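(* Let $U$ be a convex open subset of $\mathbb{R}^n$ and $f:U\to\mathbb{R}^n$ a continuous tame mapping. Assume that there exists a nowhere dense closed subset $B\subset U$ such that $f$ is a $C^1$ immersion on $U\setminus B$, that is, $f$ is $C^1$ on $U\setminus B$ and $df(x)$ is non-singular for every $x\in U\setminus B$. Suppose that: (1) the convex hull of $\{df(x):x\in U\setminus B\}$ in the space of $n\times n$ real matrices contains no singular matrix; (2) $f$ is injective on $B$. Then $f$ is injective.
   Context: A continuous map $f:U\to\mathbb{R}^n$ is tame if its graph (a subset of $\mathbb{R}^{2n}$) is subanalytic or is definable in some o-minimal structure on $(\mathbb{R},+,\cdot,<)$. *)

theory Defs
  imports "HOL-Analysis.Analysis"
begin

text \<open>
  Tameness involves subsets of all the spaces \<open>R^m\<close> simultaneously, so there \<open>R^m\<close> is the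
  topological space \<^const>\<open>Euclidean_space\<close> \<open>m\<close>, whose points are the functions
  \<open>nat \<Rightarrow> real\<close> vanishing at all \<open>i \<ge> m\<close>.
\<close>

abbreviation Rspace :: "nat \<Rightarrow> (nat \<Rightarrow> real) set"
  where "Rspace m \<equiv> topspace (Euclidean_space m)"

text \<open>Projection of \<open>R^(m+k)\<close> onto the first \<open>m\<close> coordinates.\<close>

definition proj_first :: "nat \<Rightarrow> (nat \<Rightarrow> real) \<Rightarrow> (nat \<Rightarrow> real)"
  where "proj_first m x = (\<lambda>i. if i < m then x i else 0)"

text \<open>The identification of \<open>R^m \<times> R^k\<close> with \<open>R^(m+k)\<close>.\<close>

definition juxtapose :: "nat \<Rightarrow> (nat \<Rightarrow> real) \<Rightarrow> (nat \<Rightarrow> real) \<Rightarrow> (nat \<Rightarrow> real)"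
  where "juxtapose m x y = (\<lambda>i. if i < m then x i else y (i - m))"


subsection \<open>Subanalytic sets\<close>

text \<open>
  The multi-indices of length \<open>m\<close> are the \<open>\<alpha>\<close> vanishing from \<open>m\<close> on;
  \<^const>\<open>has_sum\<close> is unconditional convergence of the power series.
\<close>

definition real_analytic_on :: "nat \<Rightarrow> ((nat \<Rightarrow> real) \<Rightarrow> real) \<Rightarrow> (nat \<Rightarrow> real) set \<Rightarrow> bool"
  where "real_analytic_on m g V \<longleftrightarrow>
    (\<forall>a\<in>V. \<exists>c :: (nat \<Rightarrow> nat) \<Rightarrow> real. \<exists>r>0. \<forall>x\<in>V. (\<forall>i<m. \<bar>x i - a i\<bar> < r) \<longrightarrow>
      ((\<lambda>\<alpha>. c \<alpha> * (\<Prod>i<m. (x i - a i) ^ \<alpha> i)) has_sum g x) {\<alpha>. \<forall>i\<ge>m. \<alpha> i = 0})"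

definition basic_analytic_set :: "nat \<Rightarrow> (nat \<Rightarrow> real) set \<Rightarrow> (nat \<Rightarrow> real) set \<Rightarrow> bool"
  where "basic_analytic_set m V A \<longleftrightarrow>
    (\<exists>Z P. finite Z \<and> finite P \<and> (\<forall>g \<in> Z \<union> P. real_analytic_on m g V) \<and>
      A = {x \<in> V. (\<forall>g\<in>Z. g x = 0) \<and> (\<forall>g\<in>P. g x > 0)})"

definition semianalytic :: "nat \<Rightarrow> (nat \<Rightarrow> real) set \<Rightarrow> bool"
  where "semianalytic m X \<longleftrightarrow> X \<subseteq> Rspace m \<and>
    (\<forall>a \<in> Rspace m. \<exists>V. openin (Euclidean_space m) V \<and> a \<in> V \<and>
      (\<exists>F. finite F \<and> (\<forall>A\<in>F. basic_analytic_set m V A) \<and> X \<inter> V = \<Union>F))"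

text \<open>
  The local condition is imposed at every point of the ambient \<open>R^m\<close>, not only at the points
  of \<open>X\<close>.
\<close>

definition subanalytic :: "nat \<Rightarrow> (nat \<Rightarrow> real) set \<Rightarrow> bool"
  where "subanalytic m X \<longleftrightarrow> X \<subseteq> Rspace m \<and>
    (\<forall>a \<in> Rspace m. \<exists>V. openin (Euclidean_space m) V \<and> a \<in> V \<and>
      (\<exists>k A. semianalytic (m + k) A \<and>
        compactin (Euclidean_space (m + k)) (Euclidean_space (m + k) closure_of A) \<and>
        X \<inter> V = proj_first m ` A))"


subsection \<open>O-minimal structures on the ordered field of real numbers\<close>

text \<open>
  \<open>Def m\<close> is the collection of definable subsets of \<open>R^m\<close>.  A definable subset of the
  line is a finite union of intervals and points; \<^const>\<open>is_interval\<close> covers all kinds of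
  intervals, including points.  As all points of the line are definable, definability is with
  parameters.
\<close>

locale o_minimal_structure =
  fixes Def :: "nat \<Rightarrow> (nat \<Rightarrow> real) set set"
  assumes boolean_algebra: "algebra (Rspace m) (Def m)"
    and times_line: "A \<in> Def m \<Longrightarrow> {x \<in> Rspace (Suc m). proj_first m x \<in> A} \<in> Def (Suc m)"
    and line_times: "A \<in> Def m \<Longrightarrow> {x \<in> Rspace (Suc m). (\<lambda>i. x (Suc i)) \<in> A} \<in> Def (Suc m)"
    and diagonal: "{x \<in> Rspace (Suc m). x 0 = x m} \<in> Def (Suc m)"
    and projection: "A \<in> Def (Suc m) \<Longrightarrow> proj_first m ` A \<in> Def m"
    and order: "{x \<in> Rspace 2. x 0 < x 1} \<in> Def 2"
    and addition: "{x \<in> Rspace 3. x 2 = x 0 + x 1} \<in> Def 3"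
    and multiplication: "{x \<in> Rspace 3. x 2 = x 0 * x 1} \<in> Def 3"
    and o_minimal: "A \<in> Def 1 \<longleftrightarrow>
      A \<subseteq> Rspace 1 \<and> (\<exists>F. finite F \<and> (\<forall>I\<in>F. is_interval I) \<and> (\<lambda>x. x 0) ` A = \<Union>F)"


subsection \<open>Tame maps\<close>

text \<open>
  Coordinates of a vector, listed in the order of \<open>from_nat_into UNIV\<close>, which enumerates the
  index type.  Subanalyticity and definability are invariant under permutations of
  coordinates, so the choice of the enumeration is immaterial.
\<close>

definition coords :: "real ^ 'n \<Rightarrow> (nat \<Rightarrow> real)"
  where "coords v = (\<lambda>i. if i < CARD('n) then v $ from_nat_into UNIV i else 0)"

lemma bij_betw_coords:
  "bij_betw (coords :: real ^ 'n \<Rightarrow> _) UNIV (Rspace CARD('n))"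
proof -
  have b: "bij_betw (from_nat_into (UNIV :: 'n set)) {..<CARD('n)} UNIV"
    by (rule bij_betw_from_nat_into_finite) simp
  define e where "e = the_inv_into {..<CARD('n)} (from_nat_into (UNIV :: 'n set))"
  have e1: "e k < CARD('n)" "from_nat_into UNIV (e k) = k" for k
    using b the_inv_into_into[of "from_nat_into (UNIV :: 'n set)" "{..<CARD('n)}" k]
      f_the_inv_into_f_bij_betw[OF b, of k]
    by (auto simp: e_def bij_betw_def)
  have e2: "e (from_nat_into UNIV i) = i" if "i < CARD('n)" for i
    using b that by (auto simp: e_def bij_betw_def the_inv_into_f_f)
  show ?thesis
  proof (rule bij_betwI[where g = "\<lambda>x. \<chi> k. x (e k)"])
    show "(coords :: real ^ 'n \<Rightarrow> _) \<in> UNIV \<rightarrow> Rspace CARD('n)"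
      by (auto simp: coords_def topspace_Euclidean_space)
  qed (auto simp: coords_def topspace_Euclidean_space vec_eq_iff fun_eq_iff e1 e2)
qed

definition graph_on :: "(real ^ 'n) set \<Rightarrow> (real ^ 'n \<Rightarrow> real ^ 'n) \<Rightarrow> (nat \<Rightarrow> real) set"
  where "graph_on U f = (\<lambda>x. juxtapose CARD('n) (coords x) (coords (f x))) ` U"

definition tame_on :: "(real ^ 'n) set \<Rightarrow> (real ^ 'n \<Rightarrow> real ^ 'n) \<Rightarrow> bool"
  where "tame_on U f \<longleftrightarrow>
    subanalytic (2 * CARD('n)) (graph_on U f) \<or>
    (\<exists>Def. o_minimal_structure Def \<and> graph_on U f \<in> Def (2 * CARD('n)))"


subsection \<open>Nowhere dense sets and immersions\<close>

definition nowhere_dense_in :: "'a topology \<Rightarrow> 'a set \<Rightarrow> bool"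
  where "nowhere_dense_in X B \<longleftrightarrow> B \<subseteq> topspace X \<and> X interior_of (X closure_of B) = {}"

text \<open>The set \<open>S\<close> is meant to be open, hence the derivatives at \<open>x\<close> rather than within \<open>S\<close>.\<close>

definition C1_on :: "(real ^ 'n \<Rightarrow> real ^ 'm) \<Rightarrow> (real ^ 'n) set \<Rightarrow> bool"
  where "C1_on f S \<longleftrightarrow>
    (\<forall>x\<in>S. f differentiable (at x)) \<and> continuous_on S (\<lambda>x. jacobian f (at x))"

definition C1_immersion_on :: "(real ^ 'n \<Rightarrow> real ^ 'n) \<Rightarrow> (real ^ 'n) set \<Rightarrow> bool"
  where "C1_immersion_on f S \<longleftrightarrow> C1_on f S \<and> (\<forall>x\<in>S. invertible (jacobian f (at x)))"

end

theory Submission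
  imports Defs "HOL-Complex_Analysis.Complex_Analysis"
begin

text \<open>
  Suppose \<open>f p = f q\<close> with \<open>p \<noteq> q\<close>.  As \<open>f\<close> is injective on \<open>B\<close>, we may take \<open>p \<notin> B\<close>, and then a local
  inverse at \<open>p\<close> gives a map \<open>G\<close> with \<open>f (G w) = f w\<close> for all \<open>w\<close> in a nonempty open set.  The
  convexity hypothesis makes each \<open>w \<mapsto> (1 - t) G w + t w\<close> an open map, so by Baire's theorem some
  segment from \<open>G w\<close> to \<open>w\<close> meets \<open>B\<close> at no rational parameter.  Separating 0 from the convex
  hull of the derivatives of \<open>f\<close> along this segment gives a functional \<open>a\<close> such that \<open>h = a \<bullet> f\<close>
  is locally nondecreasing on a dense open set of parameters, takes equal values at the ends, and is
  not locally constant.  Tameness excludes Cantor-like behaviour: \<open>h\<close> is locally nondecreasing off a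
  countable set, hence nondecreasing, a contradiction.

  In an o-minimal structure the exceptional set is definable with empty interior, hence finite.
  For a subanalytic graph, the points over the exceptional parameters lie on zero sets of analytic
  functions; these split into countably many hypersurfaces (a derivative vanishes, but one of its
  partial derivatives does not), apart from points where \<open>h\<close> is visibly \<open>C\<^sup>1\<close> or the parameter is
  locally constant, and one descends on the number of variables.
\<close>

subsection \<open>Locally nondecreasing functions\<close>

text \<open>The obstacle is that \<open>B\<close> may separate \<open>U\<close>: then every segment
  from near \<open>p\<close> to near \<open>q\<close> crosses it, and \<open>f\<close> is merely
  continuous there, so only a dense open set of parameters is under control. That is too little,
  since minus the Cantor function is continuous and locally constant on a dense open set but
  decreases. However, a continuous function with a smaller value at the right end has an exceptional
  point for every intermediate value, hence uncountably many; so tameness enters only through the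
  countability of the exceptional parameters. The separation of 0 is only weak, because the
  derivatives along the segment need not form a compact set. Taking \<open>a\<close> in the span of
  their hull makes up for this: such an \<open>a\<close> cannot be orthogonal to the whole hull.
  Local monotonicity is tracked, rather than smoothness, because it is a first-order property in the
  o-minimal case and can be read off from C^1 parametrizations in the subanalytic one. The
  subanalytic descent is of Sard type: it counts values of the parameter function and does not
  describe the exceptional set itself.\<close>

definition locally_mono_at :: "(real \<Rightarrow> real) \<Rightarrow> real \<Rightarrow> bool"
  where "locally_mono_at h t \<longleftrightarrow> (\<exists>\<epsilon>>0. mono_on {t - \<epsilon><..<t + \<epsilon>} h)"

text \<open>If \<open>h\<close> decreased between two points near \<open>\<tau> s0\<close>, the mean
  value theorem would give a parameter where \<open>y'\<close> is negative, hence negative nearby.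
  As \<open>\<tau>\<close> increases there, \<open>h\<close> would be strictly decreasing on a whole
  interval, and by density this interval contains a point where \<open>h\<close> is locally
  nondecreasing.\<close>

lemma locally_mono_at_param_pos:
  fixes \<tau> y \<tau>' y' h :: "real \<Rightarrow> real"
  assumes e: "e > 0"
    and \<tau>: "\<And>s. s \<in> ball s0 e \<Longrightarrow> (\<tau> has_real_derivative \<tau>' s) (at s)"
    and y: "\<And>s. s \<in> ball s0 e \<Longrightarrow> (y has_real_derivative y' s) (at s)"
    and cont: "continuous_on (ball s0 e) \<tau>'" "continuous_on (ball s0 e) y'"
    and pos: "\<tau>' s0 > 0"
    and eq: "\<And>s. s \<in> ball s0 e \<Longrightarrow> h (\<tau> s) = y s"
    and dense: "\<And>s. s \<in> ball s0 e \<Longrightarrow> \<tau> s \<in> closure {t. locally_mono_at h t}"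
  shows "locally_mono_at h (\<tau> s0)"
proof -
  have "open {s \<in> ball s0 e. \<tau>' s \<in> {0<..}}"
    using continuous_open_preimage[OF cont(1) open_ball, of "{0<..}"] by (simp add: vimage_def Int_def)
  moreover have "s0 \<in> {s \<in> ball s0 e. \<tau>' s \<in> {0<..}}" using e pos by simp
  ultimately obtain e1 where e1: "e1 > 0" "cball s0 e1 \<subseteq> {s \<in> ball s0 e. \<tau>' s \<in> {0<..}}"
    using open_contains_cball by metis
  have in_ball: "s \<in> ball s0 e" and \<tau>'pos: "\<tau>' s > 0" if "s \<in> {s0 - e1..s0 + e1}" for s
    using e1 that by (auto simp: subset_iff dist_real_def abs_le_iff)
  have smono: "\<tau> s < \<tau> s'" if "s0 - e1 \<le> s" "s < s'" "s' \<le> s0 + e1" for s s'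
  proof (rule DERIV_pos_imp_increasing[OF that(2)])
    fix v assume "s \<le> v" "v \<le> s'"
    then have "v \<in> {s0 - e1..s0 + e1}" using that by auto
    then show "\<exists>y. (\<tau> has_real_derivative y) (at v) \<and> 0 < y"
      using \<tau> in_ball \<tau>'pos by blast
  qed
  have c\<tau>: "continuous_on {s0 - e1..s0 + e1} \<tau>"
    using \<tau> in_ball by (meson DERIV_isCont continuous_at_imp_continuous_on)
  have ivt: "\<exists>s. a \<le> s \<and> s \<le> b \<and> \<tau> s = t" if "\<tau> a \<le> t" "t \<le> \<tau> b" "a \<le> b" "s0 - e1 \<le> a" "b \<le> s0 + e1" for a b t
    by (rule IVT'[OF that(1-3)]) (rule continuous_on_subset[OF c\<tau>], use that in auto)
  have lt: "\<tau> (s0 - e1) < \<tau> s0" "\<tau> s0 < \<tau> (s0 + e1)"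
    using smono[of "s0 - e1" s0] smono[of s0 "s0 + e1"] e1 by auto
  \<comment> \<open>With this radius every point near \<open>\<tau> s0\<close> is a value of
    \<open>\<tau>\<close> on the compact parameter interval.\<close>
  define \<epsilon> where "\<epsilon> = min (\<tau> s0 - \<tau> (s0 - e1)) (\<tau> (s0 + e1) - \<tau> s0)"
  have "\<epsilon> > 0" using lt by (simp add: \<epsilon>_def)
  moreover have "mono_on {\<tau> s0 - \<epsilon><..<\<tau> s0 + \<epsilon>} h"
  proof (rule mono_onI, rule ccontr)
    fix t1 t2 assume t: "t1 \<in> {\<tau> s0 - \<epsilon><..<\<tau> s0 + \<epsilon>}" "t2 \<in> {\<tau> s0 - \<epsilon><..<\<tau> s0 + \<epsilon>}" "t1 \<le> t2"
      "\<not> h t1 \<le> h t2"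
    have "\<tau> (s0 - e1) \<le> t1" "t1 \<le> \<tau> (s0 + e1)" "\<tau> (s0 - e1) \<le> t2" "t2 \<le> \<tau> (s0 + e1)"
      using t by (auto simp: \<epsilon>_def min_def split: if_splits)
    then obtain s1 s2 where s1: "s0 - e1 \<le> s1" "s1 \<le> s0 + e1" "\<tau> s1 = t1"
        and s2: "s0 - e1 \<le> s2" "s2 \<le> s0 + e1" "\<tau> s2 = t2"
      using ivt[of "s0 - e1" t1 "s0 + e1"] ivt[of "s0 - e1" t2 "s0 + e1"] e1 by auto
    have s12: "s1 < s2"
    proof (rule ccontr)
      assume "\<not> s1 < s2"
      then have "t2 < t1 \<or> s1 = s2" using smono[of s2 s1] s1 s2 by (cases "s1 = s2") auto
      then show False using t s1 s2 by auto
    qed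
    have ylt: "y s2 < y s1"
      using t(4) eq[OF in_ball] s1 s2 by (metis atLeastAtMost_iff not_le)
    obtain s where s: "s1 < s" "s < s2" "y s2 - y s1 = (s2 - s1) * y' s"
      using MVT2[of s1 s2 y y'] s12 y in_ball s1 s2 by force
    have "(s2 - s1) * y' s < 0" using s(3) ylt by simp
    then have neg: "y' s < 0" using s12 by (simp add: mult_less_0_iff)
    have "open {s \<in> ball s0 e. y' s \<in> {..<0}}"
      using continuous_open_preimage[OF cont(2) open_ball, of "{..<0}"] by (simp add: vimage_def Int_def)
    moreover have sb: "s \<in> {s0 - e1..s0 + e1}" using s s1 s2 by auto
    moreover have "s \<in> {s \<in> ball s0 e. y' s \<in> {..<0}}" using neg in_ball[OF sb] by simp
    ultimately obtain d1 where d1: "d1 > 0" "cball s d1 \<subseteq> {s \<in> ball s0 e. y' s \<in> {..<0}}"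
      using open_contains_cball by metis
    define d where "d = min d1 (min (s - s1) (s2 - s))"
    have d: "d > 0" "d \<le> d1" "s1 \<le> s - d" "s + d \<le> s2" using d1 s by (auto simp: d_def)
    have y'neg: "y' v < 0" if "s - d \<le> v" "v \<le> s + d" for v
    proof -
      have "v \<in> cball s d1" using that d by (auto simp: dist_real_def abs_le_iff)
      then show ?thesis using d1 by auto
    qed
    have ydec: "y v' < y v" if "s - d \<le> v" "v < v'" "v' \<le> s + d" for v v'
    proof (rule DERIV_neg_imp_decreasing[OF that(2)])
      fix w assume "v \<le> w" "w \<le> v'"
      then show "\<exists>z. (y has_real_derivative z) (at w) \<and> z < 0"
        using y[OF in_ball, of w] y'neg[of w] that d s1 s2 by force
    qed
    have "\<tau> s \<in> {\<tau> (s - d)<..<\<tau> (s + d)}"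
      using smono[of "s - d" s] smono[of s "s + d"] d s1 s2 by auto
    then obtain t where t: "t \<in> {\<tau> (s - d)<..<\<tau> (s + d)}" "locally_mono_at h t"
      using dense[OF in_ball[OF sb]] open_greaterThanLessThan[of "\<tau> (s - d)" "\<tau> (s + d)"]
      by (metis (no_types, lifting) closure_iff_nhds_not_empty disjoint_iff mem_Collect_eq subset_iff order_refl)
    obtain v where v: "s - d \<le> v" "v \<le> s + d" "\<tau> v = t"
      using ivt[of "s - d" t "s + d"] t d s1 s2 by auto
    have vlt: "v < s + d" using v t by (cases "v = s + d") auto
    obtain \<eta> where \<eta>: "\<eta> > 0" "mono_on {t - \<eta><..<t + \<eta>} h"
      using t(2) by (auto simp: locally_mono_at_def)
    \<comment> \<open>A point just to the right of \<open>t\<close>, still in the interval where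
      \<open>h\<close> is nondecreasing and still below \<open>\<tau> (s + d)\<close>, so that it
      has a parameter where \<open>y\<close> decreases.\<close>
    define t' where "t' = min (t + \<eta> / 2) (\<tau> (s + d))"
    have t': "t < t'" "t' < t + \<eta>" "t' \<le> \<tau> (s + d)" using \<eta> t by (auto simp: t'_def)
    obtain v' where v': "v \<le> v'" "v' \<le> s + d" "\<tau> v' = t'"
      using ivt[of v t' "s + d"] t' v vlt d s1 s2 by auto
    have "v < v'" using v' t' v by (cases "v = v'") auto
    then have "y v' < y v" using ydec v v' by auto
    moreover have "h t \<le> h t'"
      using mono_onD[OF \<eta>(2), of t t'] t' \<eta>(1) by auto
    moreover have "h t = y v" "h t' = y v'"
      using eq[OF in_ball] v v' d s1 s2 by auto
    ultimately show False by simp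
  qed
  ultimately show ?thesis by (auto simp: locally_mono_at_def)
qed

text \<open>A negative derivative is made positive by reversing the parameter; \<open>h\<close> is
  unaffected, as \<open>\<tau>\<close> and \<open>y\<close> are reversed together.\<close>

lemma locally_mono_at_param:
  fixes \<tau> y \<tau>' y' h :: "real \<Rightarrow> real"
  assumes e: "e > 0"
    and \<tau>: "\<And>s. s \<in> ball s0 e \<Longrightarrow> (\<tau> has_real_derivative \<tau>' s) (at s)"
    and y: "\<And>s. s \<in> ball s0 e \<Longrightarrow> (y has_real_derivative y' s) (at s)"
    and cont: "continuous_on (ball s0 e) \<tau>'" "continuous_on (ball s0 e) y'"
    and nz: "\<tau>' s0 \<noteq> 0"
    and eq: "\<And>s. s \<in> ball s0 e \<Longrightarrow> h (\<tau> s) = y s"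
    and dense: "\<And>s. s \<in> ball s0 e \<Longrightarrow> \<tau> s \<in> closure {t. locally_mono_at h t}"
  shows "locally_mono_at h (\<tau> s0)"
proof (cases "\<tau>' s0 > 0")
  case True
  with assms show ?thesis by (intro locally_mono_at_param_pos[of e s0 \<tau> \<tau>' y y'])
next
  case False
  have m: "- s \<in> ball s0 e" if "s \<in> ball (- s0) e" for s
    using that by (simp add: dist_real_def abs_minus_commute algebra_simps) 
  have "locally_mono_at h (\<tau> (- (- s0)))"
  proof (rule locally_mono_at_param_pos[where e = e and \<tau> = "\<lambda>s. \<tau> (- s)" and y = "\<lambda>s. y (- s)"
        and \<tau>' = "\<lambda>s. - \<tau>' (- s)" and y' = "\<lambda>s. - y' (- s)" and ?s0.0 = "- s0"])
    show "((\<lambda>s. \<tau> (- s)) has_real_derivative - \<tau>' (- s)) (at s)" if "s \<in> ball (- s0) e" for s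
      using \<tau>[OF m[OF that]] by (simp add: DERIV_mirror)
    show "((\<lambda>s. y (- s)) has_real_derivative - y' (- s)) (at s)" if "s \<in> ball (- s0) e" for s
      using y[OF m[OF that]] by (simp add: DERIV_mirror)
    show "continuous_on (ball (- s0) e) (\<lambda>s. - \<tau>' (- s))"
      by (intro continuous_on_minus continuous_on_compose2[OF cont(1)] continuous_on_id) (use m in auto)
    show "continuous_on (ball (- s0) e) (\<lambda>s. - y' (- s))"
      by (intro continuous_on_minus continuous_on_compose2[OF cont(2)] continuous_on_id) (use m in auto)
  qed (use False nz e eq dense m in auto)
  then show ?thesis by simp
qed

text \<open>Countably many of the neighbourhoods cover \<open>S\<close>, so countability only has to
  be checked locally. In the applications \<open>M\<close> is the set of parameters where
  \<open>h\<close> is locally nondecreasing.\<close>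

lemma countable_image_diff_Lindelof:
  fixes S :: "'a::second_countable_topology set"
  assumes "\<And>x. x \<in> S \<Longrightarrow> \<exists>N. open N \<and> x \<in> N \<and> countable (g ` (S \<inter> N) - M)"
  shows "countable (g ` S - M)"
proof -
  obtain N where N: "\<And>x. x \<in> S \<Longrightarrow> open (N x) \<and> x \<in> N x \<and> countable (g ` (S \<inter> N x) - M)"
    using assms by metis
  obtain F where F: "F \<subseteq> N ` S" "countable F" "\<Union>F = \<Union>(N ` S)"
    by (rule Lindelof[of "N ` S"]) (use N in auto)
  have "g ` S - M \<subseteq> (\<Union>V\<in>F. g ` (S \<inter> V) - M)"
  proof
    fix t assume "t \<in> g ` S - M"
    then obtain x where x: "x \<in> S" "t = g x" "t \<notin> M" by auto
    then have "x \<in> \<Union>F" using N F by auto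
    then show "t \<in> (\<Union>V\<in>F. g ` (S \<inter> V) - M)" using x by auto
  qed
  moreover have "countable (\<Union>V\<in>F. g ` (S \<inter> V) - M)"
    using F N by (intro countable_UN) auto
  ultimately show ?thesis by (rule countable_subset)
qed

text \<open>Otherwise every level strictly between \<open>h b\<close> and \<open>h a\<close> is
  attained at an exceptional point, and an uncountable interval of levels would lie in the image of
  a countable set.\<close>

lemma mono_on_countable_exceptions:
  fixes h :: "real \<Rightarrow> real"
  assumes ab: "a \<le> b" and cont: "continuous_on {a..b} h"
    and C: "countable ({a<..<b} - {t. locally_mono_at h t})"
  shows "h a \<le> h b"
proof (rule ccontr)
  assume "\<not> h a \<le> h b"
  then have lt: "h b < h a" by simp
  then have "a < b" using ab by (cases "a = b") auto
  \<comment> \<open>The last parameter where the level \<open>c\<close> is attained is exceptional.\<close>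
  have "\<exists>t. t \<in> {a<..<b} - {t. locally_mono_at h t} \<and> h t = c" if c: "c \<in> {h b<..<h a}" for c
  proof -
    define K where "K = {t \<in> {a..b}. h t \<in> {c..}}"
    have "compact K" unfolding K_def
      using continuous_closed_preimage[OF cont, of "{c..}"] 
      by (simp add: compact_eq_bounded_closed vimage_def Int_def bounded_subset[of "{a..b}"] subset_iff)
    moreover have "a \<in> K" using c ab by (simp add: K_def)
    ultimately obtain t where t: "t \<in> K" "\<And>s. s \<in> K \<Longrightarrow> s \<le> t"
      using compact_attains_sup[of K] by auto
    have tab: "a \<le> t" "t < b" using t(1) c by (auto simp: K_def less_le)
    have "h t = c"
    proof (rule ccontr)
      assume "h t \<noteq> c"
      then have "h t > c" using t(1) by (simp add: K_def)
      then obtain s where "t \<le> s" "s \<le> b" "h s = c"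
        using IVT2'[of h b c t] c tab continuous_on_subset[OF cont, of "{t..b}"] by auto
      then have "s \<in> K" using tab by (simp add: K_def)
      then show False using t(2)[of s] \<open>t \<le> s\<close> \<open>h s = c\<close> \<open>h t \<noteq> c\<close> by auto
    qed
    moreover have "t \<noteq> a" using \<open>h t = c\<close> c by auto
    moreover have "\<not> locally_mono_at h t"
    proof
      assume "locally_mono_at h t"
      then obtain \<epsilon> where \<epsilon>: "\<epsilon> > 0" "mono_on {t - \<epsilon><..<t + \<epsilon>} h" by (auto simp: locally_mono_at_def)
      define s where "s = min (t + \<epsilon> / 2) b"
      have s: "t < s" "s < t + \<epsilon>" "s \<le> b" using \<epsilon> tab by (auto simp: s_def)
      then have "h t \<le> h s" using \<epsilon> by (intro mono_onD[OF \<epsilon>(2)]) auto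
      then have "s \<in> K" using s tab \<open>h t = c\<close> by (simp add: K_def)
      then show False using t(2) s by force
    qed
    ultimately show ?thesis using tab by (auto simp: less_le)
  qed
  then have "{h b<..<h a} \<subseteq> h ` ({a<..<b} - {t. locally_mono_at h t})"
    by (metis (no_types, lifting) image_eqI subsetI)
  then have "countable {h b<..<h a}"
    using C by (meson countable_image countable_subset)
  then show False using lt uncountable_open_interval by blast
qed

section \<open>Cauchy integrals depending on parameters\<close>

lemma continuous_on_circle_integral:
  fixes K :: "'a::topological_space \<Rightarrow> complex \<Rightarrow> complex"
  assumes "continuous_on (X \<times> sphere a r) (\<lambda>(x, c). K x c)" and "r \<ge> 0"
  shows "continuous_on X (\<lambda>x. contour_integral (circlepath a r) (K x))"
proof -
  have "continuous_on (X \<times> cbox 0 1)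
      (\<lambda>(x, t). K x (circlepath a r t) * vector_derivative (circlepath a r) (at t))"
    unfolding case_prod_beta vector_derivative_circlepath
    using assms(2)
    by (intro continuous_intros
          continuous_on_compose2[OF assms(1)[unfolded case_prod_beta],
            where f = "\<lambda>p. (fst p, circlepath a r (snd p))", simplified])
       (auto simp: circlepath dist_norm norm_mult intro!: continuous_intros)
  then have "continuous_on X (\<lambda>x. integral (cbox 0 1)
      (\<lambda>t. K x (circlepath a r t) * vector_derivative (circlepath a r) (at t)))"
    by (rule integral_continuous_on_param)
  then show ?thesis
    by (simp add: contour_integral_integral)
qed

text \<open>Near a given point Cauchy's formula writes the derivative as an integral of
  \<open>F\<close> over a fixed circle, so joint continuity passes from \<open>F\<close> to its
  derivative.\<close>

lemma continuous_on_deriv_param: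
  fixes F :: "'a::t2_space \<Rightarrow> complex \<Rightarrow> complex"
  assumes W: "open W" and cont: "continuous_on (X \<times> W) (\<lambda>(x, w). F x w)"
    and hol: "\<And>x. x \<in> X \<Longrightarrow> F x holomorphic_on W"
  shows "continuous_on (X \<times> W) (\<lambda>(x, w). deriv (F x) w)"
  unfolding continuous_on_eq_continuous_within
proof safe
  fix x0 w0 assume x0: "x0 \<in> X" and w0: "w0 \<in> W"
  obtain r where r: "r > 0" "cball w0 r \<subseteq> W"
    using W w0 open_contains_cball by blast
  have eq: "deriv (F x) w = contour_integral (circlepath w0 r) (\<lambda>u. F x u / (u - w)^2) / (2 * pi * \<i>)"
    if "x \<in> X" "w \<in> ball w0 r" for x w
  proof -
    have "continuous_on (cball w0 r) (F x)" "F x holomorphic_on ball w0 r"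
      using hol[OF that(1)] r(2) ball_subset_cball[of w0 r]
      by (meson holomorphic_on_imp_continuous_on holomorphic_on_subset order_trans)+
    from Cauchy_contour_integral_circlepath_2[OF this that(2)] show ?thesis by simp
  qed
  have "continuous_on (X \<times> ball w0 r) (\<lambda>p. contour_integral (circlepath w0 r) (\<lambda>u. F (fst p) u / (u - snd p)^2) / (2 * pi * \<i>))"
  proof (intro continuous_intros continuous_on_circle_integral)
    have "continuous_on ((X \<times> ball w0 r) \<times> sphere w0 r) (\<lambda>p. F (fst (fst p)) (snd p))"
      using r by (intro continuous_on_compose2[OF cont[unfolded case_prod_beta],
            where f = "\<lambda>p. (fst (fst p), snd p)", simplified] continuous_intros) 
         (auto simp: subset_iff)
    then show "continuous_on ((X \<times> ball w0 r) \<times> sphere w0 r) (\<lambda>(p, u). F (fst p) u / (u - snd p)^2)"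
      unfolding case_prod_beta by (intro continuous_intros) auto
  qed (use r in auto)
  then have "continuous_on (X \<times> ball w0 r) (\<lambda>(x, w). deriv (F x) w)"
    by (rule continuous_on_eq) (auto simp: eq)
  then have "continuous (at (x0, w0) within X \<times> ball w0 r) (\<lambda>(x, w). deriv (F x) w)"
    using x0 r by (auto simp: continuous_on_eq_continuous_within)
  moreover have "at (x0, w0) within X \<times> ball w0 r = at (x0, w0) within X \<times> W"
    by (rule at_within_nhd[where S = "UNIV \<times> ball w0 r"]) 
       (use r ball_subset_cball[of w0 r] in \<open>auto intro!: open_Times\<close>)
  ultimately show "continuous (at (x0, w0) within X \<times> W) (\<lambda>(x, w). deriv (F x) w)"
    by simp
qed

subsection \<open>Holomorphic functions of several variables\<close>

text \<open>
  The number of variables changes in the inductions and in the definition of subanalytic sets, so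
  points are functions \<open>nat \<Rightarrow> complex\<close> with the product topology, and finitely many variables
  are singled out by \<open>depends_on\<close> below.
\<close>

definition partial :: "nat \<Rightarrow> ((nat \<Rightarrow> complex) \<Rightarrow> complex) \<Rightarrow> (nat \<Rightarrow> complex) \<Rightarrow> complex"
  where "partial i F z = deriv (\<lambda>w. F (z(i := w))) (z i)"

text \<open>For finitely many variables this is ordinary holomorphy, by Osgood's lemma. With
  continuity built in, every closure property reduces to one-variable Cauchy integrals.\<close>

definition sep_hol :: "(nat \<Rightarrow> complex) set \<Rightarrow> ((nat \<Rightarrow> complex) \<Rightarrow> complex) \<Rightarrow> bool"
  where "sep_hol P F \<longleftrightarrow> continuous_on P F \<and>
    (\<forall>z\<in>P. \<forall>i. (\<lambda>w. F (z(i := w))) field_differentiable at (z i))"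

lemma continuous_on_update:
  fixes f :: "'a::topological_space \<Rightarrow> nat \<Rightarrow> 'b::topological_space"
  assumes "continuous_on S f" "continuous_on S g"
  shows "continuous_on S (\<lambda>x. (f x)(i := g x))"
proof (rule continuous_on_coordinatewise_then_product)
  fix j show "continuous_on S (\<lambda>x. ((f x)(i := g x)) j)"
    using assms continuous_on_product_then_coordinatewise[of S f j] by (cases "i = j") auto
qed

lemma open_update_slice:
  fixes P :: "(nat \<Rightarrow> 'b::topological_space) set"
  assumes "open P" shows "open {w. z(i := w) \<in> P}"
proof -
  have "continuous_on UNIV (\<lambda>w. z(i := w))"
    by (rule continuous_on_update) (auto intro: continuous_intros)
  from open_vimage[OF assms this] show ?thesis
    by (simp add: vimage_def)
qed

lemma sep_holD:
  assumes "sep_hol P F" "open P"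
  shows "(\<lambda>w. F (z(i := w))) holomorphic_on {w. z(i := w) \<in> P}"
proof -
  have "(\<lambda>w. F (z(i := w))) field_differentiable at w" if "z(i := w) \<in> P" for w
    using assms(1) that unfolding sep_hol_def by (force dest!: bspec[where x = "z(i := w)"] spec[where x = i])
  then show ?thesis
    using holomorphic_on_open[OF open_update_slice[OF assms(2)]]
    by (auto simp: field_differentiable_def)
qed

lemma sep_hol_subset: "sep_hol P F \<Longrightarrow> Q \<subseteq> P \<Longrightarrow> sep_hol Q F"
  by (auto simp: sep_hol_def intro: continuous_on_subset)

lemma sep_hol_cong:
  assumes "sep_hol P F" "open P" "\<And>z. z \<in> P \<Longrightarrow> F z = G z"
  shows "sep_hol P G"
  unfolding sep_hol_def
proof safe
  show "continuous_on P G"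
    using assms unfolding sep_hol_def by (metis continuous_on_cong)
  fix z i assume z: "z \<in> P"
  have "(\<lambda>w. F (z(i := w))) holomorphic_on {w. z(i := w) \<in> P}"
    by (rule sep_holD[OF assms(1,2)])
  then have "(\<lambda>w. G (z(i := w))) holomorphic_on {w. z(i := w) \<in> P}"
    by (rule holomorphic_transform) (use assms in auto)
  then show "(\<lambda>w. G (z(i := w))) field_differentiable at (z i)"
    by (rule holomorphic_on_imp_differentiable_at) (use z open_update_slice[OF assms(2)] in auto)
qed

lemma sep_hol_local:
  assumes "\<And>z. z \<in> P \<Longrightarrow> \<exists>N. open N \<and> z \<in> N \<and> sep_hol N F"
  shows "sep_hol P F"
  unfolding sep_hol_def
proof safe
  have "isCont F z" if "z \<in> P" for z
    using assms[OF that] by (auto simp: sep_hol_def continuous_on_eq_continuous_at)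
  then show "continuous_on P F"
    by (simp add: continuous_at_imp_continuous_on)
  show "(\<lambda>w. F (z(i := w))) field_differentiable at (z i)" if "z \<in> P" for z i
    using assms[OF that] by (auto simp: sep_hol_def)
qed

text \<open>Differentiation under the integral sign, with the circle integral rewritten over the
  unit interval. The joint continuity of the differentiated integrand comes from
  \<open>continuous_on_deriv_param\<close>, with the point of the circle as parameter.\<close>

lemma sep_hol_circle_integral:
  fixes K :: "(nat \<Rightarrow> complex) \<Rightarrow> complex \<Rightarrow> complex"
  assumes P: "open P" and cont: "continuous_on (P \<times> sphere a r) (\<lambda>(z, c). K z c)" and r: "r \<ge> 0"
    and hol: "\<And>z c i. z \<in> P \<Longrightarrow> c \<in> sphere a r \<Longrightarrow> (\<lambda>w. K (z(i := w)) c) field_differentiable at (z i)"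
  shows "sep_hol P (\<lambda>z. contour_integral (circlepath a r) (K z))"
  unfolding sep_hol_def
proof safe
  show "continuous_on P (\<lambda>z. contour_integral (circlepath a r) (K z))"
    by (rule continuous_on_circle_integral[OF cont r])
  fix z i assume z: "z \<in> P"
  obtain e where e: "e > 0" "ball (z i) e \<subseteq> {w. z(i := w) \<in> P}"
    using open_update_slice[OF P, of z i] z by (auto elim!: openE[where x = "z i"])
  let ?W = "ball (z i) e"
  define f where "f w t = K (z(i := w)) (circlepath a r t) * vector_derivative (circlepath a r) (at t)" for w t
  define fx where "fx w t = deriv (\<lambda>w. K (z(i := w)) (circlepath a r t)) w * vector_derivative (circlepath a r) (at t)" for w t
  have sph: "circlepath a r t \<in> sphere a r" for t
    using r by (auto simp: circlepath dist_norm norm_mult)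
  have cc: "continuous_on S (circlepath a r)" for S
    unfolding circlepath by (intro continuous_intros)
  have fd: "(\<lambda>w. K (z(i := w)) c) field_differentiable at w" if "w \<in> ?W" "c \<in> sphere a r" for w c
    using hol[of "z(i := w)" c i] that e by auto
  have *: "continuous_on (?W \<times> sphere a r) (\<lambda>p. K (z(i := fst p)) (snd p))"
    by (rule continuous_on_compose2[OF cont[unfolded case_prod_beta],
            where f = "\<lambda>p. (z(i := fst p), snd p)", simplified])
       (use e in \<open>auto intro!: continuous_on_update continuous_on_Pair continuous_on_fst continuous_on_snd continuous_on_id continuous_on_const\<close>)
  have "continuous_on (sphere a r \<times> ?W) (\<lambda>(c, w). deriv (\<lambda>w. K (z(i := w)) c) w)"
  proof (rule continuous_on_deriv_param)
    show "continuous_on (sphere a r \<times> ?W) (\<lambda>(c, w). K (z(i := w)) c)"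
      unfolding case_prod_beta
      by (rule continuous_on_compose2[OF *, where f = "\<lambda>p. (snd p, fst p)", simplified])
        (auto intro!: continuous_on_Pair continuous_on_fst continuous_on_snd continuous_on_id)
  next
    fix c assume c: "c \<in> sphere a r"
    show "(\<lambda>w. K (z(i := w)) c) holomorphic_on ?W"
      unfolding holomorphic_on_def using fd[OF _ c] field_differentiable_at_within by blast
  qed auto
  then have "continuous_on (?W \<times> cbox (0::real) 1)
      (\<lambda>p. case (circlepath a r (snd p), fst p) of (c, w) \<Rightarrow> deriv (\<lambda>w. K (z(i := w)) c) w)"
    by (rule continuous_on_compose2)
      (use sph in \<open>auto intro!: continuous_on_Pair continuous_on_compose2[OF cc] continuous_on_fst continuous_on_snd continuous_on_id\<close>)
  then have fxc: "continuous_on (?W \<times> cbox 0 1) (\<lambda>(w, t). fx w t)"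
    unfolding fx_def case_prod_beta vector_derivative_circlepath fst_conv snd_conv
    by (rule continuous_on_mult) (intro continuous_intros)
  have "(\<lambda>w. integral (cbox 0 1) (f w)) holomorphic_on ?W"
  proof (rule leibniz_rule_holomorphic[OF _ _ fxc])
    fix w t assume w: "w \<in> ?W" "t \<in> cbox (0::real) 1"
    have "((\<lambda>w. K (z(i := w)) (circlepath a r t)) has_field_derivative deriv (\<lambda>w. K (z(i := w)) (circlepath a r t)) w) (at w)"
      using fd[OF w(1) sph] by (simp add: DERIV_deriv_iff_field_differentiable)
    then have "((\<lambda>w. K (z(i := w)) (circlepath a r t)) has_field_derivative deriv (\<lambda>w. K (z(i := w)) (circlepath a r t)) w) (at w within ?W)"
      by (rule has_field_derivative_at_within)
    then show "((\<lambda>w. f w t) has_field_derivative fx w t) (at w within ?W)"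
      unfolding f_def fx_def by (rule DERIV_cmult_right)
  next
    fix w assume w: "w \<in> ?W"
    have "continuous_on (cbox 0 1) (\<lambda>t. K (z(i := w)) (circlepath a r t))"
      by (rule continuous_on_compose2[OF *, where f = "\<lambda>t. (w, circlepath a r t)", simplified])
        (use w sph in \<open>auto intro!: continuous_on_Pair continuous_on_const cc\<close>)
    then show "f w integrable_on cbox 0 1"
      unfolding f_def vector_derivative_circlepath
      by (intro integrable_continuous continuous_intros) auto
  qed auto
  then have "(\<lambda>w. contour_integral (circlepath a r) (K (z(i := w)))) holomorphic_on ?W"
    by (simp add: f_def[abs_def] contour_integral_integral)
  then show "(\<lambda>w. contour_integral (circlepath a r) (K (z(i := w)))) field_differentiable at (z i)"
    by (rule holomorphic_on_imp_differentiable_at) (use e in auto)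
qed

lemma sep_hol_slice_disc:
  assumes "sep_hol P F" "open P" "\<And>w. w \<in> cball c \<rho> \<Longrightarrow> z(i := w) \<in> P"
  shows "continuous_on (cball c \<rho>) (\<lambda>w. F (z(i := w)))" "(\<lambda>w. F (z(i := w))) holomorphic_on cball c \<rho>"
proof -
  show "(\<lambda>w. F (z(i := w))) holomorphic_on cball c \<rho>"
    by (rule holomorphic_on_subset[OF sep_holD[OF assms(1,2)]]) (use assms(3) in auto)
  then show "continuous_on (cball c \<rho>) (\<lambda>w. F (z(i := w)))"
    by (rule holomorphic_on_imp_continuous_on)
qed

lemma sep_hol_fix:
  assumes "sep_hol P F" "z(i := c) \<in> P"
  shows "(\<lambda>w. F (z(j := w, i := c))) field_differentiable at (z j)"
proof (cases "j = i")
  case False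
  have "(\<lambda>w. F ((z(i := c))(j := w))) field_differentiable at ((z(i := c)) j)"
    using assms unfolding sep_hol_def by blast
  then show ?thesis using False by (simp add: fun_upd_twist)
qed simp

lemma continuous_on_sep_hol_update:
  assumes "sep_hol P F" "\<And>z c. z \<in> N \<Longrightarrow> c \<in> C \<Longrightarrow> z(i := c) \<in> P"
  shows "continuous_on (N \<times> C) (\<lambda>p. F ((fst p)(i := snd p)))"
proof (rule continuous_on_compose2[where g = F and t = P])
  show "continuous_on (N \<times> C) (\<lambda>p. (fst p)(i := snd p))"
    by (intro continuous_on_update continuous_on_fst continuous_on_snd continuous_on_id)
qed (use assms in \<open>auto simp: sep_hol_def\<close>)

text \<open>For all \<open>y\<close> near \<open>z\<close> the slices in direction \<open>i\<close>
  contain one common disc around \<open>z i\<close>. Cauchy's formula over its fixed boundary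
  expresses the partial derivative as an integral whose integrand is holomorphic in
  \<open>y\<close>.\<close>

lemma sep_hol_partial:
  assumes P: "open P" and F: "sep_hol P F"
  shows "sep_hol P (partial i F)"
proof (rule sep_hol_local)
  fix z assume z: "z \<in> P"
  have "open ((\<lambda>p. (fst p)(i := snd p)) -` P :: ((nat \<Rightarrow> complex) \<times> complex) set)"
    by (intro open_vimage P continuous_on_update continuous_on_fst continuous_on_snd continuous_on_id)
  then obtain A B where AB: "open A" "open B" "z \<in> A" "z i \<in> B"
      "A \<times> B \<subseteq> (\<lambda>p. (fst p)(i := snd p)) -` P"
    using z by (auto elim!: open_prod_elim[where x = "(z, z i)"])
  obtain r where r: "r > 0" "cball (z i) r \<subseteq> B"
    using AB open_contains_cball by blast
  define N where "N = A \<inter> {y. y i \<in> ball (z i) r}"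
  have inP: "y(i := w) \<in> P" if "y \<in> N" "w \<in> cball (z i) r" for y w
  proof -
    have "(y, w) \<in> A \<times> B" using that r by (auto simp: N_def)
    with AB(5) show ?thesis by auto
  qed
  have oN: "open N"
    unfolding N_def using AB open_vimage[OF open_ball continuous_on_product_coordinates[of i], of "z i" r]
    by (auto simp: vimage_def)
  have ci: "continuous_on S (\<lambda>p. fst p i)" for S :: "((nat \<Rightarrow> complex) \<times> complex) set"
    by (rule continuous_on_compose2[OF continuous_on_product_coordinates[of i]]) (auto intro: continuous_intros)
  have "sep_hol N (\<lambda>y. contour_integral (circlepath (z i) r) (\<lambda>u. F (y(i := u)) / (u - y i)^2 / (2 * pi * \<i>)))"
  proof (rule sep_hol_circle_integral[OF oN])
    have "continuous_on (N \<times> sphere (z i) r) (\<lambda>p. F ((fst p)(i := snd p)))"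
      by (rule continuous_on_sep_hol_update[OF F]) (use inP in auto)
    then show "continuous_on (N \<times> sphere (z i) r) (\<lambda>(y, u). F (y(i := u)) / (u - y i)^2 / (2 * pi * \<i>))"
      unfolding case_prod_beta
      by (intro continuous_intros ci) (auto simp: N_def)
  next
    fix y c j assume y: "y \<in> N" "c \<in> sphere (z i) r"
    have "(\<lambda>w. F (y(j := w, i := c))) field_differentiable at (y j)"
      by (rule sep_hol_fix[OF F]) (use y inP in auto)
    moreover have "(\<lambda>w. (y(j := w)) i) field_differentiable at (y j)"
      by (cases "i = j") auto
    moreover have "c \<noteq> y i" using y by (auto simp: N_def)
    ultimately show "(\<lambda>w. F (y(j := w, i := c)) / (c - (y(j := w)) i)^2 / (2 * pi * \<i>)) field_differentiable at (y j)"
      by (intro derivative_intros field_differentiable_divide field_differentiable_power field_differentiable_diff) auto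
  qed (use r in auto)
  moreover have "contour_integral (circlepath (z i) r) (\<lambda>u. F (y(i := u)) / (u - y i)^2 / (2 * pi * \<i>)) = partial i F y"
    if y: "y \<in> N" for y
  proof -
    have c: "continuous_on (cball (z i) r) (\<lambda>w. F (y(i := w)))" "(\<lambda>w. F (y(i := w))) holomorphic_on ball (z i) r"
      using sep_hol_slice_disc[OF F P inP[OF y], of "z i" r] ball_subset_cball holomorphic_on_subset by blast+
    have yi: "y i \<in> ball (z i) r" using y by (auto simp: N_def)
    have "(\<lambda>u. F (y(i := u)) / (u - y i)^2) contour_integrable_on (circlepath (z i) r)"
      using Cauchy_derivative_integral_circlepath(1)[OF c yi] .
    then have "contour_integral (circlepath (z i) r) (\<lambda>u. F (y(i := u)) / (u - y i)^2 / (2 * pi * \<i>)) =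
      contour_integral (circlepath (z i) r) (\<lambda>u. F (y(i := u)) / (u - y i)^2) / (2 * pi * \<i>)"
      by (rule contour_integral_div)
    then show ?thesis
      unfolding partial_def using Cauchy_contour_integral_circlepath_2[OF c yi] by simp
  qed
  ultimately have "sep_hol N (partial i F)"
    using sep_hol_cong oN by blast
  moreover have "z \<in> N" using z AB r by (auto simp: N_def)
  ultimately show "\<exists>N. open N \<and> z \<in> N \<and> sep_hol N (partial i F)"
    using oN by blast
qed

lemma sep_hol_const: "sep_hol P (\<lambda>z. c)"
  by (simp add: sep_hol_def)

lemma sep_hol_coord: "sep_hol P (\<lambda>z. z i)"
proof -
  have "continuous_on P (\<lambda>z. z i :: complex)"
    by (rule continuous_on_subset[OF continuous_on_product_coordinates]) simp
  moreover have "(\<lambda>w. (z(j := w)) i) field_differentiable at (z j)" for j and z :: "nat \<Rightarrow> complex"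
    by (cases "i = j") auto
  ultimately show ?thesis by (simp add: sep_hol_def)
qed

lemma sep_hol_add: "sep_hol P F \<Longrightarrow> sep_hol P G \<Longrightarrow> sep_hol P (\<lambda>z. F z + G z)"
  and sep_hol_mult: "sep_hol P F \<Longrightarrow> sep_hol P G \<Longrightarrow> sep_hol P (\<lambda>z. F z * G z)"
  and sep_hol_diff: "sep_hol P F \<Longrightarrow> sep_hol P G \<Longrightarrow> sep_hol P (\<lambda>z. F z - G z)"
  by (auto simp: sep_hol_def intro!: continuous_intros field_differentiable_add field_differentiable_mult field_differentiable_diff)

lemma sep_hol_power: "sep_hol P F \<Longrightarrow> sep_hol P (\<lambda>z. F z ^ k)"
  by (induction k) (auto intro: sep_hol_const sep_hol_mult)

lemma sep_hol_sum: "(\<And>i. i \<in> I \<Longrightarrow> sep_hol P (F i)) \<Longrightarrow> sep_hol P (\<lambda>z. \<Sum>i\<in>I. F i z)"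
  by (induction I rule: infinite_finite_induct) (auto intro: sep_hol_const sep_hol_add)

lemma sep_hol_prod: "(\<And>i. i \<in> I \<Longrightarrow> sep_hol P (F i)) \<Longrightarrow> sep_hol P (\<lambda>z. \<Prod>i\<in>I. F i z)"
  by (induction I rule: infinite_finite_induct) (auto intro: sep_hol_const sep_hol_mult)

section \<open>Iterated partial derivatives and the identity theorem\<close>

definition partials :: "nat list \<Rightarrow> ((nat \<Rightarrow> complex) \<Rightarrow> complex) \<Rightarrow> (nat \<Rightarrow> complex) \<Rightarrow> complex"
  where "partials l F = foldr partial l F"

lemma partials_simps [simp]: "partials [] F = F" "partials (i # l) F = partial i (partials l F)"
  by (simp_all add: partials_def)

lemma sep_hol_partials: "open P \<Longrightarrow> sep_hol P F \<Longrightarrow> sep_hol P (partials l F)"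
  by (induction l) (auto intro: sep_hol_partial)

lemma deriv_funpow_update:
  "(deriv ^^ k) (\<lambda>w. F (z(j := w))) = (\<lambda>w. (partial j ^^ k) F (z(j := w)))"
proof (induction k)
  case (Suc k)
  have "(deriv ^^ Suc k) (\<lambda>w. F (z(j := w))) = deriv (\<lambda>w. (partial j ^^ k) F (z(j := w)))"
    by (simp only: funpow.simps o_apply Suc.IH)
  also have "\<dots> = (\<lambda>w. partial j ((partial j ^^ k) F) (z(j := w)))"
    by (simp only: partial_def fun_upd_upd fun_upd_same)
  also have "\<dots> = (\<lambda>w. (partial j ^^ Suc k) F (z(j := w)))"
    by simp
  finally show ?case .
qed simp

text \<open>The coordinates from \<open>m\<close> on are free, as openness in the product topology
  demands. Every slice is therefore a disc or the whole plane.\<close>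

definition polydisc :: "nat \<Rightarrow> (nat \<Rightarrow> complex) \<Rightarrow> real \<Rightarrow> (nat \<Rightarrow> complex) set"
  where "polydisc m a r = {z. \<forall>i<m. z i \<in> ball (a i) r}"

lemma open_polydisc: "open (polydisc m a r)"
proof -
  have "polydisc m a r = (\<Inter>i\<in>{..<m}. (\<lambda>z. z i) -` ball (a i) r)"
    by (auto simp: polydisc_def)
  moreover have "open (\<Inter>i\<in>{..<m}. (\<lambda>z. z i) -` ball (a i) r)"
    by (intro open_INT finite_lessThan ballI open_vimage continuous_on_product_coordinates) auto
  ultimately show ?thesis by simp
qed

lemma polydisc_basis:
  assumes "open P" "a \<in> P"
  obtains m r where "r > 0" "polydisc m a r \<subseteq> P"
proof -
  obtain X where X: "a \<in> Pi\<^sub>E UNIV X" "\<And>i. open (X i)" "finite {i. X i \<noteq> UNIV}" "Pi\<^sub>E UNIV X \<subseteq> P"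
    using product_topology_open_contains_basis[OF assms(1)[unfolded open_fun_def] assms(2)] by auto
  obtain m where m: "\<And>i. X i \<noteq> UNIV \<Longrightarrow> i < m"
    using X(3) finite_nat_set_iff_bounded[of "{i. X i \<noteq> UNIV}"] by auto
  have "\<exists>r>0. ball (a i) r \<subseteq> X i" for i
    using X(1) X(2)[of i] open_contains_ball[of "X i"] by (auto simp: PiE_def)
  then obtain e where e: "\<And>i. e i > 0" "\<And>i. ball (a i) (e i) \<subseteq> X i"
    by metis
  define r where "r = Min (insert 1 (e ` {..<m}))"
  have "r > 0" using e(1) by (auto simp: r_def)
  moreover have "polydisc m a r \<subseteq> P"
  proof
    fix z assume z: "z \<in> polydisc m a r"
    have "z i \<in> X i" for i
    proof (cases "i < m")
      case True
      then have "r \<le> e i" by (auto simp: r_def)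
      with z True e(2)[of i] show ?thesis by (force simp: polydisc_def)
    next
      case False
      then show ?thesis using m[of i] by auto
    qed
    then show "z \<in> P" using X(4) by (auto simp: PiE_def)
  qed
  ultimately show thesis by (rule that)
qed

text \<open>Identity theorem by induction on the set of coordinates in which \<open>z\<close> may
  differ from \<open>b\<close>. Resetting one coordinate \<open>j\<close> to \<open>b j\<close>
  gives a point to which the induction hypothesis applies for every iterated
  \<open>j\<close>-derivative of \<open>F\<close>; so the slice in direction \<open>j\<close>
  vanishes to infinite order at \<open>b j\<close>.\<close>

lemma zero_if_partials_zero:
  assumes "finite J" "sep_hol (polydisc m a r) F" "b \<in> polydisc m a r" "z \<in> polydisc m a r"
    "\<And>l. set l \<subseteq> J \<Longrightarrow> partials l F b = 0" "\<And>i. i \<notin> J \<Longrightarrow> z i = b i"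
  shows "F z = 0"
  using assms
proof (induction J arbitrary: F z rule: finite_induct)
  case empty
  then have "z = b" by auto
  then show ?case using empty(4)[of "[]"] by simp
next
  case (insert j J)
  define P where "P = polydisc m a r"
  define z' where "z' = z(j := b j)"
  have P: "open P" by (simp add: P_def open_polydisc)
  have z': "z' \<in> P" using insert.prems by (auto simp: z'_def polydisc_def P_def)
  have pow: "(partial j ^^ k) F = partials (replicate k j) F" for k
    by (induction k) auto
  have zero: "(partial j ^^ k) F z' = 0" for k
  proof (rule insert.IH[where F = "(partial j ^^ k) F" and z = z'])
    show "sep_hol (polydisc m a r) ((partial j ^^ k) F)"
      unfolding pow using P insert.prems(1) by (auto simp: P_def intro: sep_hol_partials)
    fix l assume l: "set l \<subseteq> J"
    have "partials l ((partial j ^^ k) F) b = partials (l @ replicate k j) F b"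
      unfolding pow by (simp add: partials_def)
    also have "\<dots> = 0"
      by (rule insert.prems(4)) (use l in \<open>auto split: if_splits\<close>)
    finally show "partials l ((partial j ^^ k) F) b = 0" .
  next
    fix i assume "i \<notin> J"
    then show "z' i = b i" using insert.prems(5)[of i] by (auto simp: z'_def)
  qed (use insert.prems z' P_def in auto)
  let ?D = "{w. z'(j := w) \<in> P}"
  \<comment> \<open>Both cases are connected, which the one-variable identity theorem
    requires.\<close>
  have D: "?D = (if j < m then ball (a j) r else UNIV)"
    using z' by (auto simp: P_def polydisc_def)
  have "F (z'(j := z j)) = 0"
  proof (rule holomorphic_fun_eq_0_on_connected[where f = "\<lambda>w. F (z'(j := w))" and S = ?D and z = "b j"])
    show "(\<lambda>w. F (z'(j := w))) holomorphic_on ?D"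
      by (rule sep_holD) (use P insert.prems P_def in auto)
    show "open ?D" "connected ?D" unfolding D by auto
    have "z'(j := b j) = z'" by (simp add: z'_def)
    then show "b j \<in> ?D" using z' by simp
    show "(deriv ^^ n) (\<lambda>w. F (z'(j := w))) (b j) = 0" for n
      unfolding deriv_funpow_update \<open>z'(j := b j) = z'\<close> by (rule zero)
    show "z j \<in> ?D" using insert.prems by (simp add: z'_def P_def)
  qed
  then show ?case by (simp add: z'_def)
qed

subsection \<open>Values on real zero sets\<close>

definition emb :: "(nat \<Rightarrow> real) \<Rightarrow> nat \<Rightarrow> complex"
  where "emb x = (\<lambda>i. of_real (x i))"

definition real_on :: "(nat \<Rightarrow> complex) set \<Rightarrow> ((nat \<Rightarrow> complex) \<Rightarrow> complex) \<Rightarrow> bool"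
  where "real_on P F \<longleftrightarrow> (\<forall>x. emb x \<in> P \<longrightarrow> F (emb x) \<in> \<real>)"

lemma emb_update: "emb (x(i := t)) = (emb x)(i := of_real t)"
  by (auto simp: emb_def)

lemma continuous_on_emb: "continuous_on S emb"
  unfolding emb_def
  by (intro continuous_on_coordinatewise_then_product continuous_on_of_real 
      continuous_on_subset[OF continuous_on_product_coordinates]) auto

lemma has_vector_derivative_slice:
  assumes "open P" "sep_hol P F" "emb x \<in> P"
  shows "((\<lambda>t. F (emb (x(i := t)))) has_vector_derivative partial i F (emb x)) (at (x i))"
proof -
  have "(\<lambda>w. F ((emb x)(i := w))) field_differentiable at (emb x i)"
    using assms by (auto simp: sep_hol_def)
  then have "((\<lambda>w. F ((emb x)(i := w))) has_field_derivative partial i F (emb x)) (at (of_real (x i)))"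
    by (simp add: partial_def emb_def field_differentiable_derivI)
  then have "((\<lambda>t. F ((emb x)(i := of_real t))) has_vector_derivative partial i F (emb x)) (at (x i))"
    by (rule has_vector_derivative_real_field)
  then show ?thesis by (simp add: emb_update)
qed

lemma eventually_slice:
  assumes "open P" "emb x \<in> P"
  shows "eventually (\<lambda>t. emb (x(i := t)) \<in> P) (nhds (x i))"
proof -
  have "open ((\<lambda>t. emb (x(i := t))) -` P)"
    by (intro open_vimage assms continuous_on_compose2[OF continuous_on_emb[of UNIV]] continuous_on_update
        continuous_on_const continuous_on_id) auto
  moreover have "x i \<in> (\<lambda>t. emb (x(i := t))) -` P" using assms by simp
  ultimately show ?thesis
    unfolding eventually_nhds by blast
qed

text \<open>At a real point the derivative can be taken along the real axis, where the imaginary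
  part of \<open>F\<close> is identically zero.\<close>

lemma real_on_partial:
  assumes "open P" "sep_hol P F" "real_on P F"
  shows "real_on P (partial i F)"
  unfolding real_on_def
proof safe
  fix x assume x: "emb x \<in> P"
  let ?g = "\<lambda>t. F (emb (x(i := t)))"
  have "((\<lambda>t. Im (?g t)) has_vector_derivative Im (partial i F (emb x))) (at (x i))"
    by (rule bounded_linear.has_vector_derivative[OF bounded_linear_Im has_vector_derivative_slice[OF assms(1,2) x]])
  moreover have "((\<lambda>t. Im (?g t)) has_vector_derivative 0) (at (x i))"
  proof -
    obtain S where S: "open S" "x i \<in> S" "\<And>t. t \<in> S \<Longrightarrow> emb (x(i := t)) \<in> P"
      using eventually_slice[OF assms(1) x, of i] unfolding eventually_nhds by blast
    have "Im (?g t) = 0" if "t \<in> S" for t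
      using assms(3) S(3)[OF that] unfolding real_on_def complex_is_Real_iff by blast
    then show ?thesis
      by (intro has_vector_derivative_transform_within_open[OF has_vector_derivative_const S(1,2)]) simp
  qed
  ultimately have "Im (partial i F (emb x)) = 0"
    by (rule vector_derivative_unique_at)
  then show "partial i F (emb x) \<in> \<real>"
    by (simp add: complex_is_Real_iff)
qed

lemma real_on_partials: "open P \<Longrightarrow> sep_hol P F \<Longrightarrow> real_on P F \<Longrightarrow> real_on P (partials l F)"
  by (induction l) (auto intro: real_on_partial sep_hol_partials)

section \<open>Functions of finitely many coordinates and their restriction to a smooth zero
  set\<close>

definition depends_on :: "nat set \<Rightarrow> ((nat \<Rightarrow> 'a) \<Rightarrow> 'b) \<Rightarrow> bool"
  where "depends_on I F \<longleftrightarrow> (\<forall>z z'. (\<forall>i\<in>I. z i = z' i) \<longrightarrow> F z = F z')"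

lemma depends_onD: "depends_on I F \<Longrightarrow> (\<And>i. i \<in> I \<Longrightarrow> z i = z' i) \<Longrightarrow> F z = F z'"
  by (auto simp: depends_on_def)

lemma partial_not_depends:
  assumes "depends_on I F" "i \<notin> I" shows "partial i F = (\<lambda>z. 0)"
proof
  fix z
  have "F (z(i := w)) = F z" for w
    by (rule depends_onD[OF assms(1)]) (use assms(2) in auto)
  then show "partial i F z = 0" by (simp add: partial_def)
qed

lemma depends_on_partial:
  assumes "depends_on I F" shows "depends_on I (partial i F)"
proof (cases "i \<in> I")
  case True
  show ?thesis unfolding depends_on_def
  proof safe
    fix z z' :: "nat \<Rightarrow> complex" assume eq: "\<forall>i\<in>I. z i = z' i"
    have "F (z(i := w)) = F (z'(i := w))" for w
      by (rule depends_onD[OF assms]) (use eq in auto)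
    then show "partial i F z = partial i F z'" using eq True by (simp add: partial_def)
  qed
qed (simp add: partial_not_depends[OF assms] depends_on_def)

lemma depends_on_partials: "depends_on I F \<Longrightarrow> depends_on I (partials l F)"
  by (induction l) (auto intro: depends_on_partial)

text \<open>
  On a slice where \<open>u\<close> has exactly one zero, a simple one, the logarithmic derivative of \<open>u\<close> has
  residue 1 there, so this integral is the value of \<open>F\<close> at that zero.  It depends holomorphically
  on the other coordinates without any implicit function theorem.
\<close>

definition restrict_zero :: "nat \<Rightarrow> complex \<Rightarrow> real \<Rightarrow> ((nat \<Rightarrow> complex) \<Rightarrow> complex) \<Rightarrow>
    ((nat \<Rightarrow> complex) \<Rightarrow> complex) \<Rightarrow> (nat \<Rightarrow> complex) \<Rightarrow> complex"
  where "restrict_zero i c \<rho> u F z = contour_integral (circlepath c \<rho>)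
    (\<lambda>w. F (z(i := w)) * partial i u (z(i := w)) / u (z(i := w)) / (2 * pi * \<i>))"

lemma depends_on_restrict_zero:
  assumes "depends_on I F" "depends_on I u"
  shows "depends_on (I - {i}) (restrict_zero i c \<rho> u F)"
  unfolding depends_on_def
proof safe
  fix z z' :: "nat \<Rightarrow> complex" assume eq: "\<forall>j\<in>I - {i}. z j = z' j"
  have *: "H (z(i := w)) = H (z'(i := w))" if "depends_on I H" for H :: "_ \<Rightarrow> complex" and w
    by (rule depends_onD[OF that]) (use eq in auto)
  show "restrict_zero i c \<rho> u F z = restrict_zero i c \<rho> u F z'"
    unfolding restrict_zero_def *[OF assms(1)] *[OF assms(2)] *[OF depends_on_partial[OF assms(2)]] ..
qed

lemma sep_hol_restrict_zero:
  assumes P: "open P" "sep_hol P F" "sep_hol P u" and N: "open N" and \<rho>: "\<rho> > 0"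
    and inP: "\<And>z w. z \<in> N \<Longrightarrow> w \<in> sphere c \<rho> \<Longrightarrow> z(i := w) \<in> P"
    and nz: "\<And>z w. z \<in> N \<Longrightarrow> w \<in> sphere c \<rho> \<Longrightarrow> u (z(i := w)) \<noteq> 0"
  shows "sep_hol N (restrict_zero i c \<rho> u F)"
  unfolding restrict_zero_def
proof (rule sep_hol_circle_integral[OF N])
  show "continuous_on (N \<times> sphere c \<rho>)
     (\<lambda>(z, w). F (z(i := w)) * partial i u (z(i := w)) / u (z(i := w)) / (2 * pi * \<i>))"
  proof -
    have "continuous_on (N \<times> sphere c \<rho>) (\<lambda>p. H ((fst p)(i := snd p)))" if "sep_hol P H" for H
      by (rule continuous_on_sep_hol_update[OF that inP])
    from this[OF P(2)] this[OF P(3)] this[OF sep_hol_partial[OF P(1,3)]] show ?thesis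
      unfolding case_prod_beta
      by (intro continuous_on_divide continuous_on_mult continuous_on_const) (use nz in auto)
  qed
next
  fix z w j assume z: "z \<in> N" "w \<in> sphere c \<rho>"
  have "(\<lambda>v. H (z(j := v, i := w))) field_differentiable at (z j)" if "sep_hol P H" for H
    by (rule sep_hol_fix[OF that inP[OF z]])
  from this[OF P(2)] this[OF P(3)] this[OF sep_hol_partial[OF P(1,3)]] nz[OF z]
  show "(\<lambda>v. F (z(j := v, i := w)) * partial i u (z(j := v, i := w)) / u (z(j := v, i := w)) / (2 * pi * \<i>))
     field_differentiable at (z j)"
    by (intro field_differentiable_divide field_differentiable_mult field_differentiable_const)
       (auto simp: nz[OF z] fun_upd_twist)
qed (use \<rho> in auto)

text \<open>Dividing \<open>f\<close> by \<open>w - \<xi>\<close> leaves a holomorphic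
  \<open>v\<close> without zeros on the disc and with \<open>v \<xi> = deriv f \<xi>\<close>. The
  integrand becomes \<open>g w / (w - \<xi>)\<close>, and Cauchy's formula returns
  \<open>g \<xi>\<close>, where the derivative of \<open>f\<close> cancels against
  \<open>v \<xi>\<close>.\<close>

lemma contour_integral_unique_simple_zero:
  assumes S: "open S" "cball c \<rho> \<subseteq> S" and hol: "f holomorphic_on S" "h holomorphic_on S"
    and \<xi>: "\<xi> \<in> ball c \<rho>" "f \<xi> = 0" "deriv f \<xi> \<noteq> 0"
    and unique: "\<And>w. w \<in> cball c \<rho> \<Longrightarrow> f w = 0 \<Longrightarrow> w = \<xi>"
  shows "contour_integral (circlepath c \<rho>) (\<lambda>w. h w * deriv f w / f w / (2 * pi * \<i>)) = h \<xi>"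
proof -
  define v where "v w = (if w = \<xi> then deriv f \<xi> else (f w - f \<xi>) / (w - \<xi>))" for w
  define g where "g w = h w * deriv f w / v w / (2 * pi * \<i>)" for w
  have \<xi>S: "\<xi> \<in> interior S" using \<xi> S ball_subset_cball interior_open by blast
  have v: "v holomorphic_on S"
    unfolding v_def by (rule pole_lemma[OF hol(1) \<xi>S])
  have v0: "v w \<noteq> 0" if "w \<in> cball c \<rho>" for w
  proof (cases "w = \<xi>")
    case False
    then have "f w \<noteq> 0" using unique[OF that] by blast
    then show ?thesis using False \<xi>(2) by (simp add: v_def)
  qed (use \<xi>(3) in \<open>simp add: v_def\<close>)
  have g: "g holomorphic_on cball c \<rho>"
    unfolding g_def
  proof (intro holomorphic_on_mult holomorphic_on_divide holomorphic_on_const)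
    show "h holomorphic_on cball c \<rho>" "v holomorphic_on cball c \<rho>" "deriv f holomorphic_on cball c \<rho>"
      using holomorphic_on_subset[OF _ S(2)] hol v holomorphic_deriv[OF hol(1) S(1)] by blast+
  qed (use v0 in auto)
  have "((\<lambda>w. g w / (w - \<xi>)) has_contour_integral (2 * of_real pi * \<i> * g \<xi>)) (circlepath c \<rho>)"
  proof (rule Cauchy_integral_circlepath)
    show "continuous_on (cball c \<rho>) g" using g by (rule holomorphic_on_imp_continuous_on)
    show "g holomorphic_on ball c \<rho>" using g ball_subset_cball by (rule holomorphic_on_subset)
    show "norm (\<xi> - c) < \<rho>" using \<xi>(1) by (simp add: dist_norm norm_minus_commute)
  qed
  then have "contour_integral (circlepath c \<rho>) (\<lambda>w. g w / (w - \<xi>)) = 2 * of_real pi * \<i> * g \<xi>"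
    by (rule contour_integral_unique)
  moreover have "contour_integral (circlepath c \<rho>) (\<lambda>w. h w * deriv f w / f w / (2 * pi * \<i>)) =
      contour_integral (circlepath c \<rho>) (\<lambda>w. g w / (w - \<xi>))"
  proof (rule contour_integral_cong[OF refl])
    fix w assume "w \<in> path_image (circlepath c \<rho>)"
    moreover have "\<rho> > 0" using \<xi>(1) le_less_trans[OF zero_le_dist] by auto
    ultimately have w: "w \<in> sphere c \<rho>" by simp
    then have "w \<noteq> \<xi>" using \<xi>(1) by auto
    then show "h w * deriv f w / f w / (2 * pi * \<i>) = g w / (w - \<xi>)"
      by (simp add: g_def v_def \<xi>)
  qed
  ultimately show ?thesis
    using \<xi> by (simp add: g_def v_def)
qed

lemma restrict_zero_eq:
  assumes P: "open P" "sep_hol P F" "sep_hol P u"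
    and inP: "\<And>w. w \<in> cball c \<rho> \<Longrightarrow> z(i := w) \<in> P"
    and \<xi>: "\<xi> \<in> ball c \<rho>" "u (z(i := \<xi>)) = 0" "partial i u (z(i := \<xi>)) \<noteq> 0"
    and unique: "\<And>w. w \<in> cball c \<rho> \<Longrightarrow> u (z(i := w)) = 0 \<Longrightarrow> w = \<xi>"
  shows "restrict_zero i c \<rho> u F z = F (z(i := \<xi>))"
proof -
  have partial: "partial i u (z(i := w)) = deriv (\<lambda>w. u (z(i := w))) w" for w
    by (simp add: partial_def)
  show ?thesis
    unfolding restrict_zero_def partial
  proof (rule contour_integral_unique_simple_zero[where S = "{w. z(i := w) \<in> P}" and \<xi> = \<xi>])
    show "open {w. z(i := w) \<in> P}" by (rule open_update_slice[OF P(1)])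
    show "cball c \<rho> \<subseteq> {w. z(i := w) \<in> P}" using inP by auto
    show "(\<lambda>w. u (z(i := w))) holomorphic_on {w. z(i := w) \<in> P}"
      "(\<lambda>w. F (z(i := w))) holomorphic_on {w. z(i := w) \<in> P}"
      using P by (auto intro: sep_holD)
    show "deriv (\<lambda>w. u (z(i := w))) \<xi> \<noteq> 0" using \<xi>(3) unfolding partial .
  qed (use \<xi> unique in auto)
qed

lemma update_box:
  fixes z :: "nat \<Rightarrow> complex"
  assumes "open Q" "z \<in> Q"
  obtains A \<rho> where "open A" "z \<in> A" "\<rho> > 0" "\<And>y w. y \<in> A \<Longrightarrow> w \<in> cball (z i) \<rho> \<Longrightarrow> y(i := w) \<in> Q"
proof -
  have "open ((\<lambda>p. (fst p)(i := snd p)) -` Q :: ((nat \<Rightarrow> complex) \<times> complex) set)"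
    by (intro open_vimage assms continuous_on_update continuous_on_fst continuous_on_snd continuous_on_id)
  then obtain A B where AB: "open A" "open B" "z \<in> A" "z i \<in> B"
      "A \<times> B \<subseteq> (\<lambda>p. (fst p)(i := snd p)) -` Q"
    using assms(2) by (auto elim!: open_prod_elim[where x = "(z, z i)"])
  obtain \<rho> where \<rho>: "\<rho> > 0" "cball (z i) \<rho> \<subseteq> B"
    using AB open_contains_cball by blast
  have "y(i := w) \<in> Q" if "y \<in> A" "w \<in> cball (z i) \<rho>" for y w
  proof -
    have "(y, w) \<in> A \<times> B" using that \<rho> by auto
    with AB(5) show ?thesis by auto
  qed
  with AB(1,3) \<rho>(1) show thesis by (rule that)
qed

text \<open>Near \<open>emb b\<close> the derivative in direction \<open>i\<close> stays within half
  its size of its value \<open>d\<close> at \<open>emb b\<close>. On each slice \<open>u\<close>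
  therefore differs from a linear function of slope \<open>d\<close> by a function with Lipschitz
  constant \<open>norm d / 2\<close>. This gives injectivity on the disc, no zeros on its boundary,
  and on real slices a sign change, hence a real zero.\<close>

lemma zero_chart:
  assumes P: "open P" "sep_hol P u" "real_on P u"
    and b: "emb b \<in> P" "u (emb b) = 0" "partial i u (emb b) \<noteq> 0"
  obtains N \<rho> where "open N" "emb b \<in> N" "\<rho> > 0"
    "\<And>z w. z \<in> N \<Longrightarrow> w \<in> cball (of_real (b i)) \<rho> \<Longrightarrow> z(i := w) \<in> P"
    "\<And>z w. z \<in> N \<Longrightarrow> w \<in> sphere (of_real (b i)) \<rho> \<Longrightarrow> u (z(i := w)) \<noteq> 0"
    "\<And>z w. z \<in> N \<Longrightarrow> w \<in> cball (of_real (b i)) \<rho> \<Longrightarrow> partial i u (z(i := w)) \<noteq> 0"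
    "\<And>z w w'. z \<in> N \<Longrightarrow> w \<in> cball (of_real (b i)) \<rho> \<Longrightarrow> w' \<in> cball (of_real (b i)) \<rho> \<Longrightarrow>
       u (z(i := w)) = u (z(i := w')) \<Longrightarrow> w = w'"
    "\<And>x. emb x \<in> N \<Longrightarrow> \<exists>t. \<bar>t - b i\<bar> < \<rho> \<and> u (emb (x(i := t))) = 0"
proof -
  define d where "d = partial i u (emb b)"
  define c where "c = (of_real (b i) :: complex)"
  have d0: "norm d > 0" using b(3) by (simp add: d_def)
  have embi: "emb b i = c" by (simp add: emb_def c_def)
  have spartial: "sep_hol P (partial i u)" using P by (intro sep_hol_partial)
  define Q where "Q = P \<inter> (partial i u) -` ball d (norm d / 2)"
  have "open Q"
    unfolding Q_def Int_commute[of P] using spartial P(1) 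
    by (intro continuous_on_open_vimage[THEN iffD1, rule_format] P open_ball) (auto simp: sep_hol_def)
  moreover have "emb b \<in> Q" using b d0 by (simp add: Q_def d_def)
  ultimately obtain A \<rho> where A: "open A" "emb b \<in> A" "\<rho> > 0"
    "\<And>y w. y \<in> A \<Longrightarrow> w \<in> cball (emb b i) \<rho> \<Longrightarrow> y(i := w) \<in> Q"
    by (rule update_box[where i = i]) blast
  note AQ = A(4)[unfolded embi]
  have lip: "norm (u (z(i := w)) - u (z(i := w')) - d * (w - w')) \<le> norm d / 2 * norm (w - w')"
    if z: "z \<in> A" and w: "w \<in> cball c \<rho>" "w' \<in> cball c \<rho>" for z w w'
  proof -
    have "norm ((u (z(i := w)) - d * w) - (u (z(i := w')) - d * w')) \<le> norm d / 2 * norm (w - w')"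
    proof (rule field_differentiable_bound[OF convex_cball[of c \<rho>], where f' = "\<lambda>w. partial i u (z(i := w)) - d"])
      fix v assume v: "v \<in> cball c \<rho>"
      have zv: "z(i := v) \<in> Q" by (rule AQ[OF z v])
      then have "(\<lambda>w. u ((z(i := v))(i := w))) field_differentiable at ((z(i := v)) i)"
        using P(2) unfolding sep_hol_def Q_def by blast
      then have "((\<lambda>w. u (z(i := w))) has_field_derivative partial i u (z(i := v))) (at v)"
        by (simp add: partial_def field_differentiable_derivI)
      then have "((\<lambda>w. u (z(i := w)) - d * w) has_field_derivative partial i u (z(i := v)) - d) (at v)"
        by (auto intro!: derivative_eq_intros)
      then show "((\<lambda>w. u (z(i := w)) - d * w) has_field_derivative partial i u (z(i := v)) - d) (at v within cball c \<rho>)"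
        by (rule has_field_derivative_at_within)
      show "norm (partial i u (z(i := v)) - d) \<le> norm d / 2"
        using zv by (simp add: Q_def dist_norm norm_minus_commute)
    qed (use w in auto)
    then show ?thesis by (simp add: algebra_simps)
  qed
  define H where "H = (\<lambda>z. u (z(i := c)))"
  have cH: "continuous_on A H"
    unfolding H_def
  proof (rule continuous_on_compose2[where g = u and t = P])
    show "continuous_on P u" using P by (simp add: sep_hol_def)
    show "(\<lambda>z. z(i := c)) ` A \<subseteq> P" using AQ A(3) by (auto simp: Q_def)
  qed (intro continuous_on_update continuous_on_id continuous_on_const)
  \<comment> \<open>The Lipschitz error at distance \<open>\<rho>\<close> is at most
    \<open>norm d * \<rho> / 2\<close>, while the linear part has size
    \<open>norm d * \<rho>\<close>. A value at the centre below the remaining half cannot cancel it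
    on the circle, nor spoil the opposite signs at the two real ends.\<close>
  define N where "N = A \<inter> H -` ball 0 (norm d * \<rho> / 2)"
  have oN: "open N"
    unfolding N_def Int_commute[of A]
    using cH by (intro continuous_on_open_vimage[THEN iffD1, rule_format] A open_ball)
  have bN: "emb b \<in> N"
  proof -
    have "(emb b)(i := c) = emb b" using embi by auto
    then show ?thesis using A b d0 by (simp add: N_def H_def)
  qed
  have NA: "z \<in> A" and Nc: "norm (u (z(i := c))) < norm d * \<rho> / 2" if "z \<in> N" for z
    using that by (auto simp: N_def H_def)
  have c\<rho>: "c \<in> cball c \<rho>" using A by simp
  have inj: "w = w'" if "z \<in> N" "w \<in> cball c \<rho>" "w' \<in> cball c \<rho>" "u (z(i := w)) = u (z(i := w'))" for z w w'
  proof (rule ccontr)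
    assume "w \<noteq> w'"
    then have "norm d * norm (w - w') > 0" using d0 by simp
    moreover have "norm d * norm (w - w') \<le> norm d / 2 * norm (w - w')"
      using lip[OF NA[OF that(1)] that(2,3)] that(4) by (simp add: norm_mult)
    ultimately show False by linarith
  qed
  have sph: "u (z(i := w)) \<noteq> 0" if z: "z \<in> N" and w: "w \<in> sphere c \<rho>" for z w
  proof
    assume u0: "u (z(i := w)) = 0"
    have n: "norm (w - c) = \<rho>" using w by (simp add: dist_norm norm_minus_commute)
    have l: "norm (u (z(i := w)) - u (z(i := c)) - d * (w - c)) \<le> norm d / 2 * \<rho>"
      using lip[OF NA[OF z] _ c\<rho>, of w] w unfolding n by simp
    have "norm (d * (w - c)) = norm (- u (z(i := c)) - (u (z(i := w)) - u (z(i := c)) - d * (w - c)))"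
      using u0 by simp
    also have "\<dots> \<le> norm (u (z(i := c))) + norm (u (z(i := w)) - u (z(i := c)) - d * (w - c))"
      by (metis norm_minus_cancel norm_triangle_ineq4)
    also have "\<dots> < norm d * \<rho> / 2 + norm d / 2 * \<rho>"
      using Nc[OF z] l by linarith
    finally show False using n by (simp add: norm_mult)
  qed
  have ex: "\<exists>t. \<bar>t - b i\<bar> < \<rho> \<and> u (emb (x(i := t))) = 0" if x: "emb x \<in> N" for x
  proof -
    define \<phi> where "\<phi> t = Re (u (emb (x(i := t))))" for t
    define \<delta> where "\<delta> = Re d"
    have inP: "emb (x(i := t)) \<in> P" if "\<bar>t - b i\<bar> \<le> \<rho>" for t
    proof -
      have "of_real t \<in> cball c \<rho>" using that
        by (simp add: c_def dist_norm norm_minus_commute flip: of_real_diff)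
      then show ?thesis
        using AQ[OF NA[OF x]] by (simp add: emb_update Q_def)
    qed
    have ureal: "u (emb (x(i := t))) = of_real (\<phi> t)" if "\<bar>t - b i\<bar> \<le> \<rho>" for t
      using P(3) inP[OF that] by (simp add: real_on_def \<phi>_def)
    have dreal: "d = of_real \<delta>"
      using real_on_partial[OF P] b(1) by (simp add: real_on_def d_def \<delta>_def)
    have \<delta>0: "\<bar>\<delta>\<bar> > 0" using d0 dreal by simp
    have b0: "\<bar>\<phi> (b i)\<bar> < \<bar>\<delta>\<bar> * \<rho> / 2"
      using Nc[OF x] ureal[of "b i"] A(3) dreal by (simp add: emb_update c_def)
    have lipr: "\<bar>\<phi> t - \<phi> (b i) - \<delta> * (t - b i)\<bar> \<le> \<bar>\<delta>\<bar> / 2 * \<bar>t - b i\<bar>" if t: "\<bar>t - b i\<bar> \<le> \<rho>" for t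
    proof -
      have "of_real t \<in> cball c \<rho>" using that
        by (simp add: c_def dist_norm norm_minus_commute flip: of_real_diff)
      from lip[OF NA[OF x] this c\<rho>] 
      have "norm (u (emb (x(i := t))) - u (emb (x(i := b i))) - d * (of_real t - c)) \<le> norm d / 2 * norm (of_real t - c)"
        by (simp add: emb_update c_def)
      also have "u (emb (x(i := t))) - u (emb (x(i := b i))) - d * (of_real t - c) = of_real (\<phi> t - \<phi> (b i) - \<delta> * (t - b i))"
        using ureal[OF t] ureal[of "b i"] A(3) by (simp add: dreal c_def)
      also have "norm d / 2 * norm (of_real t - c) = \<bar>\<delta>\<bar> / 2 * \<bar>t - b i\<bar>"
        by (simp add: dreal c_def flip: of_real_diff)
      finally show ?thesis by (simp only: norm_of_real)
    qed
    have cont: "continuous_on {b i - \<rho>..b i + \<rho>} \<phi>"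
      unfolding \<phi>_def
    proof (rule continuous_on_Re, rule continuous_on_compose2[where g = u and t = P])
      show "continuous_on P u" using P by (simp add: sep_hol_def)
      show "continuous_on {b i - \<rho>..b i + \<rho>} (\<lambda>t. emb (x(i := t)))"
        by (intro continuous_on_compose2[OF continuous_on_emb[of UNIV]] continuous_on_update
            continuous_on_const continuous_on_id) auto
      show "(\<lambda>t. emb (x(i := t))) ` {b i - \<rho>..b i + \<rho>} \<subseteq> P"
        using inP by (auto simp: abs_le_iff)
    qed
    have e1: "\<bar>\<phi> (b i + \<rho>) - \<phi> (b i) - \<delta> * \<rho>\<bar> \<le> \<bar>\<delta>\<bar> / 2 * \<rho>"
      using lipr[of "b i + \<rho>"] A(3) by simp
    have e2: "\<bar>\<phi> (b i - \<rho>) - \<phi> (b i) + \<delta> * \<rho>\<bar> \<le> \<bar>\<delta>\<bar> / 2 * \<rho>"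
      using lipr[of "b i - \<rho>"] A(3) by simp
    have "\<exists>t. b i - \<rho> \<le> t \<and> t \<le> b i + \<rho> \<and> \<phi> t = 0"
    proof (cases "\<delta> > 0")
      case True
      define K where "K = \<delta> * \<rho>"
      have "\<bar>\<phi> (b i + \<rho>) - \<phi> (b i) - K\<bar> \<le> K / 2" "\<bar>\<phi> (b i - \<rho>) - \<phi> (b i) + K\<bar> \<le> K / 2" "\<bar>\<phi> (b i)\<bar> < K / 2"
        using e1 e2 b0 True by (simp_all add: K_def)
      then have "\<phi> (b i + \<rho>) \<ge> 0" "\<phi> (b i - \<rho>) \<le> 0" by linarith+
      then show ?thesis using IVT'[of \<phi> "b i - \<rho>" 0 "b i + \<rho>"] cont A(3) by auto
    next
      case False
      then have "\<bar>\<delta>\<bar> = - \<delta>" by simp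
      define K where "K = - \<delta> * \<rho>"
      have "\<bar>\<phi> (b i + \<rho>) - \<phi> (b i) + K\<bar> \<le> K / 2" "\<bar>\<phi> (b i - \<rho>) - \<phi> (b i) - K\<bar> \<le> K / 2" "\<bar>\<phi> (b i)\<bar> < K / 2"
        using e1 e2 b0 unfolding \<open>\<bar>\<delta>\<bar> = - \<delta>\<close> by (simp_all add: K_def)
      then have "\<phi> (b i + \<rho>) \<le> 0" "\<phi> (b i - \<rho>) \<ge> 0" by linarith+
      then show ?thesis using IVT2'[of \<phi> "b i + \<rho>" 0 "b i - \<rho>"] cont A(3) by auto
    qed
    then obtain t where "b i - \<rho> \<le> t" "t \<le> b i + \<rho>" "\<phi> t = 0" by blast
    then have t: "\<bar>t - b i\<bar> \<le> \<rho>" "\<phi> t = 0" by (simp_all add: abs_le_iff)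
    have u0: "u (emb (x(i := t))) = 0" using ureal[OF t(1)] t(2) by simp
    have "\<bar>t - b i\<bar> \<noteq> \<rho>"
    proof
      assume "\<bar>t - b i\<bar> = \<rho>"
      then have "of_real t \<in> sphere c \<rho>"
        by (simp add: c_def dist_norm norm_minus_commute flip: of_real_diff)
      from sph[OF x this] u0 show False by (simp add: emb_update)
    qed
    with t u0 show ?thesis by force
  qed
  show thesis
  proof (rule that[OF oN bN A(3)])
    fix z w assume "z \<in> N" "w \<in> cball (of_real (b i) :: complex) \<rho>"
    then have "z(i := w) \<in> Q" using AQ NA by (simp add: c_def)
    then show "z(i := w) \<in> P" "partial i u (z(i := w)) \<noteq> 0"
      using d0 by (auto simp: Q_def dist_norm)
  qed (use sph inj ex in \<open>auto simp: c_def\<close>)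
qed

text \<open>Climbing from \<open>l0\<close> to \<open>l\<close> one derivative at a time, the value
  starts at zero and ends nonzero, so at some stage one further differentiation turns zero into
  nonzero. There the iterated derivative cuts out a smooth hypersurface. The choice
  \<open>l0 = []\<close> serves \<open>G\<close>, and \<open>l0 = [j]\<close> serves
  \<open>T\<close>, whose own value need not vanish.\<close>

lemma partials_minimal:
  assumes "partials l F z \<noteq> 0" "partials l0 F z = 0" "\<exists>l'. l = l' @ l0"
  obtains i l' where "partials l' F z = 0" "partials (i # l') F z \<noteq> 0" "set (i # l') \<subseteq> set l"
proof -
  obtain l' where "l = l' @ l0" using assms(3) by blast
  then have "\<exists>i k. partials k F z = 0 \<and> partials (i # k) F z \<noteq> 0 \<and> set (i # k) \<subseteq> set l"
    using assms(1)
  proof (induction l' arbitrary: l)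
    case Nil
    then show ?case using assms(2) by simp
  next
    case (Cons a l')
    show ?case
    proof (cases "partials (l' @ l0) F z = 0")
      case True
      then show ?thesis using Cons.prems by (intro exI[of _ a] exI[of _ "l' @ l0"]) auto
    next
      case False
      then show ?thesis using Cons.IH[of "l' @ l0"] Cons.prems by (auto 0 3)
    qed
  qed
  then show thesis using that by blast
qed

lemma has_real_derivative_slice:
  assumes "open P" "sep_hol P F" "emb x \<in> P"
  shows "((\<lambda>t. Re (F (emb (x(i := t))))) has_real_derivative Re (partial i F (emb x))) (at (x i))"
  unfolding has_real_derivative_iff_has_vector_derivative
  by (rule bounded_linear.has_vector_derivative[OF bounded_linear_Re has_vector_derivative_slice[OF assms]])

text \<open>The identity theorem moves only the coordinates in \<open>I\<close>; the others may be
  reset to those of \<open>emb x\<close>, because \<open>F\<close> does not see them.\<close>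

lemma zero_near_if_partials_zero:
  assumes I: "finite I" and dep: "depends_on I F" and P: "open P" "sep_hol P F" and x: "emb x \<in> P"
    and zero: "\<And>l. set l \<subseteq> I \<Longrightarrow> partials l F (emb x) = 0"
  obtains N where "open N" "emb x \<in> N" "N \<subseteq> P" "\<And>z. z \<in> N \<Longrightarrow> F z = 0"
proof -
  obtain m r where r: "r > 0" "polydisc m (emb x) r \<subseteq> P"
    using polydisc_basis[OF P(1) x] by blast
  have xN: "emb x \<in> polydisc m (emb x) r" using r by (simp add: polydisc_def)
  have "F z = 0" if z: "z \<in> polydisc m (emb x) r" for z
  proof -
    define z' where "z' i = (if i \<in> I then z i else emb x i)" for i
    have "F z' = 0"
      by (rule zero_if_partials_zero[OF I sep_hol_subset[OF P(2) r(2)] xN])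
         (use z r zero in \<open>auto simp: polydisc_def z'_def\<close>)
    moreover have "F z = F z'"
      by (rule depends_onD[OF dep]) (simp add: z'_def)
    ultimately show ?thesis by simp
  qed
  with open_polydisc xN r(2) show thesis by (rule that)
qed

text \<open>The line through \<open>x\<close> in direction \<open>j\<close> parametrizes a piece of
  the graph of \<open>h\<close>, with \<open>T\<close> as argument and \<open>Y\<close> as value,
  and the argument moves with nonzero speed at \<open>x\<close>.\<close>

lemma locally_mono_at_slice:
  assumes P: "open P" "sep_hol P T" "sep_hol P Y" and real: "real_on P T"
    and x: "emb x \<in> P" and nz: "partial j T (emb x) \<noteq> 0"
    and eq: "\<And>x. emb x \<in> P \<Longrightarrow> Re (T (emb x)) \<in> closure {t. locally_mono_at h t} \<and>
      Re (Y (emb x)) = h (Re (T (emb x)))"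
  shows "locally_mono_at h (Re (T (emb x)))"
proof -
  obtain S where S: "open S" "x j \<in> S" "\<And>t. t \<in> S \<Longrightarrow> emb (x(j := t)) \<in> P"
    using eventually_slice[OF P(1) x, of j] unfolding eventually_nhds by blast
  obtain e where e: "e > 0" "ball (x j) e \<subseteq> S" using S open_contains_ball by blast
  have inP: "emb (x(j := s)) \<in> P" if "s \<in> ball (x j) e" for s
    using S e that by blast
  have der: "((\<lambda>t. Re (F (emb (x(j := t))))) has_real_derivative Re (partial j F (emb (x(j := s))))) (at s)"
    if "sep_hol P F" "s \<in> ball (x j) e" for F s
    using has_real_derivative_slice[OF P(1) that(1) inP[OF that(2)], of j] by simp
  have cont: "continuous_on (ball (x j) e) (\<lambda>s. Re (partial j F (emb (x(j := s)))))" if "sep_hol P F" for F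
  proof (rule continuous_on_Re, rule continuous_on_compose2[where g = "partial j F" and t = P])
    show "continuous_on P (partial j F)" using sep_hol_partial[OF P(1) that] by (simp add: sep_hol_def)
    show "continuous_on (ball (x j) e) (\<lambda>t. emb (x(j := t)))"
      by (intro continuous_on_compose2[OF continuous_on_emb[of UNIV]] continuous_on_update
          continuous_on_const continuous_on_id) auto
    show "(\<lambda>t. emb (x(j := t))) ` ball (x j) e \<subseteq> P" using inP by auto
  qed
  have "locally_mono_at h (Re (T (emb (x(j := x j)))))"
  proof (rule locally_mono_at_param[OF e(1), where \<tau> = "\<lambda>s. Re (T (emb (x(j := s))))" and
        y = "\<lambda>s. Re (Y (emb (x(j := s))))" and \<tau>' = "\<lambda>s. Re (partial j T (emb (x(j := s))))" and
        y' = "\<lambda>s. Re (partial j Y (emb (x(j := s))))" and h = h])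
    show "Re (partial j T (emb (x(j := x j)))) \<noteq> 0"
      using nz real_on_partial[OF P(1,2) real] x unfolding real_on_def
      by (metis Reals_cases Re_complex_of_real fun_upd_triv of_real_0)
  qed (fact der[OF P(2)] der[OF P(3)] cont[OF P(2)] cont[OF P(3)] eq[OF inP, THEN conjunct1]
         eq[OF inP, THEN conjunct2, symmetric])+
  then show ?thesis by simp
qed

text \<open>On a hypersurface where \<open>u\<close> vanishes but its \<open>i\<close>-th derivative
  does not, coordinate \<open>i\<close> is a function of the others, so \<open>T\<close>,
  \<open>Y\<close> and \<open>G\<close> become functions of the coordinates in
  \<open>I - {i}\<close> and the induction hypothesis applies. At a point on none of the countably
  many hypersurfaces arising from derivatives of \<open>G\<close> and \<open>T\<close>, the function
  \<open>G\<close> vanishes identically nearby, so the relation between \<open>T\<close>,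
  \<open>Y\<close> and \<open>h\<close> holds in all directions. Either \<open>T\<close> then has a
  nonzero derivative and monotonicity is read off a slice, or \<open>T\<close> is locally constant
  and contributes a single value.\<close>

lemma countable_values_on_zero_set:
  fixes h :: "real \<Rightarrow> real"
  assumes "finite I" and J: "J \<subseteq> closure {t. locally_mono_at h t}"
    and "open P" "sep_hol P T" "sep_hol P Y" "sep_hol P G"
    and "real_on P T" "real_on P Y" "real_on P G" and "depends_on I T" "depends_on I Y" "depends_on I G"
    and "\<And>x. emb x \<in> P \<Longrightarrow> G (emb x) = 0 \<Longrightarrow> Re (T (emb x)) \<in> J \<and> Re (Y (emb x)) = h (Re (T (emb x)))"
  shows "countable ((\<lambda>x. Re (T (emb x))) ` {x. emb x \<in> P \<and> G (emb x) = 0} - {t. locally_mono_at h t})"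
  using assms(1,3-)
proof (induction I arbitrary: P T Y G rule: finite_psubset_induct)
  case (psubset I)
  note P = psubset.prems(1) and hol = psubset.prems(2-4) and real = psubset.prems(5-7)
    and dep = psubset.prems(8-10) and eq = psubset.prems(11)
  define M where "M = {t. locally_mono_at h t}"
  define S where "S = {x. emb x \<in> P \<and> G (emb x) = 0}"
  define g where "g = (\<lambda>x. Re (T (emb x)))"
  define Su where "Su u i = {x \<in> S. u (emb x) = 0 \<and> partial i u (emb x) \<noteq> 0}" for u i
  have oemb: "open (emb -` Q)" if "open Q" for Q
    using open_vimage[OF that continuous_on_emb] .
  have chart: "countable (g ` Su u i - M)"
    if u: "sep_hol P u" "real_on P u" "depends_on I u" and i: "i \<in> I" for u i
  proof (rule countable_image_diff_Lindelof)
    fix b assume "b \<in> Su u i"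
    then have b: "emb b \<in> P" "u (emb b) = 0" "partial i u (emb b) \<noteq> 0" by (auto simp: Su_def S_def)
    obtain N \<rho> where N: "open N" "emb b \<in> N" "\<rho> > 0"
      and NP: "\<And>z w. z \<in> N \<Longrightarrow> w \<in> cball (of_real (b i)) \<rho> \<Longrightarrow> z(i := w) \<in> P"
      and Nsph: "\<And>z w. z \<in> N \<Longrightarrow> w \<in> sphere (of_real (b i)) \<rho> \<Longrightarrow> u (z(i := w)) \<noteq> 0"
      and Npd: "\<And>z w. z \<in> N \<Longrightarrow> w \<in> cball (of_real (b i)) \<rho> \<Longrightarrow> partial i u (z(i := w)) \<noteq> 0"
      and Ninj: "\<And>z w w'. z \<in> N \<Longrightarrow> w \<in> cball (of_real (b i)) \<rho> \<Longrightarrow> w' \<in> cball (of_real (b i)) \<rho> \<Longrightarrow>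
         u (z(i := w)) = u (z(i := w')) \<Longrightarrow> w = w'"
      and Nex: "\<And>x. emb x \<in> N \<Longrightarrow> \<exists>t. \<bar>t - b i\<bar> < \<rho> \<and> u (emb (x(i := t))) = 0"
      by (rule zero_chart[OF P u(1,2) b]) (rule that)
    define R where "R = restrict_zero i (of_real (b i)) \<rho> u"
    have inb: "of_real t \<in> ball (of_real (b i) :: complex) \<rho>" if "\<bar>t - b i\<bar> < \<rho>" for t
      using that by (simp add: dist_norm norm_minus_commute flip: of_real_diff)
    have Req: "R F (emb x) = F (emb (x(i := t)))"
      if F: "sep_hol P F" and x: "emb x \<in> N" and t: "\<bar>t - b i\<bar> < \<rho>" "u (emb (x(i := t))) = 0" for F x t
    proof -
      note tb = inb[OF t(1)]
      then have tc: "of_real t \<in> cball (of_real (b i) :: complex) \<rho>" by simp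
      show ?thesis
        unfolding R_def emb_update
        by (rule restrict_zero_eq[OF P F u(1) NP[OF x] tb _ Npd[OF x tc]])
          (use t(2) Ninj[OF x _ tc] in \<open>auto simp: emb_update\<close>)
    qed
    have Rhol: "sep_hol N (R F)" if "sep_hol P F" for F
      unfolding R_def by (rule sep_hol_restrict_zero[OF P that u(1) N(1,3)]) (use NP Nsph in auto)
    have Rreal: "real_on N (R F)" if "sep_hol P F" "real_on P F" for F
      unfolding real_on_def
    proof safe
      fix x assume x: "emb x \<in> N"
      obtain t where t: "\<bar>t - b i\<bar> < \<rho>" "u (emb (x(i := t))) = 0" using Nex[OF x] by blast
      have "emb (x(i := t)) \<in> P"
        using NP[OF x] inb[OF t(1)] by (auto simp: emb_update)
      then show "R F (emb x) \<in> \<real>"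
        unfolding Req[OF that(1) x t] using that(2) by (simp add: real_on_def)
    qed
    have Rdep: "depends_on (I - {i}) (R F)" if "depends_on I F" for F
      unfolding R_def by (rule depends_on_restrict_zero[OF that u(3)])
    have IH: "countable ((\<lambda>x. Re (R T (emb x))) ` {x. emb x \<in> N \<and> R G (emb x) = 0} - M)"
      unfolding M_def
    proof (rule psubset.IH[of "I - {i}" N "R T" "R Y" "R G"])
      show "I - {i} \<subset> I" using i by auto
      fix x assume x: "emb x \<in> N" "R G (emb x) = 0"
      obtain t where t: "\<bar>t - b i\<bar> < \<rho>" "u (emb (x(i := t))) = 0" using Nex[OF x(1)] by blast
      have inP: "emb (x(i := t)) \<in> P"
        using NP[OF x(1)] inb[OF t(1)] by (auto simp: emb_update)
      have "G (emb (x(i := t))) = 0"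
        using x(2) unfolding Req[OF hol(3) x(1) t] .
      from eq[OF inP this]
      show "Re (R T (emb x)) \<in> J \<and> Re (R Y (emb x)) = h (Re (R T (emb x)))"
        unfolding Req[OF hol(1) x(1) t] Req[OF hol(2) x(1) t] .
    qed (use N Rhol Rreal Rdep hol real dep in auto)
    \<comment> \<open>Coordinate \<open>i\<close> is confined to the disc in which the zero of
      \<open>u\<close> is unique. A point of the hypersurface in \<open>V\<close> is then the very
      point at which \<open>R\<close> evaluates.\<close>
    define V where "V = emb -` N \<inter> {x. x i \<in> ball (b i) \<rho>}"
    have "open V"
      unfolding V_def
      using oemb[OF N(1)] open_vimage[OF open_ball continuous_on_product_coordinates[of i], of "b i" \<rho>]
      by (auto simp: vimage_def)
    moreover have "b \<in> V" using N by (simp add: V_def)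
    moreover have "g ` (Su u i \<inter> V) \<subseteq> (\<lambda>x. Re (R T (emb x))) ` {x. emb x \<in> N \<and> R G (emb x) = 0}"
    proof
      fix s assume "s \<in> g ` (Su u i \<inter> V)"
      then obtain x where x: "x \<in> Su u i" "x \<in> V" "s = g x" by auto
      have xN: "emb x \<in> N" and t: "\<bar>x i - b i\<bar> < \<rho>" "u (emb (x(i := x i))) = 0"
        using x by (auto simp: V_def Su_def dist_real_def abs_minus_commute)
      have "R T (emb x) = T (emb x)" "R G (emb x) = G (emb x)"
        using Req[OF hol(1) xN t] Req[OF hol(3) xN t] by simp_all
      then show "s \<in> (\<lambda>x. Re (R T (emb x))) ` {x. emb x \<in> N \<and> R G (emb x) = 0}"
        using x xN by (intro image_eqI[of _ _ x]) (auto simp: g_def Su_def S_def)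
    qed
    ultimately show "\<exists>N. open N \<and> b \<in> N \<and> countable (g ` (Su u i \<inter> N) - M)"
      using IH by (meson Diff_mono countable_subset order_refl)
  qed
  \<comment> \<open>A countable union, because there are only countably many lists over the finite
    set \<open>I\<close>.\<close>
  define D where "D = (\<Union>F\<in>{G, T}. \<Union>l\<in>lists I. \<Union>i\<in>I. Su (partials l F) i)"
  have cD: "countable (g ` D - M)"
  proof -
    have "g ` D - M = (\<Union>F\<in>{G, T}. \<Union>l\<in>lists I. \<Union>i\<in>I. g ` Su (partials l F) i - M)"
      unfolding D_def by blast
    also have "countable \<dots>"
      using psubset.hyps(1) hol real dep P
      by (intro countable_UN chart) (auto intro: countable_finite sep_hol_partials real_on_partials depends_on_partials simp: countable_lists)
    finally show ?thesis .
  qed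
  have inD: "x \<in> D" if "x \<in> S" "F \<in> {G, T}" "partials l F (emb x) = 0" "partials (i # l) F (emb x) \<noteq> 0"
      "set (i # l) \<subseteq> I" for x F l i
  proof -
    have "x \<in> Su (partials l F) i" using that by (simp add: Su_def)
    then show ?thesis unfolding D_def using that by (intro UN_I) auto
  qed
  have "countable (g ` (S - D) - M)"
  proof (rule countable_image_diff_Lindelof)
    fix x assume x: "x \<in> S - D"
    then have xP: "emb x \<in> P" and G0: "G (emb x) = 0" by (auto simp: S_def)
    \<comment> \<open>If some derivative of \<open>G\<close> were nonzero at \<open>x\<close>, one
      on the way to it would vanish while a further derivative did not, and \<open>x\<close> would
      belong to \<open>D\<close>.\<close>
    have G: "partials l G (emb x) = 0" if "set l \<subseteq> I" for l
    proof (rule ccontr)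
      assume "partials l G (emb x) \<noteq> 0"
      then show False
        using partials_minimal[of l G "emb x" "[]"] G0 inD[of x G] x that by (metis Diff_iff append_Nil2 insertCI partials_simps(1) order_trans)
    qed
    obtain N where N: "open N" "emb x \<in> N" "N \<subseteq> P" "\<And>z. z \<in> N \<Longrightarrow> G z = 0"
      using zero_near_if_partials_zero[OF psubset.hyps(1) dep(3) P hol(3) xP G] by blast
    have "\<exists>V. open V \<and> x \<in> V \<and> (g ` (S \<inter> V) \<subseteq> insert (g x) M)"
    proof (cases "\<exists>j. partial j T (emb x) \<noteq> 0")
      case True
      then obtain j where j: "partial j T (emb x) \<noteq> 0" by blast
      define V where "V = emb -` {z \<in> N. partial j T z \<in> - {0}}"
      have "open {z \<in> N. partial j T z \<in> - {0}}"
      proof -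
        have "continuous_on N (partial j T)"
          using sep_hol_partial[OF P hol(1), of j] N(3) by (auto simp: sep_hol_def intro: continuous_on_subset)
        from continuous_open_preimage[OF this N(1) open_Compl[OF closed_singleton[of 0]]] show ?thesis
          by (simp add: vimage_def Int_def)
      qed
      from oemb[OF this] have "open V" by (simp add: V_def)
      moreover have "x \<in> V" using N j by (simp add: V_def)
      moreover have "g ` (S \<inter> V) \<subseteq> insert (g x) M"
      proof
        fix s assume "s \<in> g ` (S \<inter> V)"
        then obtain y where y: "y \<in> V" "s = g y" by auto
        have "locally_mono_at h (Re (T (emb y)))"
        proof (rule locally_mono_at_slice[of N T Y])
          show "sep_hol N T" "sep_hol N Y" "real_on N T"
            using hol real N(3) sep_hol_subset by (auto simp: real_on_def)
          show "Re (T (emb x)) \<in> closure {t. locally_mono_at h t} \<and> Re (Y (emb x)) = h (Re (T (emb x)))"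
            if "emb x \<in> N" for x
            using eq[of x] N(3,4) that J by blast
          show "emb y \<in> N" "partial j T (emb y) \<noteq> 0" using y by (auto simp: V_def)
        qed (use N in auto)
        then show "s \<in> insert (g x) M" using y by (simp add: M_def g_def)
      qed
      ultimately show ?thesis by blast
    next
      case False
      \<comment> \<open>Subtracting the value at \<open>x\<close> changes no derivative of positive
        order, so local constancy of \<open>T\<close> becomes local vanishing of
        \<open>T'\<close>.\<close>
      define T' where "T' = (\<lambda>z. T z - T (emb x))"
      have pdT': "partial i T' = partial i T" for i
      proof
        fix z
        have "((\<lambda>w. f w - c) has_field_derivative D) (at w) \<longleftrightarrow> (f has_field_derivative D) (at w)"
          for f :: "complex \<Rightarrow> complex" and c D w
        proof
          assume "((\<lambda>w. f w - c) has_field_derivative D) (at w)"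
          from DERIV_add[OF this DERIV_const[of c]] show "(f has_field_derivative D) (at w)" by simp
        next
          assume "(f has_field_derivative D) (at w)"
          from DERIV_diff[OF this DERIV_const[of c]] show "((\<lambda>w. f w - c) has_field_derivative D) (at w)" by simp
        qed
        then show "partial i T' z = partial i T z"
          by (simp add: partial_def T'_def deriv_def)
      qed
      have ipdT': "partials l T' = partials l T" if "l \<noteq> []" for l
        using that
      proof (induction l)
        case (Cons a l)
        then show ?case by (cases l) (simp_all add: pdT')
      qed simp
      have "partials l T' (emb x) = 0" if l: "set l \<subseteq> I" for l
      proof (cases l rule: rev_cases)
        case Nil
        then show ?thesis by (simp add: T'_def)
      next
        case (snoc l1 j)
        show ?thesis
        proof (rule ccontr)
          assume "partials l T' (emb x) \<noteq> 0"
          then have "partials l T (emb x) \<noteq> 0" using ipdT' snoc by simp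
          moreover have "partials [j] T (emb x) = 0" using False by simp
          moreover have "\<exists>l'. l = l' @ [j]" using snoc by blast
          ultimately obtain i l' where "partials l' T (emb x) = 0" "partials (i # l') T (emb x) \<noteq> 0" "set (i # l') \<subseteq> set l"
            by (rule partials_minimal)
          then show False using inD[of x T l' i] x l by auto
        qed
      qed
      moreover have "sep_hol P T'" unfolding T'_def by (intro sep_hol_diff hol sep_hol_const)
      moreover have "depends_on I T'" using dep(1) unfolding T'_def depends_on_def by metis
      ultimately obtain N' where N': "open N'" "emb x \<in> N'" "N' \<subseteq> P" "\<And>z. z \<in> N' \<Longrightarrow> T' z = 0"
        using zero_near_if_partials_zero[OF psubset.hyps(1) _ P _ xP, of T'] by blast
      have "g y = g x" if "emb y \<in> N'" for y
        using N'(4)[OF that] by (simp add: g_def T'_def)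
      then have "g ` (S \<inter> emb -` N') \<subseteq> insert (g x) M" by blast
      then show ?thesis using oemb[OF N'(1)] N'(2) by blast
    qed
    then obtain V where V: "open V" "x \<in> V" "g ` (S \<inter> V) \<subseteq> insert (g x) M" by blast
    have "g ` ((S - D) \<inter> V) \<subseteq> g ` (S \<inter> V)" by (intro image_mono) blast
    then have "g ` ((S - D) \<inter> V) - M \<subseteq> {g x}" using V(3) by blast
    then have "countable (g ` ((S - D) \<inter> V) - M)" by (rule countable_subset) simp
    then show "\<exists>V. open V \<and> x \<in> V \<and> countable (g ` ((S - D) \<inter> V) - M)"
      using V by blast
  qed
  moreover have "g ` S - M \<subseteq> (g ` (S - D) - M) \<union> (g ` D - M)" by blast
  ultimately have "countable (g ` S - M)"
    using cD by (meson countable_Un countable_subset)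
  then show ?case by (simp add: g_def S_def M_def)
qed

subsection \<open>Subanalytic graphs\<close>

lemma sep_hol_uniform_limit:
  assumes P: "open P" and f: "\<And>n. sep_hol P (f n)" and lim: "uniform_limit P f g F" and F: "F \<noteq> bot"
  shows "sep_hol P g"
  unfolding sep_hol_def
proof safe
  show "continuous_on P g"
    by (rule uniform_limit_theorem[OF _ lim F]) (use f in \<open>auto simp: sep_hol_def\<close>)
  fix z i assume z: "z \<in> P"
  obtain e where e: "e > 0" "cball (z i) e \<subseteq> {w. z(i := w) \<in> P}"
    using open_update_slice[OF P, of z i] z open_contains_cball[of "{w. z(i := w) \<in> P}"]
    by (metis fun_upd_triv mem_Collect_eq)
  have slice: "continuous_on (cball (z i) e) (\<lambda>w. f n (z(i := w)))" "(\<lambda>w. f n (z(i := w))) holomorphic_on ball (z i) e" for n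
    using sep_hol_slice_disc[OF f P, where \<rho> = e and c = "z i" and z = z and i = i] e(2) ball_subset_cball holomorphic_on_subset by blast+
  have ulim: "uniform_limit (cball (z i) e) (\<lambda>n w. f n (z(i := w))) (\<lambda>w. g (z(i := w))) F"
    by (rule uniform_limit_compose'[OF lim]) (use e in auto)
  have "\<forall>\<^sub>F n in F. continuous_on (cball (z i) e) (\<lambda>w. f n (z(i := w))) \<and>
      (\<lambda>w. f n (z(i := w))) holomorphic_on ball (z i) e"
    using slice by simp
  then have "(\<lambda>w. g (z(i := w))) holomorphic_on ball (z i) e"
    by (rule holomorphic_uniform_limit[OF _ ulim F])
  then show "(\<lambda>w. g (z(i := w))) field_differentiable at (z i)"
    by (rule holomorphic_on_imp_differentiable_at) (use e in auto)
qed

lemma sep_hol_power_series: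
  fixes c :: "(nat \<Rightarrow> nat) \<Rightarrow> real"
  assumes "(\<lambda>\<alpha>. \<bar>c \<alpha>\<bar> * (\<Prod>i<m. \<rho> ^ \<alpha> i)) summable_on A"
  shows "sep_hol (polydisc m a \<rho>) (\<lambda>z. \<Sum>\<^sub>\<infinity>\<alpha>\<in>A. of_real (c \<alpha>) * (\<Prod>i<m. (z i - a i) ^ \<alpha> i))"
proof (rule sep_hol_uniform_limit[OF open_polydisc])
  show "uniform_limit (polydisc m a \<rho>) (\<lambda>X z. \<Sum>\<alpha>\<in>X. of_real (c \<alpha>) * (\<Prod>i<m. (z i - a i) ^ \<alpha> i))
     (\<lambda>z. \<Sum>\<^sub>\<infinity>\<alpha>\<in>A. of_real (c \<alpha>) * (\<Prod>i<m. (z i - a i) ^ \<alpha> i)) (finite_subsets_at_top A)"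
  proof (rule Weierstrass_m_test_general[OF _ assms])
    fix \<alpha> z assume z: "z \<in> polydisc m a \<rho>"
    have "norm (\<Prod>i<m. (z i - a i) ^ \<alpha> i) \<le> (\<Prod>i<m. \<rho> ^ \<alpha> i)"
      unfolding prod_norm[symmetric] norm_power
      using z by (intro prod_mono conjI power_mono) (auto simp: polydisc_def dist_norm norm_minus_commute less_imp_le)
    then show "norm (of_real (c \<alpha>) * (\<Prod>i<m. (z i - a i) ^ \<alpha> i)) \<le> \<bar>c \<alpha>\<bar> * (\<Prod>i<m. \<rho> ^ \<alpha> i)"
      unfolding norm_mult norm_of_real by (intro mult_left_mono) auto
  qed
  show "sep_hol (polydisc m a \<rho>) (\<lambda>z. \<Sum>\<alpha>\<in>X. of_real (c \<alpha>) * (\<Prod>i<m. (z i - a i) ^ \<alpha> i))" for X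
    by (intro sep_hol_sum sep_hol_mult sep_hol_prod sep_hol_power sep_hol_diff sep_hol_const sep_hol_coord)
qed simp

lemma openin_Euclidean_spaceE:
  assumes "openin (Euclidean_space m) V"
  obtains W where "open W" "V = W \<inter> Rspace m"
  using assms
  by (auto simp: Euclidean_space_def euclidean_product_topology openin_subtopology)

lemma proj_first_Rspace [simp]: "proj_first m x \<in> Rspace m"
  by (simp add: proj_first_def topspace_Euclidean_space)

lemma proj_first_id: "x \<in> Rspace m \<Longrightarrow> proj_first m x = x"
  by (auto simp: proj_first_def topspace_Euclidean_space)

lemma emb_proj_first_eq:
  "depends_on I F \<Longrightarrow> I \<subseteq> {..<m} \<Longrightarrow> F (emb (proj_first m x)) = F (emb x)"
  by (erule depends_onD) (auto simp: emb_def proj_first_def)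

text \<open>Unconditional convergence at the real corner point
  \<open>a + (\<rho>, ..., \<rho>)\<close> is absolute, so its terms majorize the series on the
  complex polydisc of radius \<open>\<rho>\<close>. Membership in \<open>P\<close> is required to
  ignore the coordinates from \<open>m\<close> on because real sequences outside
  \<open>Rspace m\<close> are compared later with their projections.\<close>

lemma real_analytic_extension:
  assumes g: "real_analytic_on m g V" and V: "openin (Euclidean_space m) V" and a: "a \<in> V"
  obtains P F where "open P" "emb a \<in> P" "sep_hol P F" "real_on P F" "depends_on {..<m} F"
    "depends_on {..<m} (\<lambda>z. z \<in> P)"
    "\<And>x. x \<in> V \<Longrightarrow> emb x \<in> P \<Longrightarrow> F (emb x) = of_real (g x)"
proof -
  define A where "A = {\<alpha> :: nat \<Rightarrow> nat. \<forall>i\<ge>m. \<alpha> i = 0}"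
  obtain c :: "(nat \<Rightarrow> nat) \<Rightarrow> real" and r where r: "r > 0"
    and sum: "\<And>x. x \<in> V \<Longrightarrow> \<forall>i<m. \<bar>x i - a i\<bar> < r \<Longrightarrow>
      ((\<lambda>\<alpha>. c \<alpha> * (\<Prod>i<m. (x i - a i) ^ \<alpha> i)) has_sum g x) A"
    using g a unfolding real_analytic_on_def A_def by blast
  obtain W where W: "open W" "V = W \<inter> Rspace m"
    using V by (rule openin_Euclidean_spaceE)
  define p where "p t = (\<lambda>i. if i < m then a i + t else 0)" for t :: real
  have "continuous_on UNIV p"
  proof (rule continuous_on_coordinatewise_then_product)
    show "continuous_on UNIV (\<lambda>t. p t i)" for i
      unfolding p_def by (cases "i < m") (auto intro!: continuous_intros)
  qed
  with W(1) have "open (p -` W)" by (rule open_vimage)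
  moreover have p0: "p 0 = a" using a W by (auto simp: p_def topspace_Euclidean_space)
  ultimately obtain e where e: "e > 0" "ball 0 e \<subseteq> p -` W"
    using a W openE[of "p -` W" 0] by auto
  \<comment> \<open>The half keeps \<open>\<rho>\<close> strictly below both radii, so that
    \<open>p \<rho>\<close> lies in \<open>V\<close> and in the range where the series is known to
    converge.\<close>
  define \<rho> where "\<rho> = min e r / 2"
  have \<rho>: "\<rho> > 0" "\<rho> < e" "\<rho> < r" using e r by (auto simp: \<rho>_def)
  have "\<rho> \<in> ball 0 e" using \<rho> by simp
  then have "p \<rho> \<in> W" using e(2) by blast
  moreover have "p \<rho> \<in> Rspace m" by (simp add: p_def topspace_Euclidean_space)
  ultimately have "p \<rho> \<in> V" unfolding W(2) by blast
  from sum[OF this] have "((\<lambda>\<alpha>. c \<alpha> * (\<Prod>i<m. \<rho> ^ \<alpha> i)) has_sum g (p \<rho>)) A"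
    using \<rho> by (simp add: p_def)
  then have "(\<lambda>\<alpha>. norm (c \<alpha> * (\<Prod>i<m. \<rho> ^ \<alpha> i))) summable_on A"
    by (intro iffD1[OF summable_on_iff_abs_summable_on_real] has_sum_imp_summable)
  then have summ: "(\<lambda>\<alpha>. \<bar>c \<alpha>\<bar> * (\<Prod>i<m. \<rho> ^ \<alpha> i)) summable_on A"
    using \<rho>(1) by (simp add: abs_mult abs_prod)
  define F where "F z = (\<Sum>\<^sub>\<infinity>\<alpha>\<in>A. of_real (c \<alpha>) * (\<Prod>i<m. (z i - emb a i) ^ \<alpha> i))" for z
  have Femb: "F (emb x) = (\<Sum>\<^sub>\<infinity>\<alpha>\<in>A. of_real (c \<alpha> * (\<Prod>i<m. (x i - a i) ^ \<alpha> i)))" for x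
    by (simp add: F_def emb_def)
  show thesis
  proof (rule that[of "polydisc m (emb a) \<rho>" F])
    show "sep_hol (polydisc m (emb a) \<rho>) F"
      unfolding F_def by (rule sep_hol_power_series[OF summ])
    show "real_on (polydisc m (emb a) \<rho>) F"
      unfolding real_on_def Femb
    proof safe
      fix x
      let ?f = "\<lambda>\<alpha>. c \<alpha> * (\<Prod>i<m. (x i - a i) ^ \<alpha> i)"
      show "(\<Sum>\<^sub>\<infinity>\<alpha>\<in>A. of_real (?f \<alpha>) :: complex) \<in> \<real>"
      proof (cases "(\<lambda>\<alpha>. of_real (?f \<alpha>) :: complex) summable_on A")
        case True
        from summable_on_Re[OF this] have "?f summable_on A" by (simp del: of_real_mult)
        from has_sum_of_real[OF has_sum_infsum[OF this], where 'a = complex]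
        have "(\<Sum>\<^sub>\<infinity>\<alpha>\<in>A. of_real (?f \<alpha>) :: complex) = of_real (infsum ?f A)"
          by (rule infsumI)
        then show ?thesis by (simp only: Reals_of_real)
      next
        \<comment> \<open>The default value 0 of \<open>infsum\<close> is real as well.\<close>
        case False
        then show ?thesis by (subst infsum_not_exists) auto
      qed
    qed
    show "depends_on {..<m} (\<lambda>z. z \<in> polydisc m (emb a) \<rho>)"
      by (simp add: depends_on_def polydisc_def)
    show "depends_on {..<m} F"
      by (simp add: depends_on_def F_def)
    fix x assume x: "x \<in> V" "emb x \<in> polydisc m (emb a) \<rho>"
    have "\<bar>x i - a i\<bar> < r" if "i < m" for i
    proof -
      have "\<bar>a i - x i\<bar> < \<rho>"
        using x(2) that by (simp add: polydisc_def emb_def dist_norm flip: of_real_diff)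
      then show ?thesis using \<rho> by simp
    qed
    then have "((\<lambda>\<alpha>. c \<alpha> * (\<Prod>i<m. (x i - a i) ^ \<alpha> i)) has_sum g x) A"
      using sum[OF x(1)] by blast
    from has_sum_of_real[OF this, where 'a = complex] show "F (emb x) = of_real (g x)"
      unfolding Femb by (rule infsumI)
  next
    show "emb a \<in> polydisc m (emb a) \<rho>" using \<rho> by (simp add: polydisc_def)
  qed (rule open_polydisc)
qed

text \<open>Near a given point the strict inequalities only shrink the domain, being open
  conditions, and all equations together with \<open>L = 0\<close> merge into one: at real points a
  sum of squares of real values vanishes only if each of them does.\<close>

lemma countable_values_on_basic_analytic_set:
  fixes h :: "real \<Rightarrow> real"
  assumes V: "openin (Euclidean_space m) V" and A: "basic_analytic_set m V A"
    and hol: "sep_hol UNIV T" "sep_hol UNIV Y" "sep_hol UNIV L"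
    and real: "real_on UNIV T" "real_on UNIV Y" "real_on UNIV L"
    and dep: "depends_on {..<m} T" "depends_on {..<m} Y" "depends_on {..<m} L"
    and J: "open J" "J \<subseteq> closure {t. locally_mono_at h t}"
    and eq: "\<And>x. x \<in> A \<Longrightarrow> L (emb x) = 0 \<Longrightarrow> Re (T (emb x)) \<in> J \<Longrightarrow> Re (Y (emb x)) = h (Re (T (emb x)))"
  shows "countable ((\<lambda>x. Re (T (emb x))) ` {x \<in> A. L (emb x) = 0 \<and> Re (T (emb x)) \<in> J} - {t. locally_mono_at h t})"
proof (rule countable_image_diff_Lindelof)
  define S where "S = {x \<in> A. L (emb x) = 0 \<and> Re (T (emb x)) \<in> J}"
  obtain Z Q where ZQ: "finite Z" "finite Q" "\<And>g. g \<in> Z \<union> Q \<Longrightarrow> real_analytic_on m g V"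
      "A = {x \<in> V. (\<forall>g\<in>Z. g x = 0) \<and> (\<forall>g\<in>Q. g x > 0)}"
    using A unfolding basic_analytic_set_def by blast
  obtain W where W: "open W" "V = W \<inter> Rspace m"
    using V by (rule openin_Euclidean_spaceE)
  fix b assume "b \<in> {x \<in> A. L (emb x) = 0 \<and> Re (T (emb x)) \<in> J}"
  then have b: "b \<in> A" "Re (T (emb b)) \<in> J" "b \<in> V" using ZQ by auto
  have "\<forall>g. \<exists>P F. g \<in> Z \<union> Q \<longrightarrow> open P \<and> emb b \<in> P \<and> sep_hol P F \<and> real_on P F \<and> depends_on {..<m} F \<and>
      depends_on {..<m} (\<lambda>z. z \<in> P) \<and> (\<forall>x. x \<in> V \<longrightarrow> emb x \<in> P \<longrightarrow> F (emb x) = of_real (g x))"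
    using real_analytic_extension[OF ZQ(3) V b(3)] by metis
  then obtain P F where PF: "\<And>g. g \<in> Z \<union> Q \<Longrightarrow> open (P g) \<and> emb b \<in> P g \<and> sep_hol (P g) (F g) \<and> real_on (P g) (F g)
      \<and> depends_on {..<m} (F g) \<and>
      depends_on {..<m} (\<lambda>z. z \<in> P g) \<and> (\<forall>x. x \<in> V \<longrightarrow> emb x \<in> P g \<longrightarrow> F g (emb x) = of_real (g x))"
    by metis
  \<comment> \<open>The last set asks the real parts of the first \<open>m\<close> coordinates to
    form a point of \<open>W\<close>. \<open>V\<close> is open only within \<open>Rspace m\<close>,
    whereas the domain must be open among all complex sequences.\<close>
  define P0 where "P0 = (\<Inter>g\<in>Z \<union> Q. P g) \<inter> {z. Re (T z) \<in> J} \<inter> {z. (\<lambda>i. if i < m then Re (z i) else 0) \<in> W}"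
  have "open {z. Re (T z) \<in> J}"
    using open_vimage[OF J(1), of "\<lambda>z. Re (T z)"] hol(1) by (auto simp: sep_hol_def vimage_def intro!: continuous_on_Re)
  moreover have "continuous_on UNIV (\<lambda>z :: nat \<Rightarrow> complex. \<lambda>i. if i < m then Re (z i) else 0)"
  proof (rule continuous_on_coordinatewise_then_product)
    fix i
    have "continuous_on UNIV (\<lambda>z :: nat \<Rightarrow> complex. Re (z i))"
      by (intro continuous_on_Re continuous_on_product_coordinates)
    then show "continuous_on UNIV (\<lambda>z :: nat \<Rightarrow> complex. if i < m then Re (z i) else 0)"
      by (cases "i < m") auto
  qed
  from open_vimage[OF W(1) this] have "open {z :: nat \<Rightarrow> complex. (\<lambda>i. if i < m then Re (z i) else 0) \<in> W}"
    by (simp add: vimage_def)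
  ultimately have P0: "open P0"
    unfolding P0_def using ZQ(1,2) PF by (intro open_Int open_INT) auto
  have P0W: "proj_first m x \<in> V" if "emb x \<in> P0" for x
  proof -
    have "(\<lambda>i. if i < m then Re (emb x i) else 0) \<in> W" using that by (simp add: P0_def)
    moreover have "(\<lambda>i. if i < m then Re (emb x i) else 0) = proj_first m x"
      by (rule ext) (auto simp: emb_def proj_first_def)
    ultimately have "proj_first m x \<in> W" by simp
    then show ?thesis using W(2) by simp
  qed
  have bR: "proj_first m b = b" using b(3) W(2) by (simp add: proj_first_id)
  have bP0: "emb b \<in> P0"
  proof -
    have "(\<lambda>i. if i < m then Re (emb b i) else 0) = proj_first m b"
      by (rule ext) (auto simp: emb_def proj_first_def)
    then have "(\<lambda>i. if i < m then Re (emb b i) else 0) = b" using bR by simp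
    then show ?thesis using b W PF by (auto simp: P0_def)
  qed
  have P0sub: "P0 \<subseteq> P g" if "g \<in> Z \<union> Q" for g using that by (auto simp: P0_def)
  have holF: "sep_hol P0 (F g)" if "g \<in> Z \<union> Q" for g
    using PF[OF that] sep_hol_subset P0sub[OF that] by blast
  define P1 where "P1 = P0 \<inter> (\<Inter>g\<in>Q. {z \<in> P0. Re (F g z) \<in> {0<..}})"
  have "open {z \<in> P0. Re (F g z) \<in> {0<..}}" if "g \<in> Q" for g
  proof -
    have "continuous_on P0 (\<lambda>z. Re (F g z))"
      using holF[of g] that by (intro continuous_on_Re) (simp add: sep_hol_def)
    from continuous_open_preimage[OF this P0 open_greaterThan[of 0]] show ?thesis
      by (simp add: vimage_def Int_def)
  qed
  then have P1: "open P1"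
    unfolding P1_def using P0 ZQ(2) by (intro open_Int open_INT) auto
  have Fval: "F g (emb x) = of_real (g x)" if "g \<in> Z \<union> Q" "x \<in> V" "emb x \<in> P0" for g x
    using PF[OF that(1)] P0sub[OF that(1)] that by blast
  have bP1: "emb b \<in> P1"
    unfolding P1_def using bP0 Fval[OF _ b(3) bP0] b(1) ZQ(4) by auto
  define G where "G z = (\<Sum>g\<in>Z. (F g z)^2) + (L z)^2" for z
  have sub: "P1 \<subseteq> P0" by (auto simp: P1_def)
  have G0: "(\<forall>g\<in>Z. F g (emb x) = 0) \<and> L (emb x) = 0" if x: "emb x \<in> P1" and G: "G (emb x) = 0" for x
  proof -
    have r: "F g (emb x) = of_real (Re (F g (emb x)))" if "g \<in> Z" for g
      using PF[of g] P0sub[of g] sub x that by (auto simp: real_on_def)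
    have l: "L (emb x) = of_real (Re (L (emb x)))"
      using real(3) by (simp add: real_on_def)
    have "G (emb x) = of_real ((\<Sum>g\<in>Z. (Re (F g (emb x)))^2) + (Re (L (emb x)))^2)"
      unfolding G_def of_real_add of_real_sum of_real_power l[symmetric]
      using r by (simp cong: sum.cong)
    then have "(\<Sum>g\<in>Z. (Re (F g (emb x)))^2) + (Re (L (emb x)))^2 = 0"
      using G by (metis of_real_eq_0_iff)
    then have "(\<Sum>g\<in>Z. (Re (F g (emb x)))^2) = 0" "(Re (L (emb x)))^2 = 0"
      using add_nonneg_eq_0_iff[OF sum_nonneg zero_le_power2, of Z "\<lambda>g. (Re (F g (emb x)))^2" "Re (L (emb x))"] by auto
    then show ?thesis
      using r l ZQ(1) by (auto simp: sum_nonneg_eq_0_iff)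
  qed
  have "countable ((\<lambda>x. Re (T (emb x))) ` {x. emb x \<in> P1 \<and> G (emb x) = 0} - {t. locally_mono_at h t})"
  proof (rule countable_values_on_zero_set[OF finite_lessThan[of m] J(2) P1, of T Y G])
    show "sep_hol P1 G"
      unfolding G_def using holF sub
      by (intro sep_hol_add sep_hol_sum sep_hol_power) (auto intro: sep_hol_subset hol(3))
    show "real_on P1 G"
      unfolding real_on_def G_def
    proof safe
      fix x assume x: "emb x \<in> P1"
      have "F g (emb x) \<in> \<real>" if "g \<in> Z" for g
        using PF[of g] P0sub[of g] sub x that by (auto simp: real_on_def)
      moreover have "L (emb x) \<in> \<real>" using real(3) by (simp add: real_on_def)
      ultimately show "(\<Sum>g\<in>Z. (F g (emb x))^2) + (L (emb x))^2 \<in> \<real>"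
        by (intro Reals_add sum_in_Reals Reals_power) auto
    qed
    show "depends_on {..<m} G"
      unfolding depends_on_def G_def
    proof safe
      fix z z' :: "nat \<Rightarrow> complex" assume zz: "\<forall>i\<in>{..<m}. z i = z' i"
      have "F g z = F g z'" if "g \<in> Z" for g
      proof -
        have "depends_on {..<m} (F g)" using PF that by blast
        then show ?thesis by (rule depends_onD) (use zz in blast)
      qed
      moreover have "L z = L z'" by (rule depends_onD[OF dep(3)]) (use zz in blast)
      ultimately show "(\<Sum>g\<in>Z. (F g z)^2) + (L z)^2 = (\<Sum>g\<in>Z. (F g z')^2) + (L z')^2" by simp
    qed
    show "real_on P1 T" "real_on P1 Y" using real by (auto simp: real_on_def)
    show "sep_hol P1 T" "sep_hol P1 Y" using hol sep_hol_subset by blast+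
    fix x assume x: "emb x \<in> P1" "G (emb x) = 0"
    \<comment> \<open>The coordinates of \<open>x\<close> from \<open>m\<close> on are arbitrary;
      the projection has the same values under all functions concerned and lies in \<open>V\<close>,
      where the analytic data are given.\<close>
    define y where "y = proj_first m x"
    have pe: "H (emb y) = H (emb x)" if "depends_on {..<m} H" for H :: "_ \<Rightarrow> complex"
      unfolding y_def by (rule emb_proj_first_eq[OF that]) auto
    have yV: "y \<in> V" using P0W x(1) sub by (auto simp: y_def)
    have TJ: "Re (T (emb x)) \<in> J" using x(1) sub by (auto simp: P0_def)
    have gy: "of_real (g y) = F g (emb x)" if g: "g \<in> Z \<union> Q" for g
    proof -
      have yx: "emb y i = emb x i" if "i < m" for i using that by (simp add: y_def emb_def proj_first_def)
      have "depends_on {..<m} (\<lambda>z. z \<in> P g)" using PF[OF g] by blast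
      then have "(emb y \<in> P g) = (emb x \<in> P g)" by (rule depends_onD) (simp add: yx)
      then have "emb y \<in> P g" using x(1) sub P0sub[OF g] by blast
      then have "F g (emb y) = of_real (g y)" using PF[OF g] yV by blast
      moreover have "depends_on {..<m} (F g)" using PF[OF g] by blast
      ultimately show ?thesis using pe[of "F g"] by simp
    qed
    have "g y = 0" if "g \<in> Z" for g
      using gy[of g] G0[OF x] that by (metis UnI1 of_real_eq_0_iff)
    moreover have "g y > 0" if "g \<in> Q" for g
    proof -
      have "Re (F g (emb x)) > 0" using x(1) that by (auto simp: P1_def)
      then show ?thesis using gy[of g] that by (metis Re_complex_of_real UnI2)
    qed
    ultimately have "y \<in> A" using ZQ(4) yV by blast
    moreover have "L (emb y) = 0" using G0[OF x] pe[OF dep(3)] by simp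
    ultimately show "Re (T (emb x)) \<in> J \<and> Re (Y (emb x)) = h (Re (T (emb x)))"
      using eq[of y] TJ pe[OF dep(1)] pe[OF dep(2)] by simp
  qed (use dep in auto)
  moreover have "x \<in> {x. emb x \<in> P1 \<and> G (emb x) = 0}" if "x \<in> S" "emb x \<in> P1" for x
  proof -
    have x: "x \<in> V" "\<forall>g\<in>Z. g x = 0" "L (emb x) = 0" using that ZQ(4) by (auto simp: S_def)
    have "F g (emb x) = 0" if "g \<in> Z" for g
      using Fval[of g x] x sub \<open>emb x \<in> P1\<close> that by auto
    then show ?thesis using x \<open>emb x \<in> P1\<close> by (simp add: G_def)
  qed
  then have "(\<lambda>x. Re (T (emb x))) ` (S \<inter> emb -` P1) \<subseteq> (\<lambda>x. Re (T (emb x))) ` {x. emb x \<in> P1 \<and> G (emb x) = 0}"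
    by blast
  ultimately have "countable ((\<lambda>x. Re (T (emb x))) ` (S \<inter> emb -` P1) - {t. locally_mono_at h t})"
    by (meson Diff_mono countable_subset order_refl)
  moreover have "open (emb -` P1)" by (rule open_vimage[OF P1 continuous_on_emb])
  ultimately show "\<exists>N. open N \<and> b \<in> N \<and> countable ((\<lambda>x. Re (T (emb x))) `
      ({x \<in> A. L (emb x) = 0 \<and> Re (T (emb x)) \<in> J} \<inter> N) - {t. locally_mono_at h t})"
    using bP1 unfolding S_def[symmetric] by blast
qed

lemma countable_values_on_semianalytic:
  fixes h :: "real \<Rightarrow> real"
  assumes A: "semianalytic m A"
    and hol: "sep_hol UNIV T" "sep_hol UNIV Y" "sep_hol UNIV L"
    and real: "real_on UNIV T" "real_on UNIV Y" "real_on UNIV L"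
    and dep: "depends_on {..<m} T" "depends_on {..<m} Y" "depends_on {..<m} L"
    and J: "open J" "J \<subseteq> closure {t. locally_mono_at h t}"
    and eq: "\<And>x. x \<in> A \<Longrightarrow> L (emb x) = 0 \<Longrightarrow> Re (T (emb x)) \<in> J \<Longrightarrow> Re (Y (emb x)) = h (Re (T (emb x)))"
  shows "countable ((\<lambda>x. Re (T (emb x))) ` {x \<in> A. L (emb x) = 0 \<and> Re (T (emb x)) \<in> J} - {t. locally_mono_at h t})"
proof (rule countable_image_diff_Lindelof)
  fix b assume b: "b \<in> {x \<in> A. L (emb x) = 0 \<and> Re (T (emb x)) \<in> J}"
  then have "b \<in> Rspace m" using A by (auto simp: semianalytic_def)
  then obtain V F where V: "openin (Euclidean_space m) V" "b \<in> V"
    and F: "finite F" "\<And>A'. A' \<in> F \<Longrightarrow> basic_analytic_set m V A'" "A \<inter> V = \<Union>F"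
    using A unfolding semianalytic_def by metis
  obtain W where W: "open W" "V = W \<inter> Rspace m"
    using V(1) by (rule openin_Euclidean_spaceE)
  have AW: "A \<inter> W = \<Union>F" using F(3) W A unfolding semianalytic_def by blast
  have c: "countable ((\<lambda>x. Re (T (emb x))) ` {x \<in> A'. L (emb x) = 0 \<and> Re (T (emb x)) \<in> J} - {t. locally_mono_at h t})"
    if "A' \<in> F" for A'
  proof (rule countable_values_on_basic_analytic_set[OF V(1) F(2)[OF that] hol real dep J])
    fix x assume "x \<in> A'" "L (emb x) = 0" "Re (T (emb x)) \<in> J"
    then show "Re (Y (emb x)) = h (Re (T (emb x)))" using eq[of x] F(3) that by blast
  qed
  have "(\<lambda>x. Re (T (emb x))) ` ({x \<in> A. L (emb x) = 0 \<and> Re (T (emb x)) \<in> J} \<inter> W) - {t. locally_mono_at h t} \<subseteq>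
    (\<Union>A'\<in>F. (\<lambda>x. Re (T (emb x))) ` {x \<in> A'. L (emb x) = 0 \<and> Re (T (emb x)) \<in> J} - {t. locally_mono_at h t})"
    (is "?l \<subseteq> ?r")
  proof
    fix t assume "t \<in> ?l"
    then obtain x where x: "x \<in> A" "x \<in> W" "L (emb x) = 0" "Re (T (emb x)) \<in> J" "t = Re (T (emb x))" "\<not> locally_mono_at h t"
      by auto
    then obtain A' where "A' \<in> F" "x \<in> A'" using AW by blast
    then show "t \<in> ?r" using x by blast
  qed
  moreover have "countable ?r"
    using F(1) c by (intro countable_UN) (auto intro: countable_finite)
  ultimately have "countable ?l" by (rule countable_subset)
  then show "\<exists>N. open N \<and> b \<in> N \<and> countable ((\<lambda>x. Re (T (emb x))) `
      ({x \<in> A. L (emb x) = 0 \<and> Re (T (emb x)) \<in> J} \<inter> N) - {t. locally_mono_at h t})"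
    using W V(2) by blast
qed

text \<open>A projection of a semianalytic set need not be semianalytic, but \<open>T\<close>,
  \<open>Y\<close> and \<open>L\<close> ignore the coordinates that are projected away. Their values
  can thus be counted on the semianalytic set upstairs.\<close>

lemma countable_values_on_subanalytic:
  fixes h :: "real \<Rightarrow> real"
  assumes X: "subanalytic m X"
    and hol: "sep_hol UNIV T" "sep_hol UNIV Y" "sep_hol UNIV L"
    and real: "real_on UNIV T" "real_on UNIV Y" "real_on UNIV L"
    and dep: "depends_on {..<m} T" "depends_on {..<m} Y" "depends_on {..<m} L"
    and J: "open J" "J \<subseteq> closure {t. locally_mono_at h t}"
    and eq: "\<And>x. x \<in> X \<Longrightarrow> L (emb x) = 0 \<Longrightarrow> Re (T (emb x)) \<in> J \<Longrightarrow> Re (Y (emb x)) = h (Re (T (emb x)))"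
  shows "countable ((\<lambda>x. Re (T (emb x))) ` {x \<in> X. L (emb x) = 0 \<and> Re (T (emb x)) \<in> J} - {t. locally_mono_at h t})"
proof (rule countable_image_diff_Lindelof)
  fix b assume b: "b \<in> {x \<in> X. L (emb x) = 0 \<and> Re (T (emb x)) \<in> J}"
  then have "b \<in> Rspace m" using X by (auto simp: subanalytic_def)
  then obtain V k A where V: "openin (Euclidean_space m) V" "b \<in> V"
    and A: "semianalytic (m + k) A" "X \<inter> V = proj_first m ` A"
    using X unfolding subanalytic_def by metis
  obtain W where W: "open W" "V = W \<inter> Rspace m"
    using V(1) by (rule openin_Euclidean_spaceE)
  have XW: "X \<inter> W = proj_first m ` A" using A(2) W X unfolding subanalytic_def by blast
  have pe: "H (emb (proj_first m x)) = H (emb x)" if "depends_on {..<m} H" for H :: "_ \<Rightarrow> complex" and x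
    by (rule emb_proj_first_eq[OF that]) auto
  have dep': "depends_on {..<m + k} H" if "depends_on {..<m} H" for H :: "(nat \<Rightarrow> complex) \<Rightarrow> complex"
    using that by (auto simp: depends_on_def)
  have c: "countable ((\<lambda>x. Re (T (emb x))) ` {x \<in> A. L (emb x) = 0 \<and> Re (T (emb x)) \<in> J} - {t. locally_mono_at h t})"
  proof (rule countable_values_on_semianalytic[OF A(1) hol real dep'[OF dep(1)] dep'[OF dep(2)] dep'[OF dep(3)] J])
    fix x assume x: "x \<in> A" "L (emb x) = 0" "Re (T (emb x)) \<in> J"
    then have "proj_first m x \<in> X" using A(2) by blast
    from eq[OF this] x show "Re (Y (emb x)) = h (Re (T (emb x)))"
      by (simp add: pe dep)
  qed
  have "(\<lambda>x. Re (T (emb x))) ` ({x \<in> X. L (emb x) = 0 \<and> Re (T (emb x)) \<in> J} \<inter> W) \<subseteq>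
    (\<lambda>x. Re (T (emb x))) ` {x \<in> A. L (emb x) = 0 \<and> Re (T (emb x)) \<in> J}" (is "?l \<subseteq> ?r")
  proof
    fix t assume "t \<in> ?l"
    then obtain x where x: "x \<in> X \<inter> W" "L (emb x) = 0" "Re (T (emb x)) \<in> J" "t = Re (T (emb x))"
      by auto
    then obtain y where "y \<in> A" "x = proj_first m y" using XW by blast
    then show "t \<in> ?r" using x by (auto simp: pe dep)
  qed
  then have "countable (?l - {t. locally_mono_at h t})"
    using c by (meson Diff_mono countable_subset order_refl)
  then show "\<exists>N. open N \<and> b \<in> N \<and> countable ((\<lambda>x. Re (T (emb x))) `
      ({x \<in> X. L (emb x) = 0 \<and> Re (T (emb x)) \<in> J} \<inter> N) - {t. locally_mono_at h t})"
    using W V(2) by blast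
qed

section \<open>The graph over a line\<close>

lemma inner_coords: "v \<bullet> w = (\<Sum>i<CARD('n). coords v i * coords w i)" for v w :: "real ^ 'n"
proof -
  have "bij_betw (from_nat_into (UNIV :: 'n set)) {..<CARD('n)} UNIV"
    by (rule bij_betw_from_nat_into_finite) simp
  then have "(\<Sum>i<CARD('n). v $ from_nat_into UNIV i * w $ from_nat_into UNIV i) = (\<Sum>k\<in>UNIV. v $ k * w $ k)"
    by (rule sum.reindex_bij_betw)
  then show ?thesis by (simp add: inner_vec_def coords_def)
qed

lemma coords_eqI:
  assumes "\<And>i. i < CARD('n) \<Longrightarrow> coords v i = coords w i" shows "v = (w :: real ^ 'n)"
proof -
  have "coords v = coords w"
    by (rule ext) (metis assms coords_def)
  then show ?thesis using bij_betw_coords[where 'n = 'n] by (auto simp: bij_betw_def inj_def)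
qed

lemma coords_linear: "coords (p + t *\<^sub>R v) i = coords p i + t * coords v i"
  by (simp add: coords_def)

text \<open>\<open>T\<close> recovers the parameter from a coordinate \<open>j\<close> in which
  \<open>v\<close> is nonzero. At a real point \<open>L\<close> vanishes exactly when the first half
  of the coordinates lies on the line, and \<open>Y\<close> applies the functional \<open>a\<close>
  to the second half. All three are polynomials with real coefficients.\<close>

lemma subanalytic_line:
  fixes f :: "real ^ 'n \<Rightarrow> real ^ 'n"
  assumes f: "subanalytic (2 * CARD('n)) (graph_on U f)"
    and v: "v \<noteq> 0" and seg: "\<And>t. t \<in> {0<..<1} \<Longrightarrow> p + t *\<^sub>R v \<in> U"
    and h: "h = (\<lambda>t. a \<bullet> f (p + t *\<^sub>R v))"
    and dense: "{0<..<1} \<subseteq> closure {t. locally_mono_at h t}"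
  shows "countable ({0<..<1} - {t. locally_mono_at h t})"
proof -
  let ?n = "CARD('n)"
  obtain j where j: "j < ?n" "coords v j \<noteq> 0"
    using v coords_eqI[of v 0] by (auto simp: coords_def)
  define T :: "(nat \<Rightarrow> complex) \<Rightarrow> complex"
    where "T z = (z j - of_real (coords p j)) * of_real (1 / coords v j)" for z
  define L :: "(nat \<Rightarrow> complex) \<Rightarrow> complex"
    where "L z = (\<Sum>i<?n. (z i - (of_real (coords p i) + T z * of_real (coords v i)))^2)" for z
  define Y :: "(nat \<Rightarrow> complex) \<Rightarrow> complex"
    where "Y z = (\<Sum>i<?n. of_real (coords a i) * z (?n + i))" for z
  define Tr where "Tr x = (x j - coords p j) / coords v j" for x
  have T: "T (emb x) = of_real (Tr x)" for x by (simp add: T_def emb_def Tr_def)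
  have e: "emb x i = of_real (x i)" for x i by (simp add: emb_def)
  have L: "L (emb x) = of_real (\<Sum>i<?n. (x i - (coords p i + Tr x * coords v i))^2)" for x
    by (simp add: L_def T e)
  have Y: "Y (emb x) = of_real (\<Sum>i<?n. coords a i * x (?n + i))" for x
    by (simp add: Y_def e)
  define pt where "pt c = juxtapose ?n (coords c) (coords (f c))" for c :: "real ^ 'n"
  have pt1: "pt c i = coords c i" if "i < ?n" for c i using that by (simp add: pt_def juxtapose_def)
  have pt2: "pt c (?n + i) = coords (f c) i" for c i by (simp add: pt_def juxtapose_def)
  have Ypt: "Y (emb (pt c)) = of_real (a \<bullet> f c)" for c
    unfolding Y by (simp add: pt2 inner_coords)
  have "countable ((\<lambda>x. Re (T (emb x))) ` {x \<in> graph_on U f. L (emb x) = 0 \<and> Re (T (emb x)) \<in> {0<..<1}} - {t. locally_mono_at h t})"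
  proof (rule countable_values_on_subanalytic[OF f _ _ _ _ _ _ _ _ _ open_greaterThanLessThan dense, of T Y L])
    show hT: "sep_hol UNIV T"
      unfolding T_def by (intro sep_hol_mult sep_hol_diff sep_hol_coord sep_hol_const)
    show "sep_hol UNIV L"
      unfolding L_def by (intro sep_hol_sum sep_hol_power sep_hol_diff sep_hol_add sep_hol_mult sep_hol_coord sep_hol_const hT)
    show "sep_hol UNIV Y"
      unfolding Y_def by (intro sep_hol_sum sep_hol_mult sep_hol_coord sep_hol_const)
    show "real_on UNIV T" "real_on UNIV L" "real_on UNIV Y"
      unfolding real_on_def T L Y by (simp_all only: Reals_of_real simp_thms)
    show dT: "depends_on {..<2 * ?n} T" using j by (simp add: depends_on_def T_def)
    show "depends_on {..<2 * ?n} L"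
      unfolding depends_on_def
    proof (intro allI impI)
      fix z z' :: "nat \<Rightarrow> complex" assume z: "\<forall>i\<in>{..<2 * ?n}. z i = z' i"
      have "T z = T z'" by (rule depends_onD[OF dT]) (use z in blast)
      then show "L z = L z'" unfolding L_def using z by (intro sum.cong) auto
    qed
    show "depends_on {..<2 * ?n} Y" by (auto simp: depends_on_def Y_def intro!: sum.cong)
    fix x assume x: "x \<in> graph_on U f" "L (emb x) = 0"
    then obtain c where c: "x = pt c" by (auto simp: graph_on_def pt_def)
    have "(\<Sum>i<?n. (x i - (coords p i + Tr x * coords v i))^2) = 0"
      using x(2) unfolding L by (simp only: of_real_eq_0_iff)
    then have "x i = coords p i + Tr x * coords v i" if "i < ?n" for i
      using that by (subst (asm) sum_nonneg_eq_0_iff) auto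
    then have "c = p + Tr x *\<^sub>R v"
      by (intro coords_eqI) (simp add: coords_linear c pt1)
    then show "Re (Y (emb x)) = h (Re (T (emb x)))"
      unfolding c Ypt T h by simp
  qed
  moreover have "{0<..<1} \<subseteq> (\<lambda>x. Re (T (emb x))) ` {x \<in> graph_on U f. L (emb x) = 0 \<and> Re (T (emb x)) \<in> {0<..<1}}"
  proof
    fix t :: real assume t: "t \<in> {0<..<1}"
    define x where "x = pt (p + t *\<^sub>R v)"
    have Tx: "Tr x = t" using j by (simp add: Tr_def x_def pt1 coords_linear)
    have "L (emb x) = 0" unfolding L Tx by (simp add: x_def pt1 coords_linear)
    moreover have "x \<in> graph_on U f" using seg[OF t] by (auto simp: x_def pt_def graph_on_def)
    ultimately show "t \<in> (\<lambda>x. Re (T (emb x))) ` {x \<in> graph_on U f. L (emb x) = 0 \<and> Re (T (emb x)) \<in> {0<..<1}}"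
      using t by (intro image_eqI[of _ _ x]) (simp_all add: T Tx)
  qed
  ultimately show ?thesis
    by (meson Diff_mono countable_subset order_refl)
qed

subsection \<open>Graphs definable in an o-minimal structure\<close>

text \<open>This is the first-order form: the tolerance is replaced by endpoints \<open>s1\<close>
  and \<open>s2\<close>, and the witnesses are kept in the unit interval, the only place where the
  graph of \<open>h\<close> is assumed to be definable.\<close>

lemma not_locally_mono_at_iff:
  assumes "t \<in> {0<..<1}"
  shows "\<not> locally_mono_at h t \<longleftrightarrow>
    (\<forall>s1 s2. s1 < t \<and> t < s2 \<longrightarrow> (\<exists>a b. s1 < a \<and> b < s2 \<and> a < b \<and> a \<in> {0<..<1} \<and> b \<in> {0<..<1} \<and> h b < h a))"
    (is "_ \<longleftrightarrow> ?r")
proof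
  assume no: "\<not> locally_mono_at h t"
  show ?r
  proof (intro allI impI)
    fix s1 s2 assume s: "s1 < t \<and> t < s2"
    \<comment> \<open>The bounds \<open>t\<close> and \<open>1 - t\<close> keep the witnesses inside
      the unit interval.\<close>
    define \<epsilon> where "\<epsilon> = min (min (t - s1) (s2 - t)) (min t (1 - t))"
    have "\<epsilon> > 0" using s assms by (simp add: \<epsilon>_def)
    then have "\<not> mono_on {t - \<epsilon><..<t + \<epsilon>} h" using no by (auto simp: locally_mono_at_def)
    then obtain a b where ab: "a \<in> {t - \<epsilon><..<t + \<epsilon>}" "b \<in> {t - \<epsilon><..<t + \<epsilon>}" "a \<le> b" "\<not> h a \<le> h b"
      by (auto simp: monotone_on_def)
    then have "a < b" by (cases "a = b") auto
    then show "\<exists>a b. s1 < a \<and> b < s2 \<and> a < b \<and> a \<in> {0<..<1} \<and> b \<in> {0<..<1} \<and> h b < h a"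
      using ab by (intro exI[of _ a] exI[of _ b]) (auto simp: \<epsilon>_def)
  qed
next
  assume r: ?r
  show "\<not> locally_mono_at h t"
  proof
    assume "locally_mono_at h t"
    then obtain \<epsilon> where \<epsilon>: "\<epsilon> > 0" "mono_on {t - \<epsilon><..<t + \<epsilon>} h" by (auto simp: locally_mono_at_def)
    obtain a b where ab: "t - \<epsilon> < a" "b < t + \<epsilon>" "a < b" "h b < h a"
      using r[rule_format, of "t - \<epsilon>" "t + \<epsilon>"] \<epsilon> by auto
    then have "h a \<le> h b" by (intro mono_onD[OF \<epsilon>(2)]) auto
    then show False using ab by simp
  qed
qed

context o_minimal_structure
begin

lemma Def_Rspace: "Rspace m \<in> Def m"
proof -
  interpret algebra "Rspace m" "Def m" by (rule boolean_algebra)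
  show ?thesis by (rule top)
qed

lemma Def_Int: "A \<in> Def m \<Longrightarrow> B \<in> Def m \<Longrightarrow> A \<inter> B \<in> Def m"
proof -
  interpret algebra "Rspace m" "Def m" by (rule boolean_algebra)
  show "A \<in> Def m \<Longrightarrow> B \<in> Def m \<Longrightarrow> A \<inter> B \<in> Def m" by (rule Int)
qed

lemma Def_Compl: "A \<in> Def m \<Longrightarrow> Rspace m - A \<in> Def m"
proof -
  interpret algebra "Rspace m" "Def m" by (rule boolean_algebra)
  show "A \<in> Def m \<Longrightarrow> Rspace m - A \<in> Def m" by (rule compl_sets)
qed

section \<open>A calculus of first-order formulas\<close>

definition definable :: "nat \<Rightarrow> ((nat \<Rightarrow> real) \<Rightarrow> bool) \<Rightarrow> bool"
  where "definable m P \<longleftrightarrow> {x \<in> Rspace m. P x} \<in> Def m"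

lemma definable_cong: "(\<And>x. x \<in> Rspace m \<Longrightarrow> P x = Q x) \<Longrightarrow> definable m P = definable m Q"
  unfolding definable_def by (metis (mono_tags, lifting) Collect_cong)

lemma definable_True: "definable m (\<lambda>x. True)"
  using Def_Rspace[of m] by (simp add: definable_def)

lemma definable_conj: "definable m P \<Longrightarrow> definable m Q \<Longrightarrow> definable m (\<lambda>x. P x \<and> Q x)"
  unfolding definable_def by (drule (1) Def_Int) (simp add: Int_def conj_ac cong: conj_cong)

lemma definable_not: "definable m P \<Longrightarrow> definable m (\<lambda>x. \<not> P x)"
  unfolding definable_def by (drule Def_Compl) (simp add: set_diff_eq cong: conj_cong)

lemma definable_ball:
  "finite I \<Longrightarrow> (\<And>i. i \<in> I \<Longrightarrow> definable m (P i)) \<Longrightarrow> definable m (\<lambda>x. \<forall>i\<in>I. P i x)"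
  by (induction I rule: finite_induct) (auto intro: definable_True definable_conj)

lemma Rspace_shift: "x \<in> Rspace (Suc m) \<Longrightarrow> (\<lambda>i. x (Suc i)) \<in> Rspace m"
  by (simp add: topspace_Euclidean_space)

lemma definable_times_line: "definable m P \<Longrightarrow> definable (Suc m) (\<lambda>x. P (proj_first m x))"
  unfolding definable_def by (drule times_line) (simp add: proj_first_Rspace)

lemma definable_line_times: "definable m P \<Longrightarrow> definable (Suc m) (\<lambda>x. P (\<lambda>i. x (Suc i)))"
  unfolding definable_def by (drule line_times) (simp add: Rspace_shift cong: conj_cong)

lemma definable_times_lines: "definable m P \<Longrightarrow> definable (m + k) (\<lambda>x. P (proj_first m x))"
proof (induction k)
  case 0
  have "proj_first m x = x" if "x \<in> Rspace m" for x
    using that by (auto simp: proj_first_def topspace_Euclidean_space)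
  then have "definable m (\<lambda>x. P (proj_first m x)) = definable m P" by (intro definable_cong) simp
  with 0 show ?case by simp
next
  case (Suc k)
  have "proj_first m (proj_first (m + k) x) = proj_first m x" for x
    by (auto simp: proj_first_def)
  with definable_times_line[OF Suc.IH[OF Suc.prems]] show ?case by simp
qed

lemma definable_lines_times: "definable m P \<Longrightarrow> definable (k + m) (\<lambda>x. P (\<lambda>i. x (k + i)))"
proof (induction k)
  case (Suc k)
  from definable_line_times[OF Suc.IH[OF Suc.prems]] show ?case by simp
qed simp

text \<open>The quantified variable sits in the last coordinate, where \<open>projection\<close>
  acts; longer formulas below order their variables accordingly.\<close>

lemma definable_exists:
  assumes "definable (Suc m) P"
  shows "definable m (\<lambda>x. \<exists>t. P (x(m := t)))"
proof -
  have "proj_first m ` {x \<in> Rspace (Suc m). P x} = {x \<in> Rspace m. \<exists>t. P (x(m := t))}"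
  proof (intro set_eqI iffI)
    fix x assume "x \<in> proj_first m ` {x \<in> Rspace (Suc m). P x}"
    then obtain y where y: "y \<in> Rspace (Suc m)" "P y" "x = proj_first m y" by auto
    have "x(m := y m) = y" using y by (auto simp: proj_first_def topspace_Euclidean_space)
    then have "P (x(m := y m))" using y(2) by simp
    then show "x \<in> {x \<in> Rspace m. \<exists>t. P (x(m := t))}"
      using y(3) proj_first_Rspace by blast
  next
    fix x assume "x \<in> {x \<in> Rspace m. \<exists>t. P (x(m := t))}"
    then obtain t where t: "x \<in> Rspace m" "P (x(m := t))" by auto
    then show "x \<in> proj_first m ` {x \<in> Rspace (Suc m). P x}"
      by (intro image_eqI[of _ _ "x(m := t)"]) (auto simp: proj_first_def topspace_Euclidean_space)
  qed
  with projection[OF assms[unfolded definable_def]] show ?thesis by (simp add: definable_def)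
qed

lemma definable_exists_many:
  assumes "definable (m + k) P"
  shows "definable m (\<lambda>x. \<exists>y\<in>Rspace k. P (juxtapose m x y))"
  using assms
proof (induction k arbitrary: P)
  case 0
  have "definable m (\<lambda>x. \<exists>y\<in>Rspace 0. P (juxtapose m x y)) = definable m P"
  proof (rule definable_cong)
    fix x assume x: "x \<in> Rspace m"
    have "juxtapose m x y = x" if "y \<in> Rspace 0" for y
      using that x by (auto simp: juxtapose_def topspace_Euclidean_space)
    moreover have "(\<lambda>i. 0) \<in> Rspace 0" by (simp add: topspace_Euclidean_space)
    ultimately show "(\<exists>y\<in>Rspace 0. P (juxtapose m x y)) = P x" by metis
  qed
  with 0 show ?case by simp
next
  case (Suc k)
  have "definable (m + k) (\<lambda>x. \<exists>t. P (x(m + k := t)))"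
    by (rule definable_exists) (use Suc.prems in simp)
  from Suc.IH[OF this]
  have "definable m (\<lambda>x. \<exists>y\<in>Rspace k. \<exists>t. P ((juxtapose m x y)(m + k := t)))" .
  also have "(\<lambda>x. \<exists>y\<in>Rspace k. \<exists>t. P ((juxtapose m x y)(m + k := t))) = (\<lambda>x. \<exists>y\<in>Rspace (Suc k). P (juxtapose m x y))"
  proof (intro ext iffI)
    fix x assume "\<exists>y\<in>Rspace k. \<exists>t. P ((juxtapose m x y)(m + k := t))"
    then obtain y t where y: "y \<in> Rspace k" "P ((juxtapose m x y)(m + k := t))" by blast
    have "(juxtapose m x y)(m + k := t) = juxtapose m x (y(k := t))"
      by (auto simp: juxtapose_def fun_eq_iff)
    moreover have "y(k := t) \<in> Rspace (Suc k)" using y by (simp add: topspace_Euclidean_space)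
    ultimately show "\<exists>y\<in>Rspace (Suc k). P (juxtapose m x y)" using y by metis
  next
    fix x assume "\<exists>y\<in>Rspace (Suc k). P (juxtapose m x y)"
    then obtain y where y: "y \<in> Rspace (Suc k)" "P (juxtapose m x y)" by blast
    have "(juxtapose m x (proj_first k y))(m + k := y k) = juxtapose m x y"
      using y(1) by (auto simp: juxtapose_def fun_eq_iff proj_first_def topspace_Euclidean_space)
    then show "\<exists>y\<in>Rspace k. \<exists>t. P ((juxtapose m x y)(m + k := t))"
      using y proj_first_Rspace by metis
  qed
  finally show ?case .
qed

text \<open>The axiom \<open>diagonal\<close> compares only the first and the last coordinate, so
  \<open>i\<close> coordinates are added in front and \<open>m - Suc j\<close> behind.\<close>

lemma definable_eq_coord:
  assumes "i < m" "j < m" shows "definable m (\<lambda>x. x i = x j)"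
proof -
  have *: "definable m (\<lambda>x. x i = x j)" if ij: "i \<le> j" "j < m" for i j
  proof -
    have "definable (Suc (j - i)) (\<lambda>x. x 0 = x (j - i))"
      using diagonal by (simp add: definable_def)
    from definable_times_lines[OF definable_lines_times[OF this, of i], of "m - Suc j"]
    show ?thesis using ij by (simp add: proj_first_def)
  qed
  show ?thesis
  proof (cases "i \<le> j")
    case False
    then have "definable m (\<lambda>x. x j = x i)" using * assms by simp
    then show ?thesis by (simp add: eq_commute)
  qed (use * assms in simp)
qed

text \<open>The axioms only pad at either end. A renaming of variables, possibly with repetitions,
  is obtained by appending fresh coordinates, equating them with the coordinates \<open>s i\<close>
  and quantifying them away.\<close>

lemma definable_subst:
  assumes P: "definable k P" and s: "\<And>i. i < k \<Longrightarrow> s i < m"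
  shows "definable m (\<lambda>x. P (\<lambda>i. if i < k then x (s i) else 0))"
proof -
  have "definable (m + k) (\<lambda>z. P (\<lambda>i. z (m + i)) \<and> (\<forall>i\<in>{..<k}. z (m + i) = z (s i)))"
    using s by (intro definable_conj definable_lines_times[OF P] definable_ball definable_eq_coord)
      (auto intro: less_trans add_strict_left_mono trans_less_add1)
  from definable_exists_many[OF this]
  have "definable m (\<lambda>x. \<exists>y\<in>Rspace k. P (\<lambda>i. juxtapose m x y (m + i)) \<and>
      (\<forall>i\<in>{..<k}. juxtapose m x y (m + i) = juxtapose m x y (s i)))" .
  also have "(\<lambda>x. \<exists>y\<in>Rspace k. P (\<lambda>i. juxtapose m x y (m + i)) \<and>
      (\<forall>i\<in>{..<k}. juxtapose m x y (m + i) = juxtapose m x y (s i))) =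
    (\<lambda>x. P (\<lambda>i. if i < k then x (s i) else 0))"
  proof (intro ext)
    fix x
    have "(\<exists>y\<in>Rspace k. P (\<lambda>i. juxtapose m x y (m + i)) \<and>
      (\<forall>i\<in>{..<k}. juxtapose m x y (m + i) = juxtapose m x y (s i))) \<longleftrightarrow>
      (\<exists>y\<in>Rspace k. P y \<and> (\<forall>i\<in>{..<k}. y i = x (s i)))"
      using s by (simp add: juxtapose_def)
    also have "\<dots> \<longleftrightarrow> (\<exists>y. y = (\<lambda>i. if i < k then x (s i) else 0) \<and> P y)"
    proof -
      have "y = (\<lambda>i. if i < k then x (s i) else 0) \<longleftrightarrow> y \<in> Rspace k \<and> (\<forall>i\<in>{..<k}. y i = x (s i))" for y
        by (auto simp: topspace_Euclidean_space)
      then show ?thesis by (simp only: Bex_def conj_ac)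
    qed
    finally show "(\<exists>y\<in>Rspace k. P (\<lambda>i. juxtapose m x y (m + i)) \<and>
      (\<forall>i\<in>{..<k}. juxtapose m x y (m + i) = juxtapose m x y (s i))) = P (\<lambda>i. if i < k then x (s i) else 0)"
      by blast
  qed
  finally show ?thesis .
qed

lemma definable_less: "i < m \<Longrightarrow> j < m \<Longrightarrow> definable m (\<lambda>x. x i < x j)"
proof -
  assume ij: "i < m" "j < m"
  have "definable 2 (\<lambda>x. x 0 < x 1)" using order by (simp add: definable_def)
  from definable_subst[OF this, of "\<lambda>l. if l = 0 then i else j" m] ij show ?thesis by simp
qed

lemma definable_add: "i < m \<Longrightarrow> j < m \<Longrightarrow> l < m \<Longrightarrow> definable m (\<lambda>x. x l = x i + x j)"
proof -
  assume ij: "i < m" "j < m" "l < m"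
  have "definable 3 (\<lambda>x. x 2 = x 0 + x 1)" using addition by (simp add: definable_def)
  from definable_subst[OF this, of "\<lambda>k. if k = 0 then i else if k = 1 then j else l" m] ij
  show ?thesis by simp
qed

lemma definable_mult: "i < m \<Longrightarrow> j < m \<Longrightarrow> l < m \<Longrightarrow> definable m (\<lambda>x. x l = x i * x j)"
proof -
  assume ij: "i < m" "j < m" "l < m"
  have "definable 3 (\<lambda>x. x 2 = x 0 * x 1)" using multiplication by (simp add: definable_def)
  from definable_subst[OF this, of "\<lambda>k. if k = 0 then i else if k = 1 then j else l" m] ij
  show ?thesis by simp
qed

text \<open>Real parameters enter here, through the direction of \<open>o_minimal\<close> that makes
  every interval of the line definable.\<close>

lemma definable_interval:
  assumes "is_interval I" "i < m" shows "definable m (\<lambda>x. x i \<in> I)"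
proof -
  have "(\<lambda>x. x 0) ` {x \<in> Rspace 1. x 0 \<in> I} = \<Union>{I}"
  proof (intro set_eqI iffI)
    fix t assume "t \<in> \<Union>{I}"
    then show "t \<in> (\<lambda>x. x 0) ` {x \<in> Rspace 1. x 0 \<in> I}"
      by (intro image_eqI[of _ _ "\<lambda>i. if i = 0 then t else 0"]) (auto simp: topspace_Euclidean_space)
  qed auto
  then have "definable 1 (\<lambda>x. x 0 \<in> I)"
    unfolding definable_def o_minimal using assms(1) by (intro conjI exI[of _ "{I}"]) auto
  from definable_subst[OF this, of "\<lambda>_. i" m] assms(2) show ?thesis by simp
qed

text \<open>A term is definable if its graph is, the value being stored in the last coordinate.\<close>

definition dterm :: "nat \<Rightarrow> ((nat \<Rightarrow> real) \<Rightarrow> real) \<Rightarrow> bool"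
  where "dterm m g \<longleftrightarrow> definable (Suc m) (\<lambda>x. x m = g (proj_first m x))"

lemma dterm_const: "dterm m (\<lambda>x. c)"
  using definable_interval[of "{c}" m "Suc m"] by (simp add: dterm_def is_interval_1)

lemma dterm_coord: "i < m \<Longrightarrow> dterm m (\<lambda>x. x i)"
  using definable_eq_coord[of m "Suc m" i] by (simp add: dterm_def proj_first_def)

text \<open>Coordinate \<open>m\<close> holds the result and the next two hold the arguments of
  \<open>f\<close>; these are tied to \<open>g\<close> and \<open>h\<close> and then quantified
  away.\<close>

lemma dterm_op:
  assumes g: "dterm m g" "dterm m h"
    and op: "definable (Suc (Suc (Suc m))) (\<lambda>x. x m = f (x (Suc m)) (x (Suc (Suc m))))"
  shows "dterm m (\<lambda>x. f (g x) (h x))"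
proof -
  let ?N = "Suc (Suc (Suc m))"
  have g': "definable ?N (\<lambda>x. x (Suc m) = g (proj_first m x))"
  proof -
    from definable_subst[OF g(1)[unfolded dterm_def], of "\<lambda>i. if i = m then Suc m else i" ?N]
    have "definable ?N (\<lambda>x. x (Suc m) = g (proj_first m (\<lambda>i. if i < Suc m then x (if i = m then Suc m else i) else 0)))"
      by simp
    also have "(\<lambda>x. proj_first m (\<lambda>i. if i < Suc m then x (if i = m then Suc m else i) else 0)) = proj_first m"
      by (auto simp: proj_first_def fun_eq_iff)
    then have "(\<lambda>x. x (Suc m) = g (proj_first m (\<lambda>i. if i < Suc m then x (if i = m then Suc m else i) else 0))) =
        (\<lambda>x. x (Suc m) = g (proj_first m x))"
      by (metis (no_types))
    finally show ?thesis .
  qed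
  have h': "definable ?N (\<lambda>x. x (Suc (Suc m)) = h (proj_first m x))"
  proof -
    from definable_subst[OF g(2)[unfolded dterm_def], of "\<lambda>i. if i = m then Suc (Suc m) else i" ?N]
    have "definable ?N (\<lambda>x. x (Suc (Suc m)) = h (proj_first m (\<lambda>i. if i < Suc m then x (if i = m then Suc (Suc m) else i) else 0)))"
      by simp
    also have "(\<lambda>x. proj_first m (\<lambda>i. if i < Suc m then x (if i = m then Suc (Suc m) else i) else 0)) = proj_first m"
      by (auto simp: proj_first_def fun_eq_iff)
    then have "(\<lambda>x. x (Suc (Suc m)) = h (proj_first m (\<lambda>i. if i < Suc m then x (if i = m then Suc (Suc m) else i) else 0))) =
        (\<lambda>x. x (Suc (Suc m)) = h (proj_first m x))"
      by (metis (no_types))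
    finally show ?thesis .
  qed
  have "definable (Suc m) (\<lambda>x. \<exists>a b. x m = f a b \<and> a = g (proj_first m x) \<and> b = h (proj_first m x))"
  proof -
    have p: "proj_first m (x(Suc m := a, Suc (Suc m) := b)) = proj_first m x" for x a b
      by (auto simp: proj_first_def)
    from definable_exists[OF definable_exists[OF definable_conj[OF op definable_conj[OF g' h']]]]
    show ?thesis by (simp add: p)
  qed
  then show ?thesis by (simp add: dterm_def)
qed

lemma dterm_add: "dterm m g \<Longrightarrow> dterm m h \<Longrightarrow> dterm m (\<lambda>x. g x + h x)"
  by (rule dterm_op) (auto intro: definable_add)

lemma dterm_mult: "dterm m g \<Longrightarrow> dterm m h \<Longrightarrow> dterm m (\<lambda>x. g x * h x)"
  by (rule dterm_op) (auto intro: definable_mult)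

lemma dterm_sum: "finite I \<Longrightarrow> (\<And>i. i \<in> I \<Longrightarrow> dterm m (g i)) \<Longrightarrow> dterm m (\<lambda>x. \<Sum>i\<in>I. g i x)"
  by (induction I rule: finite_induct) (auto intro: dterm_const dterm_add)

lemma definable_eq_dterm:
  assumes "dterm m g" "i < m" shows "definable m (\<lambda>x. x i = g x)"
proof -
  have "definable m (\<lambda>x. \<exists>t. (x(m := t)) i = (x(m := t)) m \<and> (x(m := t)) m = g (proj_first m (x(m := t))))"
    using assms(2) by (intro definable_exists definable_conj definable_eq_coord assms(1)[unfolded dterm_def]) auto
  also have "?this \<longleftrightarrow> definable m (\<lambda>x. x i = g x)"
  proof (rule definable_cong)
    fix x assume "x \<in> Rspace m"
    then have "proj_first m (x(m := t)) = x" for t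
      by (auto simp: proj_first_def topspace_Euclidean_space)
    then show "(\<exists>t. (x(m := t)) i = (x(m := t)) m \<and> (x(m := t)) m = g (proj_first m (x(m := t)))) = (x i = g x)"
      using assms(2) by auto
  qed
  finally show ?thesis .
qed

lemma definable_line_graph:
  fixes f :: "real ^ 'n \<Rightarrow> real ^ 'n"
  assumes f: "graph_on U f \<in> Def (2 * CARD('n))"
  shows "definable 2 (\<lambda>x. p + x 0 *\<^sub>R v \<in> U \<and> x 1 = a \<bullet> f (p + x 0 *\<^sub>R v))"
proof -
  let ?n = "CARD('n)" let ?N = "2 + 2 * CARD('n)"
  have X: "definable (2 * ?n) (\<lambda>w. w \<in> graph_on U f)"
  proof -
    interpret algebra "Rspace (2 * ?n)" "Def (2 * ?n)" by (rule boolean_algebra)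
    have "{w \<in> Rspace (2 * ?n). w \<in> graph_on U f} = graph_on U f"
      using sets_into_space[OF f] by blast
    then show ?thesis using f by (simp add: definable_def)
  qed
  \<comment> \<open>Coordinates 0 and 1 hold the parameter and the value of the functional; the
    others hold a point of the graph, to be quantified away.\<close>
  have "definable ?N (\<lambda>z. (\<lambda>i. z (2 + i)) \<in> graph_on U f \<and>
      (\<forall>i\<in>{..<?n}. z (2 + i) = coords p i + z 0 * coords v i) \<and>
      z 1 = (\<Sum>i<?n. coords a i * z (2 + (?n + i))))"
    by (intro definable_conj definable_lines_times[OF X] definable_ball definable_eq_dterm
        dterm_add dterm_mult dterm_sum dterm_const dterm_coord) auto
  from definable_exists_many[OF this]
  have "definable 2 (\<lambda>x. \<exists>w\<in>Rspace (2 * ?n). (\<lambda>i. juxtapose 2 x w (2 + i)) \<in> graph_on U f \<and>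
      (\<forall>i\<in>{..<?n}. juxtapose 2 x w (2 + i) = coords p i + juxtapose 2 x w 0 * coords v i) \<and>
      juxtapose 2 x w 1 = (\<Sum>i<?n. coords a i * juxtapose 2 x w (2 + (?n + i))))" .
  also have "?this \<longleftrightarrow> definable 2 (\<lambda>x. p + x 0 *\<^sub>R v \<in> U \<and> x 1 = a \<bullet> f (p + x 0 *\<^sub>R v))"
  proof (rule definable_cong)
    fix x :: "nat \<Rightarrow> real"
    define pt where "pt c = juxtapose ?n (coords c) (coords (f c))" for c :: "real ^ 'n"
    have pt1: "pt c i = coords c i" if "i < ?n" for c i using that by (simp add: pt_def juxtapose_def)
    have pt2: "pt c (?n + i) = coords (f c) i" for c i by (simp add: pt_def juxtapose_def)
    have "(\<exists>w\<in>Rspace (2 * ?n). (\<lambda>i. juxtapose 2 x w (2 + i)) \<in> graph_on U f \<and>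
      (\<forall>i\<in>{..<?n}. juxtapose 2 x w (2 + i) = coords p i + juxtapose 2 x w 0 * coords v i) \<and>
      juxtapose 2 x w 1 = (\<Sum>i<?n. coords a i * juxtapose 2 x w (2 + (?n + i)))) \<longleftrightarrow>
      (\<exists>w\<in>Rspace (2 * ?n). w \<in> graph_on U f \<and> (\<forall>i\<in>{..<?n}. w i = coords p i + x 0 * coords v i) \<and>
        x 1 = (\<Sum>i<?n. coords a i * w (?n + i)))"
      by (simp add: juxtapose_def)
    also have "\<dots> \<longleftrightarrow> (\<exists>c\<in>U. (\<forall>i\<in>{..<?n}. pt c i = coords p i + x 0 * coords v i) \<and>
        x 1 = (\<Sum>i<?n. coords a i * pt c (?n + i)))"
    proof -
      have "pt c \<in> Rspace (2 * ?n)" for c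
        by (auto simp: pt_def juxtapose_def coords_def topspace_Euclidean_space)
      then show ?thesis by (auto simp: graph_on_def pt_def)
    qed
    also have "\<dots> \<longleftrightarrow> (\<exists>c\<in>U. c = p + x 0 *\<^sub>R v \<and> x 1 = a \<bullet> f c)"
    proof -
      have "(\<forall>i\<in>{..<?n}. pt c i = coords p i + x 0 * coords v i) \<longleftrightarrow> c = p + x 0 *\<^sub>R v" for c
        using coords_eqI[of c "p + x 0 *\<^sub>R v"] by (auto simp: pt1 coords_linear)
      then show ?thesis by (simp add: pt2 inner_coords)
    qed
    finally show "(\<exists>w\<in>Rspace (2 * ?n). (\<lambda>i. juxtapose 2 x w (2 + i)) \<in> graph_on U f \<and>
      (\<forall>i\<in>{..<?n}. juxtapose 2 x w (2 + i) = coords p i + juxtapose 2 x w 0 * coords v i) \<and>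
      juxtapose 2 x w 1 = (\<Sum>i<?n. coords a i * juxtapose 2 x w (2 + (?n + i)))) \<longleftrightarrow>
      (p + x 0 *\<^sub>R v \<in> U \<and> x 1 = a \<bullet> f (p + x 0 *\<^sub>R v))" by blast
  qed
  finally show ?thesis .
qed

lemma countable_not_locally_mono:
  assumes H: "definable 2 H" and eq: "\<And>x. x 0 \<in> {0<..<1} \<Longrightarrow> H x \<longleftrightarrow> x 1 = h (x 0)"
    and dense: "{0<..<1} \<subseteq> closure {t. locally_mono_at h t}"
  shows "countable ({0<..<1} - {t. locally_mono_at h t})"
proof -
  have I: "definable m (\<lambda>x. x i \<in> {0<..<1})" if "i < m" for i m
    by (rule definable_interval[OF _ that]) (simp add: is_interval_1)
  have HH: "definable 7 (\<lambda>x. H (\<lambda>l. if l < 2 then x (if l = 0 then i else j) else 0))" if "i < 7" "j < 7" for i j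
    by (rule definable_subst[OF H]) (use that in auto)
  have Hij: "H (\<lambda>l. if l < 2 then x (if l = 0 then i else j) else 0) \<longleftrightarrow> x j = h (x i)"
    if "x i \<in> {0<..<1}" for x :: "nat \<Rightarrow> real" and i j
    using that by (subst eq) auto
  \<comment> \<open>The coordinates stand for \<open>t\<close>, \<open>s1\<close>,
    \<open>s2\<close>, \<open>a\<close>, \<open>b\<close>, \<open>h a\<close>, \<open>h b\<close> in
    this order and are eliminated from the last one down. The values of \<open>h\<close> are
    variables of their own because only the graph \<open>H\<close> is definable.\<close>
  have "definable 7 (\<lambda>x. x 1 < x 3 \<and> x 4 < x 2 \<and> x 3 < x 4 \<and> x 3 \<in> {0<..<1} \<and> x 4 \<in> {0<..<1} \<and>
      H (\<lambda>l. if l < 2 then x (if l = 0 then 3 else 5) else 0) \<and>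
      H (\<lambda>l. if l < 2 then x (if l = 0 then 4 else 6) else 0) \<and> x 6 < x 5)"
    by (intro definable_conj definable_less I HH) auto
  also have "?this \<longleftrightarrow> definable 7 (\<lambda>x. x 1 < x 3 \<and> x 4 < x 2 \<and> x 3 < x 4 \<and> x 3 \<in> {0<..<1} \<and> x 4 \<in> {0<..<1} \<and>
      x 5 = h (x 3) \<and> x 6 = h (x 4) \<and> x 6 < x 5)"
    by (intro definable_cong) (use Hij in blast)
  finally have "definable (Suc 6) (\<lambda>x. x 1 < x 3 \<and> x 4 < x 2 \<and> x 3 < x 4 \<and> x 3 \<in> {0<..<1} \<and> x 4 \<in> {0<..<1} \<and>
      x 5 = h (x 3) \<and> x 6 = h (x 4) \<and> x 6 < x 5)" by simp
  from definable_exists[OF this]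
  have "definable (Suc 5) (\<lambda>x. x 1 < x 3 \<and> x 4 < x 2 \<and> x 3 < x 4 \<and> x 3 \<in> {0<..<1} \<and> x 4 \<in> {0<..<1} \<and>
      x 5 = h (x 3) \<and> h (x 4) < x 5)" by simp
  from definable_exists[OF this]
  have "definable (Suc 4) (\<lambda>x. x 1 < x 3 \<and> x 4 < x 2 \<and> x 3 < x 4 \<and> x 3 \<in> {0<..<1} \<and> x 4 \<in> {0<..<1} \<and>
      h (x 4) < h (x 3))" by simp
  from definable_exists[OF this]
  have "definable (Suc 3) (\<lambda>x. \<exists>b. x 1 < x 3 \<and> b < x 2 \<and> x 3 < b \<and> x 3 \<in> {0<..<1} \<and> b \<in> {0<..<1} \<and> h b < h (x 3))"
    by simp
  from definable_exists[OF this]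
  have "definable 3 (\<lambda>x. \<exists>a b. x 1 < a \<and> b < x 2 \<and> a < b \<and> a \<in> {0<..<1} \<and> b \<in> {0<..<1} \<and> h b < h a)"
    by simp
  from definable_not[OF this]
  have "definable (Suc 2) (\<lambda>x. x 1 < x 0 \<and> x 0 < x 2 \<and>
      \<not> (\<exists>a b. x 1 < a \<and> b < x 2 \<and> a < b \<and> a \<in> {0<..<1} \<and> b \<in> {0<..<1} \<and> h b < h a))"
    by (intro definable_conj definable_less) simp_all
  from definable_exists[OF this]
  have "definable (Suc 1) (\<lambda>x. \<exists>s2. x 1 < x 0 \<and> x 0 < s2 \<and>
      \<not> (\<exists>a b. x 1 < a \<and> b < s2 \<and> a < b \<and> a \<in> {0<..<1} \<and> b \<in> {0<..<1} \<and> h b < h a))"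
    by (simp add: numeral_2_eq_2)
  from definable_exists[OF this]
  have "definable 1 (\<lambda>x. \<exists>s1 s2. s1 < x 0 \<and> x 0 < s2 \<and>
      \<not> (\<exists>a b. s1 < a \<and> b < s2 \<and> a < b \<and> a \<in> {0<..<1} \<and> b \<in> {0<..<1} \<and> h b < h a))"
    by simp
  from definable_conj[OF I[of 0 1] definable_not[OF this]]
  have "definable 1 (\<lambda>x. x 0 \<in> {0<..<1} \<and> \<not> (\<exists>s1 s2. s1 < x 0 \<and> x 0 < s2 \<and>
      \<not> (\<exists>a b. s1 < a \<and> b < s2 \<and> a < b \<and> a \<in> {0<..<1} \<and> b \<in> {0<..<1} \<and> h b < h a)))"
    by simp
  also have "?this \<longleftrightarrow> definable 1 (\<lambda>x. x 0 \<in> {0<..<1} \<and> \<not> locally_mono_at h (x 0))"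
    using not_locally_mono_at_iff[of _ h] by (intro definable_cong) (metis (no_types, lifting))
  finally obtain F where F: "finite F" "\<forall>I\<in>F. is_interval I"
    "(\<lambda>x. x 0) ` {x \<in> Rspace 1. x 0 \<in> {0<..<1} \<and> \<not> locally_mono_at h (x 0)} = \<Union>F"
    unfolding definable_def o_minimal by blast
  have bad: "{0<..<1} - {t. locally_mono_at h t} = \<Union>F"
    unfolding F(3)[symmetric]
  proof (intro set_eqI iffI)
    fix t :: real assume "t \<in> {0<..<1} - {t. locally_mono_at h t}"
    then show "t \<in> (\<lambda>x. x 0) ` {x \<in> Rspace 1. x 0 \<in> {0<..<1} \<and> \<not> locally_mono_at h (x 0)}"
      by (intro image_eqI[of _ _ "\<lambda>i. if i = 0 then t else 0"]) (auto simp: topspace_Euclidean_space)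
  qed auto
  \<comment> \<open>Two points of \<open>I\<close> would span an open interval of exceptional
    parameters, against density; so \<open>I\<close> has at most one point.\<close>
  have ctbl: "countable I" if "I \<in> F" for I
  proof -
    have "\<not> a < b" if ab: "a \<in> I" "b \<in> I" for a b
    proof
      assume lt: "a < b"
      have "(a + b) / 2 \<in> {a<..<b}" using lt by (simp add: field_simps)
      have sub: "{a<..<b} \<subseteq> I"
      proof
        fix c assume "c \<in> {a<..<b}"
        then show "c \<in> I" using F(2) \<open>I \<in> F\<close> ab unfolding is_interval_1
          by (metis greaterThanLessThan_iff less_imp_le)
      qed
      then have "(a + b) / 2 \<in> {0<..<1}" using \<open>(a + b) / 2 \<in> {a<..<b}\<close> bad \<open>I \<in> F\<close> by blast
      then have "(a + b) / 2 \<in> closure {t. locally_mono_at h t}" using dense by blast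
      then obtain t where "t \<in> {a<..<b}" "locally_mono_at h t"
        using \<open>(a + b) / 2 \<in> {a<..<b}\<close> open_greaterThanLessThan[of a b]
        by (metis closure_iff_nhds_not_empty disjoint_iff mem_Collect_eq subset_refl)
      then show False using sub bad \<open>I \<in> F\<close> by blast
    qed
    then have "\<forall>a\<in>I. \<forall>b\<in>I. a = b" by (metis linorder_neqE_linordered_idom)
    then have "I = {} \<or> (\<exists>a. I = {a})" by blast
    then show ?thesis by auto
  qed
  have "countable (\<Union>I\<in>F. I)" using F(1) ctbl by (intro countable_UN[OF countable_finite]) auto
  then show ?thesis unfolding bad by simp
qed

end

lemma o_minimal_line:
  fixes f :: "real ^ 'n \<Rightarrow> real ^ 'n"
  assumes "o_minimal_structure Def" and f: "graph_on U f \<in> Def (2 * CARD('n))"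
    and seg: "\<And>t. t \<in> {0<..<1} \<Longrightarrow> p + t *\<^sub>R v \<in> U"
    and h: "h = (\<lambda>t. a \<bullet> f (p + t *\<^sub>R v))"
    and dense: "{0<..<1} \<subseteq> closure {t. locally_mono_at h t}"
  shows "countable ({0<..<1} - {t. locally_mono_at h t})"
proof -
  interpret o_minimal_structure Def by fact
  show ?thesis
    by (rule countable_not_locally_mono[OF definable_line_graph[OF f, of p v a] _ dense])
      (use seg in \<open>auto simp: h\<close>)
qed

subsection \<open>Injectivity\<close>

lemma tame_line:
  fixes f :: "real ^ 'n \<Rightarrow> real ^ 'n"
  assumes "tame_on U f" and "v \<noteq> 0" and "\<And>t. t \<in> {0<..<1} \<Longrightarrow> p + t *\<^sub>R v \<in> U"
    and "h = (\<lambda>t. a \<bullet> f (p + t *\<^sub>R v))"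
    and "{0<..<1} \<subseteq> closure {t. locally_mono_at h t}"
  shows "countable ({0<..<1} - {t. locally_mono_at h t})"
  using assms(1) unfolding tame_on_def
proof
  assume "subanalytic (2 * CARD('n)) (graph_on U f)"
  then show ?thesis by (rule subanalytic_line) (fact assms)+
next
  assume "\<exists>Def. o_minimal_structure Def \<and> graph_on U f \<in> Def (2 * CARD('n))"
  then obtain Def where "o_minimal_structure Def" "graph_on U f \<in> Def (2 * CARD('n))" by blast
  then show ?thesis by (rule o_minimal_line) (fact assms)+
qed

lemma jacobian_derivative:
  fixes f :: "real ^ 'n \<Rightarrow> real ^ 'n"
  assumes "f differentiable (at x)"
  shows "(f has_derivative (\<lambda>h. jacobian f (at x) *v h)) (at x)"
  using jacobian_works assms by blast

lemma nowhere_dense_interior: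
  assumes "open U" "closedin (top_of_set U) B" "nowhere_dense_in (top_of_set U) B"
    and "open S" "S \<subseteq> B"
  shows "S = {}"
proof -
  have "top_of_set U closure_of B = B"
    using assms(2) by (simp add: closure_of_closedin)
  then have "top_of_set U interior_of B = {}"
    using assms(3) by (simp add: nowhere_dense_in_def)
  moreover have "S \<subseteq> U" using assms(3,5) by (auto simp: nowhere_dense_in_def)
  then have "openin (top_of_set U) S" using assms(4) by (simp add: open_subset)
  then have "S \<subseteq> top_of_set U interior_of B" using assms(5) by (simp add: interior_of_maximal)
  ultimately show ?thesis by simp
qed

text \<open>The derivative of \<open>(1 - t) G + t\<close> is \<open>A\<inverse> ((1 - t) C + t A)\<close>, where \<open>A\<close> and \<open>C\<close> are
  the Jacobians of \<open>f\<close> at \<open>G w\<close> and \<open>w\<close>: its surjectivity is exactly where the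
  nonsingularity of convex combinations enters.\<close>

lemma invertible_interpolation:
  fixes A C :: "real ^ 'n ^ 'n"
  assumes g: "linear g" "\<And>x. g (A *v x) = x" "\<And>y. A *v g y = y"
    and inv: "invertible ((1 - t) *\<^sub>R C + t *\<^sub>R A)"
  obtains k where "bounded_linear k" "(\<lambda>h. (1 - t) *\<^sub>R g (C *v h) + t *\<^sub>R h) \<circ> k = id"
proof -
  let ?E = "(1 - t) *\<^sub>R C + t *\<^sub>R A"
  obtain E' where E': "?E ** E' = mat 1" "E' ** ?E = mat 1" using inv by (auto simp: invertible_def)
  have D: "(1 - t) *\<^sub>R g (C *v h) + t *\<^sub>R h = g (?E *v h)" for h
  proof -
    have "g (?E *v h) = g ((1 - t) *\<^sub>R (C *v h) + t *\<^sub>R (A *v h))"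
      by (simp add: matrix_vector_mult_add_rdistrib scaleR_matrix_vector_assoc)
    also have "\<dots> = (1 - t) *\<^sub>R g (C *v h) + t *\<^sub>R g (A *v h)"
      using g(1) by (simp add: linear_add linear_scale)
    finally show ?thesis using g(2) by simp
  qed
  show thesis
  proof (rule that[of "\<lambda>y. E' *v (A *v y)"])
    show "bounded_linear (\<lambda>y. E' *v (A *v y))"
      unfolding matrix_vector_mul_assoc by (rule matrix_vector_mul_bounded_linear)
    show "(\<lambda>h. (1 - t) *\<^sub>R g (C *v h) + t *\<^sub>R h) \<circ> (\<lambda>y. E' *v (A *v y)) = id"
      unfolding D by (rule ext) (simp add: matrix_vector_mul_assoc matrix_mul_assoc E' g(2) flip: matrix_vector_mul_assoc[of A])
  qed
qed

text \<open>For each rational \<open>t\<close> the good \<open>w\<close> are relatively open in a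
  closed ball, because \<open>B\<close> is closed in \<open>U\<close>, and dense, because
  \<open>\<Phi> t\<close> would map an open set of bad \<open>w\<close> onto an open subset of
  \<open>B\<close>. Baire's theorem handles countably many \<open>t\<close> at once, and the
  rationals suffice to make the good parameters dense.\<close>

lemma ex_avoiding_segment:
  fixes G :: "'a::euclidean_space \<Rightarrow> 'a"
  assumes W: "open W" "W \<noteq> {}" and G: "\<And>w. w \<in> W \<Longrightarrow> (G has_derivative G' w) (at w)"
    and surj: "\<And>w t. w \<in> W \<Longrightarrow> t \<in> {0..1} \<Longrightarrow>
      \<exists>k. bounded_linear k \<and> (\<lambda>h. (1 - t) *\<^sub>R G' w h + t *\<^sub>R h) \<circ> k = id"
    and inU: "\<And>w t. w \<in> W \<Longrightarrow> t \<in> {0..1} \<Longrightarrow> (1 - t) *\<^sub>R G w + t *\<^sub>R w \<in> U"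
    and B: "closedin (top_of_set U) B" and nd: "\<And>S. open S \<Longrightarrow> S \<subseteq> B \<Longrightarrow> S = {}"
  obtains w where "w \<in> W" "\<And>t. t \<in> \<rat> \<Longrightarrow> t \<in> {0..1} \<Longrightarrow> (1 - t) *\<^sub>R G w + t *\<^sub>R w \<notin> B"
proof -
  define \<Phi> where "\<Phi> t w = (1 - t) *\<^sub>R G w + t *\<^sub>R w" for t w
  obtain w0 r where r: "r > 0" "cball w0 r \<subseteq> W" using W open_contains_cball by blast
  let ?S = "cball w0 r"
  define \<G> where "\<G> = (\<lambda>t. {w \<in> ?S. \<Phi> t w \<notin> B}) ` (\<rat> \<inter> {0..1})"
  have der: "(\<Phi> t has_derivative (\<lambda>h. (1 - t) *\<^sub>R G' w h + t *\<^sub>R h)) (at w)" if "w \<in> W" for t w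
    unfolding \<Phi>_def by (intro derivative_intros G that)
  have cont: "continuous_on W (\<Phi> t)" for t
    using der has_derivative_continuous by (blast intro: continuous_at_imp_continuous_on)
  have "?S \<subseteq> closure (\<Inter>\<G>)"
  proof (rule Baire)
    show "countable \<G>" unfolding \<G>_def using countable_rat by (intro countable_image) auto
    fix T assume "T \<in> \<G>"
    then obtain t where t: "t \<in> {0..1}" "T = {w \<in> ?S. \<Phi> t w \<notin> B}" by (auto simp: \<G>_def)
    obtain C where C: "closed C" "B = U \<inter> C" using B by (auto simp: closedin_closed)
    have "closedin (top_of_set ?S) (?S \<inter> \<Phi> t -` C)"
      by (intro continuous_closedin_preimage C continuous_on_subset[OF cont r(2)])
    moreover have "T = ?S - (?S \<inter> \<Phi> t -` C)"
      using inU[OF _ t(1)] r(2) C(2) by (auto simp: t(2) \<Phi>_def)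
    ultimately have "openin (top_of_set ?S) T"
      by (simp add: openin_diff)
    moreover have "?S \<subseteq> closure T"
    proof -
      have "ball w0 r \<subseteq> closure T"
      proof (rule ccontr)
        assume "\<not> ball w0 r \<subseteq> closure T"
        then have ne: "ball w0 r - closure T \<noteq> {}" by blast
        have o: "open (ball w0 r - closure T)" by auto
        have sub: "ball w0 r - closure T \<subseteq> W" using r ball_subset_cball by blast
        have "\<Phi> t ` (ball w0 r - closure T) \<subseteq> interior (\<Phi> t ` (ball w0 r - closure T))"
        proof
          fix y assume "y \<in> \<Phi> t ` (ball w0 r - closure T)"
          then obtain w where w: "w \<in> ball w0 r - closure T" "y = \<Phi> t w" by blast
          then have wW: "w \<in> W" using sub by blast
          obtain k where k: "bounded_linear k" "(\<lambda>h. (1 - t) *\<^sub>R G' w h + t *\<^sub>R h) \<circ> k = id"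
            using surj[OF wW t(1)] by blast
          show "y \<in> interior (\<Phi> t ` (ball w0 r - closure T))"
            unfolding w(2)
            by (rule sussmann_open_mapping[OF W(1) cont wW der[OF wW] k sub])
               (use w(1) o in \<open>simp add: interior_open\<close>)
        qed
        then have "open (\<Phi> t ` (ball w0 r - closure T))"
          by (metis interior_subset open_interior subset_antisym)
        moreover have "\<Phi> t ` (ball w0 r - closure T) \<subseteq> B"
          using t(2) closure_subset[of T] by auto
        ultimately show False using nd ne by blast
      qed
      then have "closure (ball w0 r) \<subseteq> closure T" by (simp add: closure_minimal)
      then show ?thesis using r by simp
    qed
    ultimately show "openin (top_of_set ?S) T \<and> ?S \<subseteq> closure T" by blast
  qed auto
  moreover have "?S \<noteq> {}" using r by auto
  ultimately obtain w where w: "w \<in> \<Inter>\<G>"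
    by (metis closure_empty ex_in_conv subset_empty)
  \<comment> \<open>Some member of \<open>\<G>\<close> is needed to place \<open>w\<close> in the
    ball, and the parameter 0 provides one.\<close>
  have "0 \<in> \<rat> \<inter> {0..1::real}" by auto
  then have "{w \<in> ?S. \<Phi> 0 w \<notin> B} \<in> \<G>" unfolding \<G>_def by (rule imageI)
  then have "w \<in> W" using w r by blast
  moreover have "\<Phi> t w \<notin> B" if "t \<in> \<rat>" "t \<in> {0..1}" for t
    using w that unfolding \<G>_def by blast
  ultimately show thesis using that by (simp add: \<Phi>_def)
qed

text \<open>The inverse function theorem, with the derivative of \<open>g\<close> recorded as a
  two-sided inverse of the Jacobian, the form in which \<open>invertible_interpolation\<close> takes
  it.\<close>

lemma local_inverse:
  fixes f :: "real ^ 'n \<Rightarrow> real ^ 'n"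
  assumes S: "open S" and f: "C1_immersion_on f S" and p: "p \<in> S"
  obtains U' V g where "open U'" "U' \<subseteq> S" "p \<in> U'" "open V" "f p \<in> V"
    "\<And>y. y \<in> V \<Longrightarrow> g y \<in> U' \<and> f (g y) = y"
    "\<And>y. y \<in> V \<Longrightarrow> \<exists>g'. (g has_derivative g') (at y) \<and>
       (\<forall>x. g' (jacobian f (at (g y)) *v x) = x) \<and> (\<forall>x. jacobian f (at (g y)) *v g' x = x)"
proof -
  define f' where "f' x = Blinfun (\<lambda>h. jacobian f (at x) *v h)" for x
  have f'app: "blinfun_apply (f' x) = (\<lambda>h. jacobian f (at x) *v h)" for x
    unfolding f'_def by (rule bounded_linear_Blinfun_apply) (rule matrix_vector_mul_bounded_linear)
  have der: "(f has_derivative blinfun_apply (f' x)) (at x)" if "x \<in> S" for x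
    unfolding f'app using f that by (auto simp: C1_immersion_on_def C1_on_def intro: jacobian_derivative)
  have inv: "invertible (jacobian f (at x))" if "x \<in> S" for x
    using f that by (simp add: C1_immersion_on_def)
  have cont: "continuous_on S f'"
  proof (rule continuous_on_blinfun_componentwise)
    fix i :: "real ^ 'n"
    have "continuous_on S (\<lambda>x. jacobian f (at x))"
      using f by (simp add: C1_immersion_on_def C1_on_def)
    moreover have "linear (\<lambda>M :: real ^ 'n ^ 'n. M *v i)"
      by (auto intro!: linearI simp: matrix_vector_mult_add_rdistrib scaleR_matrix_vector_assoc)
    ultimately show "continuous_on S (\<lambda>x. blinfun_apply (f' x) i)"
      unfolding f'app by (rule linear_continuous_on_compose)
  qed
  obtain A' where A': "A' ** jacobian f (at p) = mat 1"
    using inv[OF p] by (auto simp: invertible_def)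
  have invf: "Blinfun (\<lambda>h. A' *v h) o\<^sub>L f' p = id_blinfun"
    by (rule blinfun_eqI)
       (simp add: f'app bounded_linear_Blinfun_apply matrix_vector_mul_bounded_linear matrix_vector_mul_assoc A')
  obtain U' V g g' where *: "open U'" "U' \<subseteq> S" "p \<in> U'" "open V" "f p \<in> V" "homeomorphism U' V f g"
    "\<And>y. y \<in> V \<Longrightarrow> (g has_derivative (g' y)) (at y)"
    "\<And>y. y \<in> V \<Longrightarrow> g' y = inv (blinfun_apply (f'(g y)))"
    "\<And>y. y \<in> V \<Longrightarrow> bij (blinfun_apply (f'(g y)))"
    by (rule inverse_function_theorem[OF S der cont p invf]) (assumption, rule that)
  show thesis
  proof (rule that[OF *(1-5)])
    show "g y \<in> U' \<and> f (g y) = y" if "y \<in> V" for y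
      using *(6) that by (auto simp: homeomorphism_def)
    fix y assume y: "y \<in> V"
    have "g' y (jacobian f (at (g y)) *v x) = x" "jacobian f (at (g y)) *v g' y x = x" for x
      using *(8)[OF y] *(9)[OF y] by (simp_all add: f'app bij_is_inj bij_is_surj inv_f_f surj_f_inv_f)
    then show "\<exists>g'. (g has_derivative g') (at y) \<and>
       (\<forall>x. g' (jacobian f (at (g y)) *v x) = x) \<and> (\<forall>x. jacobian f (at (g y)) *v g' x = x)"
      using *(7)[OF y] by blast
  qed
qed

text \<open>Only \<open>p\<close> has to avoid \<open>B\<close>: the segments used below end at
  nearby points instead of \<open>q\<close>, and these can be taken off \<open>B\<close> because
  \<open>B\<close> has empty interior.\<close>

lemma no_fold_outside_exceptional_set:
  fixes U B :: "(real ^ 'n) set" and f :: "real ^ 'n \<Rightarrow> real ^ 'n"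
  assumes "convex U" and "open U" and cf: "continuous_on U f" and tame: "tame_on U f"
    and B: "closedin (top_of_set U) B" and nd: "\<And>S. open S \<Longrightarrow> S \<subseteq> B \<Longrightarrow> S = {}"
    and C1: "C1_immersion_on f (U - B)"
    and hull: "\<forall>A \<in> convex hull ((\<lambda>x. jacobian f (at x)) ` (U - B)). invertible A"
    and p: "p \<in> U - B" and q: "q \<in> U" and fpq: "f p = f q"
  shows "p = q"
proof (rule ccontr)
  assume "p \<noteq> q"
  define J where "J x = jacobian f (at x)" for x
  \<comment> \<open>Half the distance makes the balls around \<open>p\<close> and \<open>q\<close>
    disjoint, so that \<open>G w\<close> and \<open>w\<close> below never coincide.\<close>
  define r where "r = dist p q / 2"
  have r: "r > 0" using \<open>p \<noteq> q\<close> by (simp add: r_def)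
  have disj: "x \<noteq> y" if "x \<in> ball p r" "y \<in> ball q r" for x y
    using that dist_triangle_half_r[of x p "dist p q" q] by (auto simp: r_def dist_commute)
  have oUB: "open (U - B)"
  proof -
    obtain C where "closed C" "B = U \<inter> C" using B by (auto simp: closedin_closed)
    moreover from this have "U - B = U - C" by blast
    ultimately show ?thesis using \<open>open U\<close> by auto
  qed
  have dJ: "(f has_derivative (\<lambda>h. J x *v h)) (at x)" if "x \<in> U - B" for x
    using C1 that unfolding J_def by (intro jacobian_derivative) (simp add: C1_immersion_on_def C1_on_def)
  define S where "S = (U - B) \<inter> ball p r"
  have S: "C1_immersion_on f S"
    using C1 by (auto simp: C1_immersion_on_def C1_on_def S_def intro: continuous_on_subset)
  have oS: "open S" and pS: "p \<in> S" using oUB p r by (auto simp: S_def)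
  obtain U' V g where U': "open U'" "U' \<subseteq> S" "p \<in> U'" "open V" "f p \<in> V"
    and g: "\<And>y. y \<in> V \<Longrightarrow> g y \<in> U' \<and> f (g y) = y"
    and dg: "\<And>y. y \<in> V \<Longrightarrow> \<exists>g'. (g has_derivative g') (at y) \<and>
       (\<forall>x. g' (jacobian f (at (g y)) *v x) = x) \<and> (\<forall>x. jacobian f (at (g y)) *v g' x = x)"
    by (rule local_inverse[OF oS S pS]) (rule that)
  obtain g' where g': "\<And>y. y \<in> V \<Longrightarrow> (g has_derivative g' y) (at y)"
    "\<And>y x. y \<in> V \<Longrightarrow> g' y (J (g y) *v x) = x" "\<And>y x. y \<in> V \<Longrightarrow> J (g y) *v g' y x = x"
    using dg unfolding J_def by metis
  define W0 where "W0 = (U \<inter> f -` V) \<inter> ball q r"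
  have "open W0"
    unfolding W0_def using continuous_open_preimage[OF cf \<open>open U\<close> U'(4)] by auto
  moreover have "q \<in> W0" using q U'(5) fpq r by (simp add: W0_def)
  ultimately have nW: "\<not> W0 \<subseteq> B" using nd by blast
  define W where "W = W0 \<inter> (U - B)"
  have W: "open W" "W \<noteq> {}" using \<open>open W0\<close> oUB nW by (auto simp: W_def W0_def)
  have WU: "w \<in> U - B" "f w \<in> V" "w \<in> ball q r" if "w \<in> W" for w
    using that by (auto simp: W_def W0_def)
  define G where "G w = g (f w)" for w
  have GU: "G w \<in> U - B" "f (G w) = f w" "G w \<noteq> w" if "w \<in> W" for w
  proof -
    have *: "G w \<in> S" "f (G w) = f w" using g[OF WU(2)[OF that]] U'(2) by (auto simp: G_def)
    then show "G w \<in> U - B" "f (G w) = f w" by (auto simp: S_def)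
    show "G w \<noteq> w" by (rule disj[OF _ WU(3)[OF that]]) (use * in \<open>simp add: S_def\<close>)
  qed
  have dG: "(G has_derivative (\<lambda>h. g' (f w) (J w *v h))) (at w)" if "w \<in> W" for w
    unfolding G_def using diff_chain_at[OF dJ[OF WU(1)[OF that]] g'(1)[OF WU(2)[OF that]]] by (simp add: o_def)
  have inU: "(1 - t) *\<^sub>R G w + t *\<^sub>R w \<in> U" if "w \<in> W" "t \<in> {0..1}" for w t
    using convexD[OF \<open>convex U\<close>, of "G w" w "1 - t" t] GU(1)[OF that(1)] WU(1)[OF that(1)] that(2) by auto
  have surj: "\<exists>k. bounded_linear k \<and> (\<lambda>h. (1 - t) *\<^sub>R g' (f w) (J w *v h) + t *\<^sub>R h) \<circ> k = id"
    if wt: "w \<in> W" "t \<in> {0..1}" for w t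
  proof -
    note V = WU(2)[OF wt(1)]
    have lin: "linear (g' (f w))" using g'(1)[OF WU(2)[OF wt(1)]] has_derivative_linear by blast
    have "J w \<in> convex hull (J ` (U - B))" "J (G w) \<in> convex hull (J ` (U - B))"
      using WU(1) GU(1) wt(1) by (auto intro: hull_inc)
    then have "(1 - t) *\<^sub>R J w + t *\<^sub>R J (G w) \<in> convex hull (J ` (U - B))"
      using wt(2) by (intro convexD[OF convex_convex_hull]) auto
    then have inv: "invertible ((1 - t) *\<^sub>R J w + t *\<^sub>R J (G w))"
      using hull by (simp add: J_def)
    obtain k where "bounded_linear k" "(\<lambda>h. (1 - t) *\<^sub>R g' (f w) (J w *v h) + t *\<^sub>R h) \<circ> k = id"
      by (rule invertible_interpolation[OF lin g'(2)[OF V, folded G_def] g'(3)[OF V, folded G_def] inv])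
    then show "\<exists>k. bounded_linear k \<and> (\<lambda>h. (1 - t) *\<^sub>R g' (f w) (J w *v h) + t *\<^sub>R h) \<circ> k = id"
      by blast
  qed
  obtain w where w: "w \<in> W" "\<And>t. t \<in> \<rat> \<Longrightarrow> t \<in> {0..1} \<Longrightarrow> (1 - t) *\<^sub>R G w + t *\<^sub>R w \<notin> B"
    by (rule ex_avoiding_segment[OF W dG surj inU B nd]) (assumption | rule that)+
  define v where "v = w - G w"
  have v0: "v \<noteq> 0" using GU(3)[OF w(1)] by (simp add: v_def)
  define \<gamma> where "\<gamma> t = G w + t *\<^sub>R v" for t
  have \<gamma>: "\<gamma> t = (1 - t) *\<^sub>R G w + t *\<^sub>R w" for t by (simp add: \<gamma>_def v_def algebra_simps)
  have \<gamma>U: "\<gamma> t \<in> U" if "t \<in> {0..1}" for t using inU[OF w(1) that] by (simp add: \<gamma>)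
  have c\<gamma>: "continuous_on X \<gamma>" for X unfolding \<gamma>_def by (intro continuous_intros)
  define Q where "Q = {0<..<1} \<inter> \<gamma> -` (U - B)"
  have oQ: "open Q" unfolding Q_def using oUB c\<gamma> by (intro open_Int open_vimage) auto
  have ratQ: "t \<in> Q" if "t \<in> \<rat>" "t \<in> {0<..<1}" for t
    using w(2)[of t] \<gamma>U[of t] that by (simp add: Q_def \<gamma>)
  have half: "1 / 2 \<in> Q" by (rule ratQ) auto
  define K where "K = (\<lambda>t. J (\<gamma> t) *v v) ` Q"
  \<comment> \<open>Applying matrices to \<open>v\<close> is linear, so an element of the hull of
    \<open>K\<close> is \<open>A *v v\<close> with \<open>A\<close> in the hull of the Jacobians;
    such an \<open>A\<close> is invertible and does not annihilate \<open>v\<close>.\<close>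
  have "0 \<notin> convex hull K"
  proof
    assume "0 \<in> convex hull K"
    moreover have "K \<subseteq> (\<lambda>A. A *v v) ` (J ` (U - B))" by (auto simp: K_def Q_def)
    ultimately have "0 \<in> convex hull ((\<lambda>A. A *v v) ` (J ` (U - B)))"
      using hull_mono by blast
    moreover have "linear (\<lambda>A :: real ^ 'n ^ 'n. A *v v)"
      by (auto intro!: linearI simp: matrix_vector_mult_add_rdistrib scaleR_matrix_vector_assoc)
    ultimately have "0 \<in> (\<lambda>A. A *v v) ` (convex hull (J ` (U - B)))"
      by (simp add: convex_hull_linear_image)
    then obtain A where A: "A \<in> convex hull (J ` (U - B))" "A *v v = 0" by auto
    then have "invertible A" using hull by (simp add: J_def)
    then obtain A' where "A' ** A = mat 1" by (auto simp: invertible_def)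
    then have "v = A' *v (A *v v)" by (simp add: matrix_vector_mul_assoc)
    then show False using A(2) v0 by simp
  qed
  moreover have "convex hull K \<noteq> {}" using half by (auto simp: K_def)
  ultimately obtain a where a: "a \<in> span (convex hull K)" "a \<noteq> 0" "\<And>x. x \<in> convex hull K \<Longrightarrow> 0 \<le> a \<bullet> x"
    using separating_hyperplane_set_0_inspan[OF convex_convex_hull, of K] by metis
  define h where "h = (\<lambda>t. a \<bullet> f (G w + t *\<^sub>R v))"
  have h\<gamma>: "h t = a \<bullet> f (\<gamma> t)" for t by (simp add: h_def \<gamma>_def)
  have dh: "(h has_real_derivative a \<bullet> (J (\<gamma> t) *v v)) (at t)" if "t \<in> Q" for t
  proof -
    have "(\<gamma> has_derivative (\<lambda>s. s *\<^sub>R v)) (at t)"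
      unfolding \<gamma>_def by (auto intro!: derivative_eq_intros)
    from diff_chain_at[OF this dJ[of "\<gamma> t"]] that
    have "((\<lambda>t. f (\<gamma> t)) has_derivative (\<lambda>s. J (\<gamma> t) *v (s *\<^sub>R v))) (at t)"
      by (simp add: o_def Q_def)
    then have "(h has_derivative (\<lambda>s. a \<bullet> (J (\<gamma> t) *v (s *\<^sub>R v)))) (at t)"
      unfolding h\<gamma>[abs_def] by (intro derivative_intros)
    then show ?thesis
      by (simp add: has_field_derivative_def matrix_vector_mult_scaleR mult_commute_abs)
  qed
  have nonneg: "0 \<le> a \<bullet> (J (\<gamma> t) *v v)" if "t \<in> Q" for t
    by (rule a(3), rule hull_inc) (use that in \<open>simp add: K_def\<close>)
  have lm: "locally_mono_at h t" if t: "t \<in> Q" for t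
  proof -
    obtain \<epsilon> where \<epsilon>: "\<epsilon> > 0" "ball t \<epsilon> \<subseteq> Q" using oQ t open_contains_ball by blast
    have "mono_on {t - \<epsilon><..<t + \<epsilon>} h"
    proof (rule mono_onI)
      fix x y assume xy: "x \<in> {t - \<epsilon><..<t + \<epsilon>}" "y \<in> {t - \<epsilon><..<t + \<epsilon>}" "x \<le> y"
      show "h x \<le> h y"
      proof (rule DERIV_nonneg_imp_nondecreasing[OF xy(3)])
        fix z assume "x \<le> z" "z \<le> y"
        then have "z \<in> Q" using xy \<epsilon> by (auto simp: dist_real_def subset_iff)
        then show "\<exists>d. (h has_real_derivative d) (at z) \<and> d \<ge> 0" using dh nonneg by blast
      qed
    qed
    then show ?thesis using \<epsilon>(1) by (auto simp: locally_mono_at_def)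
  qed
  have dense: "{0<..<1} \<subseteq> closure {t. locally_mono_at h t}"
  proof
    fix t :: real assume t: "t \<in> {0<..<1}"
    show "t \<in> closure {t. locally_mono_at h t}"
      unfolding closure_approachable
    proof (intro allI impI)
      fix e :: real assume "e > 0"
      then have "t < min (t + e) 1" using t by auto
      then obtain s where s: "s \<in> \<rat>" "t < s" "s < min (t + e) 1" using Rats_dense_in_real by blast
      then have "s \<in> Q" using t by (intro ratQ) auto
      then show "\<exists>y\<in>{t. locally_mono_at h t}. dist y t < e"
        using s lm by (intro bexI[of _ s]) (auto simp: dist_real_def)
    qed
  qed
  have ctbl: "countable ({0<..<1} - {t. locally_mono_at h t})"
    by (rule tame_line[OF tame v0 _ h_def dense]) (use \<gamma>U in \<open>simp add: \<gamma>_def\<close>)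
  have ch: "continuous_on {0..1} h"
    unfolding h\<gamma>[abs_def]
    by (intro continuous_on_inner continuous_on_const continuous_on_compose2[OF cf c\<gamma>]) (use \<gamma>U in auto)
  have mono: "h s \<le> h t" if "0 \<le> s" "s \<le> t" "t \<le> 1" for s t
  proof (rule mono_on_countable_exceptions[OF that(2)])
    show "continuous_on {s..t} h" by (rule continuous_on_subset[OF ch]) (use that in auto)
    show "countable ({s<..<t} - {t. locally_mono_at h t})"
      by (rule countable_subset[OF _ ctbl]) (use that in auto)
  qed
  have "h 0 = h 1" using GU(2)[OF w(1)] by (simp add: h_def v_def)
  then have const: "h t = h 0" if "t \<in> {0..1}" for t
    using mono[of 0 t] mono[of t 1] that by auto
  have perp: "a \<bullet> (J (\<gamma> t) *v v) = 0" if t: "t \<in> Q" for t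
  proof -
    have "(h has_real_derivative 0) (at t)"
    proof (rule has_field_derivative_transform_within_open[where f = "\<lambda>_. h 0"])
      show "open {0<..<1::real}" "t \<in> {0<..<1}" using t by (auto simp: Q_def)
      show "h 0 = h s" if "s \<in> {0<..<1}" for s
        using that by (intro const[symmetric]) auto
    qed simp
    then show ?thesis using dh[OF t] DERIV_unique by blast
  qed
  \<comment> \<open>As \<open>a\<close> belongs to the span of this hull, it would be orthogonal to
    itself.\<close>
  have "convex hull K \<subseteq> {x. a \<bullet> x = 0}"
    by (rule hull_minimal) (auto simp: K_def perp convex_hyperplane)
  then have "span (convex hull K) \<subseteq> {x. a \<bullet> x = 0}"
    by (intro span_minimal subspace_hyperplane)
  then show False using a(1,2) by auto
qed

theorem theorem3p3:
  fixes U B :: "(real ^ 'n) set"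
    and f :: "real ^ 'n \<Rightarrow> real ^ 'n"
  assumes "convex U" and "open U"
    and "continuous_on U f" and "tame_on U f"
    and "closedin (top_of_set U) B" and "nowhere_dense_in (top_of_set U) B"
    and "C1_immersion_on f (U - B)"
    and "\<forall>A \<in> convex hull ((\<lambda>x. jacobian f (at x)) ` (U - B)). invertible A"
    and "inj_on f B"
  shows "inj_on f U"
proof (rule inj_onI)
  have nd: "S = {}" if "open S" "S \<subseteq> B" for S
    using nowhere_dense_interior assms(2,5,6) that by blast
  note * = no_fold_outside_exceptional_set[OF assms(1-5) nd assms(7,8)]
  fix p q assume pq: "p \<in> U" "q \<in> U" "f p = f q"
  consider "p \<in> U - B" | "q \<in> U - B" | "p \<in> B" "q \<in> B" using pq by blast
  then show "p = q"
  proof cases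
    case 1
    then show ?thesis using *[of p q] pq by simp
  next
    case 2
    then show ?thesis using *[of q p] pq by simp
  next
    case 3
    then show ?thesis using assms(9) pq by (simp add: inj_on_eq_iff)
  qed
qed


end
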